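(* Let $1\le p,q<\infty$. The normalized bi-parameter Haar system $\big(h_I\otimes h_J/(|I|^{1/p}|J|^{1/q})\big)_{I\times J\in\mathcal R_2}$, linearly ordered by $\lhd$, is strategically reproducible in the mixed norm Hardy space $H^p(H^q)$.
   Context: All Banach spaces are real. $\mathcal D$ is the set of dyadic intervals $[\frac{i-1}{2^j},\frac{i}{2^j})$, $j\ge0$, $1\le i\le2^j$; for $I\in\mathcal D$ with left half $I^+$ and right half $I^-$, $h_I=\chi_{I^+}-\chi_{I^-}$. $\mathcal R_2=\{I\times J:I,J\in\mathcal D\}$ and $h_{I\times J}(s,t)=(h_I\otimes h_J)(s,t)=h_I(s)h_J(t)$. $H^p(H^q)$ is the completion of $\mathrm{span}\{h_{\bar I}:\bar I\in\mathcal R_2\}$ under the norm $\|\sum a_{\bar I}h_{\bar I}\|_{H^p(H^q)}=\big\|(\sum a_{\bar I}^2h_{\bar I}^2)^{1/2}\big\|_{L^p(L^q)}$. The normalized bi-parameter Haar system is a $1$-unconditional basis of it. The order $\lhd$: let $\mathcal O_{\mathbb N_0^2}(m,n)=n^2+m$ if $m<n$ and $m^2+m+n$ if $m\ge n$ (a bijection $\mathbb N_0^2\to\mathbb N_0$). For $I_k\times J_k\in\mathcal R_2$ with $|I_k|=2^{-m_k}$, $|J_k|=2^{-n_k}$, $k=0,1$, one has $I_0\times J_0\lhd I_1\times J_1$ iff $(\mathcal O_{\mathbb N_0^2}(m_0,n_0),\inf I_0,\inf J_0)$ is smaller than $(\mathcal O_{\mathbb N_0^2}(m_1,n_1),\inf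 I_1,\inf J_1)$ in the lexicographic order of $\mathbb R^3$. This enumerates $\mathcal R_2$ as a sequence. Impartial equivalence: sequences $(x_i)$, $(y_i)$ in Banach spaces are impartially $C$-equivalent if $\frac1{\sqrt C}\|\sum a_iy_i\|\le\|\sum a_ix_i\|\le\sqrt C\|\sum a_iy_i\|$ for all finitely supported real sequences $(a_i)$. Strategical reproducibility (for unconditional bases): let $X$ be a Banach space with an unconditional basis $(e_i)_{i\in\mathbb N}$ and biorthogonal functionals $(e_i^* )\subset X^*$. $\mathrm{cof}(X)$ is the set of closed finite-codimensional subspaces of $X$ and $\mathrm{cof}_{w^*}(X^* )$ the set of $w^*$-closed finite-codimensional subspaces of $X^*$. For $C\ge1$ the two-player game $\mathrm{Rep}_{(X,(e_i))}(C)$ has turns $k\in\mathbb N$, each with three steps. Step 1: player (I) chooses $\eta_k>0$, $W_k\in\mathrm{cof}(X)$, $G_k\in\mathrm{cof}_{w^*}(X^* )$. Step 2: player (II) chooses a finite set $E_k\subset\mathbb N$ and non-negative reals $(\lambda_i^{(k)})_{i\in E_k}$, $(\mu_i^{(k)})_{i\in E_k}$ with $\sum_{i\in E_k}\lambda_i^{(k)}\mu_i^{(k)}=1$. Step 3: player (I) chooses signs $(\varepsilon_i^{(k)})_{i\in E_k}\in\{-1,1\}^{E_k}$. Put $x_k=\sum_{i\in E_k}\varepsilon_i^{(k)}\lambda_i^{(k)}e_i$, $x_k^*=\sum_{i\in E_k}\varepsilon_i^{(k)}\mu_i^{(k)}e_i^*$. Player (II) wins if (i) $(x_k)$ and $(e_k)$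 are impartially $C$-equivalent; (ii) $(x_k^* )$ and $(e_k^* )$ are impartially $C$-equivalent; (iii) $\mathrm{dist}(x_k,W_k)<\eta_k$ for all $k$; (iv) $\mathrm{dist}(x_k^*,G_k)<\eta_k$ for all $k$. The basis is $C$-strategically reproducible if for every $\eta>0$ player (II) has a winning strategy in $\mathrm{Rep}_{(X,(e_i))}(C+\eta)$, and strategically reproducible if it is $C$-strategically reproducible for some $C\ge1$. *)

theory Defs
  imports "HOL-Analysis.Analysis"
begin

section \<open>The bi-parameter Haar system\<close>

definition dyadic_intervals :: "real set set" where
  "dyadic_intervals = {{(real i - 1) / 2 ^ j ..< real i / 2 ^ j} | i j :: nat. 1 \<le> i \<and> i \<le> 2 ^ j}"

abbreviation ilen :: "real set \<Rightarrow> real" where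
  "ilen I \<equiv> measure lborel I"

definition left_half :: "real set \<Rightarrow> real set" where
  "left_half I = {Inf I ..< (Inf I + Sup I) / 2}"

definition right_half :: "real set \<Rightarrow> real set" where
  "right_half I = {(Inf I + Sup I) / 2 ..< Sup I}"

definition haar :: "real set \<Rightarrow> real \<Rightarrow> real" where
  "haar I s = indicator (left_half I) s - indicator (right_half I) s"

text \<open>A dyadic rectangle \<open>I \<times> J\<close> is represented by the pair \<open>(I, J)\<close> of its sides.\<close>

type_synonym rect = "real set \<times> real set"

definition dyadic_rects :: "rect set" where
  "dyadic_rects = dyadic_intervals \<times> dyadic_intervals"

definition haar2 :: "rect \<Rightarrow> real \<times> real \<Rightarrow> real" where
  "haar2 R x = haar (fst R) (fst x) * haar (snd R) (snd x)"

definition normalized_haar2 :: "real \<Rightarrow> real \<Rightarrow> rect \<Rightarrow> real \<times> real \<Rightarrow> real" where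
  "normalized_haar2 p q R x = haar2 R x / (ilen (fst R) powr (1 / p) * ilen (snd R) powr (1 / q))"

section \<open>The linear order on dyadic rectangles\<close>

definition ord_N2 :: "nat \<Rightarrow> nat \<Rightarrow> nat" where
  "ord_N2 m n = (if m < n then n\<^sup>2 + m else m\<^sup>2 + m + n)"

definition rect_less :: "rect \<Rightarrow> rect \<Rightarrow> bool" (infix \<open>\<lhd>\<^sub>R\<close> 50) where
  "R0 \<lhd>\<^sub>R R1 \<longleftrightarrow> (\<exists>m0 n0 m1 n1.
      ilen (fst R0) = 1 / 2 ^ m0 \<and> ilen (snd R0) = 1 / 2 ^ n0 \<and>
      ilen (fst R1) = 1 / 2 ^ m1 \<and> ilen (snd R1) = 1 / 2 ^ n1 \<and>
      ((ord_N2 m0 n0, Inf (fst R0), Inf (snd R0)), (ord_N2 m1 n1, Inf (fst R1), Inf (snd R1)))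
        \<in> {(x, y). x < y} <*lex*> {(x, y). x < y} <*lex*> {(x, y). x < y})"

definition rect_enum :: "nat \<Rightarrow> rect" where
  "rect_enum = (THE \<rho>. bij_betw \<rho> UNIV dyadic_rects \<and> (\<forall>k l. k < l \<longrightarrow> \<rho> k \<lhd>\<^sub>R \<rho> l))"

section \<open>The mixed norm Hardy space\<close>

definition mixed_norm :: "real \<Rightarrow> real \<Rightarrow> (real \<times> real \<Rightarrow> real) \<Rightarrow> real" where
  "mixed_norm p q f =
     (LBINT s:{0..<1}. (LBINT t:{0..<1}. \<bar>f (s, t)\<bar> powr q) powr (p / q)) powr (1 / p)"

definition haar_sum :: "rect set \<Rightarrow> (rect \<Rightarrow> real) \<Rightarrow> real \<times> real \<Rightarrow> real" where
  "haar_sum F a x = (\<Sum>R\<in>F. a R * haar2 R x)"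

definition Hpq_norm :: "real \<Rightarrow> real \<Rightarrow> rect set \<Rightarrow> (rect \<Rightarrow> real) \<Rightarrow> real" where
  "Hpq_norm p q F a = mixed_norm p q (\<lambda>x. sqrt (\<Sum>R\<in>F. (a R)\<^sup>2 * (haar2 R x)\<^sup>2))"

definition haar_span :: "(real \<times> real \<Rightarrow> real) set" where
  "haar_span = {haar_sum F a | F a. finite F \<and> F \<subseteq> dyadic_rects}"

text \<open>\<open>Hpq_completion p q \<iota>\<close> says that the Banach space \<open>'a\<close>, together with the canonical
  map \<open>\<iota>\<close> from the span of the Haar functions, is a completion of that span in the norm of
  \<open>H\<^sup>p(H\<^sup>q)\<close>: \<open>\<iota>\<close> is linear on the span, isometric, and has dense range. Such a completion is unique
  up to isometric isomorphism. A single type cannot serve, as the space depends on the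
  reals \<open>p\<close> and \<open>q\<close>. Values of \<open>\<iota>\<close> off the span are irrelevant.\<close>

definition Hpq_completion ::
    "real \<Rightarrow> real \<Rightarrow> ((real \<times> real \<Rightarrow> real) \<Rightarrow> 'a::banach) \<Rightarrow> bool" where
  "Hpq_completion p q \<iota> \<longleftrightarrow>
     (\<forall>f\<in>haar_span. \<forall>g\<in>haar_span. \<iota> (\<lambda>x. f x + g x) = \<iota> f + \<iota> g) \<and>
     (\<forall>c. \<forall>f\<in>haar_span. \<iota> (\<lambda>x. c * f x) = c *\<^sub>R \<iota> f) \<and>
     (\<forall>F a. finite F \<and> F \<subseteq> dyadic_rects \<longrightarrow> norm (\<iota> (haar_sum F a)) = Hpq_norm p q F a) \<and>
     closure (\<iota> ` haar_span) = UNIV"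

section \<open>Unconditional bases and impartial equivalence\<close>

definition schauder_basis :: "(nat \<Rightarrow> 'a::banach) \<Rightarrow> bool" where
  "schauder_basis e \<longleftrightarrow> (\<forall>x. \<exists>!a :: nat \<Rightarrow> real. (\<lambda>i. a i *\<^sub>R e i) sums x)"

text \<open>The predicate \<open>has_sum\<close> is convergence of the net of finite partial sums, i.e. unconditional
  convergence.\<close>

definition unconditional_basis :: "(nat \<Rightarrow> 'a::banach) \<Rightarrow> bool" where
  "unconditional_basis e \<longleftrightarrow> schauder_basis e \<and>
     (\<forall>(a :: nat \<Rightarrow> real) x. (\<lambda>i. a i *\<^sub>R e i) sums x \<longrightarrow> ((\<lambda>i. a i *\<^sub>R e i) has_sum x) UNIV)"

definition biorthogonal_functionals :: "(nat \<Rightarrow> 'a::banach) \<Rightarrow> nat \<Rightarrow> 'a \<Rightarrow>\<^sub>L real" where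
  "biorthogonal_functionals e =
     (THE e'. \<forall>i j. blinfun_apply (e' i) (e j) = (if i = j then 1 else 0))"

definition impartially_equivalent ::
    "real \<Rightarrow> (nat \<Rightarrow> 'a::real_normed_vector) \<Rightarrow> (nat \<Rightarrow> 'b::real_normed_vector) \<Rightarrow> bool" where
  "impartially_equivalent C x y \<longleftrightarrow> (\<forall>a :: nat \<Rightarrow> real. finite {i. a i \<noteq> 0} \<longrightarrow>
     1 / sqrt C * norm (\<Sum>i | a i \<noteq> 0. a i *\<^sub>R y i) \<le> norm (\<Sum>i | a i \<noteq> 0. a i *\<^sub>R x i) \<and>
     norm (\<Sum>i | a i \<noteq> 0. a i *\<^sub>R x i) \<le> sqrt C * norm (\<Sum>i | a i \<noteq> 0. a i *\<^sub>R y i))"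

section \<open>The game and strategical reproducibility\<close>

definition finite_codim_subspace :: "'a::real_vector set \<Rightarrow> bool" where
  "finite_codim_subspace W \<longleftrightarrow> subspace W \<and> (\<exists>B. finite B \<and> span (W \<union> B) = UNIV)"

definition cof :: "'a::real_normed_vector set set" where
  "cof = {W. closed W \<and> finite_codim_subspace W}"

text \<open>For scalar-valued operators, \<open>strong_operator_topology\<close> (pointwise convergence on \<open>'a\<close>) is the
  weak-star topology of the dual.\<close>

definition cof_wstar :: "('a::real_normed_vector \<Rightarrow>\<^sub>L real) set set" where
  "cof_wstar = {G. closedin strong_operator_topology G \<and> finite_codim_subspace G}"

text \<open>The moves of step 1, namely \<open>(\<eta>, W, G)\<close>, of step 2, namely \<open>(E, \<lambda>, \<mu>)\<close>, and of step 3, the signs.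
  Values of \<open>\<lambda>\<close> and \<open>\<mu>\<close> off \<open>E\<close> are irrelevant; sign families are required to be \<open>undefined\<close> off
  \<open>E\<close>, so that they carry no information beyond the signs on \<open>E\<close>.\<close>

type_synonym 'a move1 = "real \<times> 'a set \<times> ('a \<Rightarrow>\<^sub>L real) set"
type_synonym move2 = "nat set \<times> (nat \<Rightarrow> real) \<times> (nat \<Rightarrow> real)"
type_synonym move3 = "nat \<Rightarrow> real"

definition legal1 :: "'a::real_normed_vector move1 \<Rightarrow> bool" where
  "legal1 = (\<lambda>(\<eta>, W, G). 0 < \<eta> \<and> W \<in> cof \<and> G \<in> cof_wstar)"

definition legal2 :: "move2 \<Rightarrow> bool" where
  "legal2 = (\<lambda>(E, l, u). finite E \<and> (\<forall>i\<in>E. 0 \<le> l i \<and> 0 \<le> u i) \<and> (\<Sum>i\<in>E. l i * u i) = 1)"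

definition legal3 :: "move2 \<Rightarrow> move3 \<Rightarrow> bool" where
  "legal3 = (\<lambda>(E, l, u) \<epsilon>. \<epsilon> \<in> PiE E (\<lambda>_. {-1, 1}))"

definition game_vec :: "(nat \<Rightarrow> 'a::banach) \<Rightarrow> move2 \<Rightarrow> move3 \<Rightarrow> 'a" where
  "game_vec e = (\<lambda>(E, l, u) \<epsilon>. \<Sum>i\<in>E. (\<epsilon> i * l i) *\<^sub>R e i)"

definition game_fun :: "(nat \<Rightarrow> 'a::banach) \<Rightarrow> move2 \<Rightarrow> move3 \<Rightarrow> 'a \<Rightarrow>\<^sub>L real" where
  "game_fun e = (\<lambda>(E, l, u) \<epsilon>. \<Sum>i\<in>E. (\<epsilon> i * u i) *\<^sub>R biorthogonal_functionals e i)"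

definition II_wins ::
    "(nat \<Rightarrow> 'a::banach) \<Rightarrow> real \<Rightarrow> (nat \<Rightarrow> 'a move1) \<Rightarrow> (nat \<Rightarrow> move2) \<Rightarrow> (nat \<Rightarrow> move3) \<Rightarrow> bool" where
  "II_wins e C m1 m2 m3 \<longleftrightarrow>
     impartially_equivalent C (\<lambda>k. game_vec e (m2 k) (m3 k)) e \<and>
     impartially_equivalent C (\<lambda>k. game_fun e (m2 k) (m3 k)) (biorthogonal_functionals e) \<and>
     (\<forall>k. case m1 k of (\<eta>, W, G) \<Rightarrow>
        infdist (game_vec e (m2 k) (m3 k)) W < \<eta> \<and>
        infdist (game_fun e (m2 k) (m3 k)) G < \<eta>)"

text \<open>A strategy of player (II) yields the step 2 move of turn \<open>k\<close> from the step 1 moves of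
  turns \<open>0, \<dots>, k\<close> and the signs of turns \<open>0, \<dots>, k - 1\<close>; the previous moves of player (II)
  are determined by these.\<close>

type_synonym 'a strategy = "'a move1 list \<Rightarrow> move3 list \<Rightarrow> move2"

definition strategy_moves ::
    "'a strategy \<Rightarrow> (nat \<Rightarrow> 'a::real_normed_vector move1) \<Rightarrow> (nat \<Rightarrow> move3) \<Rightarrow> nat \<Rightarrow> move2" where
  "strategy_moves \<sigma> m1 m3 k = \<sigma> (map m1 [0..<Suc k]) (map m3 [0..<k])"

definition winning_strategy :: "(nat \<Rightarrow> 'a::banach) \<Rightarrow> real \<Rightarrow> 'a strategy \<Rightarrow> bool" where
  "winning_strategy e C \<sigma> \<longleftrightarrow>
     (\<forall>m1 m3. (\<forall>k. legal1 (m1 k)) \<and> (\<forall>k. legal3 (strategy_moves \<sigma> m1 m3 k) (m3 k)) \<longrightarrow>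
        (\<forall>k. legal2 (strategy_moves \<sigma> m1 m3 k)) \<and> II_wins e C m1 (strategy_moves \<sigma> m1 m3) m3)"

definition C_strategically_reproducible :: "real \<Rightarrow> (nat \<Rightarrow> 'a::banach) \<Rightarrow> bool" where
  "C_strategically_reproducible C e \<longleftrightarrow>
     unconditional_basis e \<and> (\<forall>\<eta>>0. \<exists>\<sigma>. winning_strategy e (C + \<eta>) \<sigma>)"

definition strategically_reproducible :: "(nat \<Rightarrow> 'a::banach) \<Rightarrow> bool" where
  "strategically_reproducible e \<longleftrightarrow> (\<exists>C\<ge>1. C_strategically_reproducible C e)"

end

theory Submission
  imports Defs
begin

text \<open>The norm of \<open>H\<^sup>p(H\<^sup>q)\<close> sees only the moduli of the Haar coefficients, so the signs of player (I)
never influence it. Player (II) can therefore win with equivalence constant \<open>1\<close>, by answering the basis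
vector of a rectangle \<open>I \<times> J\<close> with a signed multiple of the sum of all Haar functions of one fixed pair of
levels whose supports tile a set \<open>B\<^sub>I \<times> B\<^sub>J\<close>. Here \<open>B\<^sub>I\<close> is the preimage of \<open>I\<close> under a measure preserving map
of \<open>[0,1)\<close>, namely the map that keeps the binary digits at the positions in a set \<open>D\<close> and forgets all
other digits (\<open>read_digits\<close>).

The square function of a combination of such block vectors is the square function of the same combination
of basis vectors, composed with this map in both variables. As the map preserves measure, the block vectors
span an isometric copy of the basis (\<open>norm_blocks_distinct\<close>).

For the functionals one needs that the projection onto the blocks is contractive, that is, that replacing
the moduli of the coefficients on each block by their mean does not increase the norm. For an arbitrary choice
of levels this is an inequality of Stein type, which fails for \<open>p = 1\<close>. It holds here for the following reason.
If the level of the intervals that tile \<open>B\<^sub>I\<close> with \<open>\<bar>I\<bar> = 1 / 2 ^ j\<close> lies between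
the \<open>j\<close>-th and the next element of \<open>D\<close> (\<open>admissible\<close>), then flipping digits at positions outside \<open>D\<close> maps each
block onto itself, and the finite group of these flips acts transitively on it. Up to signs, flips permute the
Haar functions and preserve the norm, so the average over the group is a contraction, by nothing but the triangle
inequality in the completion (\<open>norm_block_averages\<close>).

The closeness to the subspaces of player (I) is obtained by letting one of the two levels tend to infinity while
\<open>D\<close> stays fixed. Then any \<open>n\<close> block vectors for the same rectangle, at different levels, have a sum of norm \<open>\<surd>n\<close> times
the norm of one of them, so a fixed functional is small on all but finitely many of them
(\<open>functional_small_on_late_blocks\<close>). The block functionals are bounded, and each finite combination of basis vectors
is annihilated by all but finitely many of them (\<open>late_block_functionals_small\<close>). Finitely many functionals,
respectively evaluations, control the distance to a closed, respectively weak-star closed, subspace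
of finite codimension.

The order of the basis enters only through the fact that the larger of the two levels of a rectangle never
decreases along it. When it reaches a new value, player (II) adds to \<open>D\<close> a position beyond all levels used so far.
Hence the coordinate in which the rectangle has this maximal level imposes no upper bound on the level of the block,
and the level in the other coordinate can be taken minimal.\<close>

section \<open>Dyadic cells and the mixed norm of step functions\<close>

definition cell :: "nat \<Rightarrow> nat \<Rightarrow> real set" where
  "cell m i = {real i / 2 ^ m ..< (real i + 1) / 2 ^ m}"

lemma dyadic_intervals_eq: "dyadic_intervals = {cell m i | m i. i < 2 ^ m}"
proof -
  have "(\<exists>i j. I = {(real i - 1) / 2 ^ j ..< real i / 2 ^ j} \<and> 1 \<le> i \<and> i \<le> 2 ^ j)
      \<longleftrightarrow> (\<exists>m i. I = cell m i \<and> i < 2 ^ m)" for I :: "real set"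
  proof
    assume "\<exists>i j. I = {(real i - 1) / 2 ^ j ..< real i / 2 ^ j} \<and> 1 \<le> i \<and> i \<le> 2 ^ j"
    then obtain i j where *: "I = {(real i - 1) / 2 ^ j ..< real i / 2 ^ j}" "1 \<le> i" "i \<le> 2 ^ j"
      by blast
    then have "I = cell j (i - 1) \<and> i - 1 < 2 ^ j"
      by (auto simp: cell_def of_nat_diff)
    then show "\<exists>m i. I = cell m i \<and> i < 2 ^ m" by blast
  next
    assume "\<exists>m i. I = cell m i \<and> i < 2 ^ m"
    then obtain m i where *: "I = cell m i" "i < 2 ^ m" by blast
    then have "I = {(real (Suc i) - 1) / 2 ^ m ..< real (Suc i) / 2 ^ m} \<and> 1 \<le> Suc i \<and> Suc i \<le> 2 ^ m"
      by (auto simp: cell_def add.commute)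
    then show "\<exists>i j. I = {(real i - 1) / 2 ^ j ..< real i / 2 ^ j} \<and> 1 \<le> i \<and> i \<le> 2 ^ j" by blast
  qed
  then show ?thesis
    by (auto simp: dyadic_intervals_def)
qed

lemma cell_less: "real i / 2 ^ m < (real i + 1) / 2 ^ m"
  by (simp add: divide_strict_right_mono)

lemma Inf_cell: "Inf (cell m i) = real i / 2 ^ m"
  and Sup_cell: "Sup (cell m i) = (real i + 1) / 2 ^ m"
  using cell_less[of i m] by (simp_all add: cell_def)

lemma ilen_cell: "ilen (cell m i) = 1 / 2 ^ m"
  using cell_less[of i m] by (simp add: cell_def diff_divide_distrib[symmetric])

lemma cell_inject: "cell m i = cell n j \<longleftrightarrow> m = n \<and> i = j"
proof
  assume *: "cell m i = cell n j"
  then have "(2::real) ^ m = 2 ^ n"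
    using ilen_cell by (metis div_by_1 divide_divide_eq_right mult_1)
  then have mn: "m = n" by simp
  have "real i / 2 ^ m = real j / 2 ^ n"
    using arg_cong[OF *, of Inf] unfolding Inf_cell .
  with mn show "m = n \<and> i = j" by simp
qed auto

lemma haar_cell_sq: "(haar (cell m i) s)\<^sup>2 = indicator (cell m i) s"
proof -
  have "(haar {a..<b} s)\<^sup>2 = indicator {a..<b} s" if "a < b" for a b :: real
    using that by (auto simp: haar_def left_half_def right_half_def indicator_def)
  then show ?thesis using cell_less by (simp add: cell_def)
qed

lemma haar2_cell_sq:
  "(haar2 (cell m i, cell n j) (s, t))\<^sup>2 = indicator (cell m i) s * indicator (cell n j) t"
  by (simp add: haar2_def power_mult_distrib haar_cell_sq)

lemma mem_cell_iff: "0 \<le> s \<Longrightarrow> s \<in> cell M u \<longleftrightarrow> nat \<lfloor>2 ^ M * s\<rfloor> = u"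
proof -
  assume s: "0 \<le> s"
  have "s \<in> cell M u \<longleftrightarrow> real u \<le> 2 ^ M * s \<and> 2 ^ M * s < real u + 1"
    by (simp add: cell_def field_simps)
  also have "\<dots> \<longleftrightarrow> \<lfloor>2 ^ M * s\<rfloor> = int u" by linarith
  also have "\<dots> \<longleftrightarrow> nat \<lfloor>2 ^ M * s\<rfloor> = u"
    using s by auto
  finally show ?thesis .
qed

lemma mem_cell_coarser:
  assumes "s \<in> cell M u" "m \<le> M"
  shows "s \<in> cell m i \<longleftrightarrow> u div 2 ^ (M - m) = i"
proof -
  have "0 \<le> real u / 2 ^ M" by simp
  then have s: "0 \<le> s" using assms(1) unfolding cell_def by (meson atLeastLessThan_iff order_trans)
  then have u: "nat \<lfloor>2 ^ M * s\<rfloor> = u" using assms(1) mem_cell_iff by blast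
  have "2 ^ M * s = 2 ^ (M - m) * (2 ^ m * s)"
    using assms(2) by (simp flip: power_add mult.assoc)
  then have "2 ^ m * s = 2 ^ M * s / real (2 ^ (M - m))" by (simp only: of_nat_power of_nat_numeral) simp
  then have "nat \<lfloor>2 ^ m * s\<rfloor> = u div 2 ^ (M - m)"
    using u floor_divide_real_eq_div[of "int (2 ^ (M - m))" "2 ^ M * s"]
    by (simp add: nat_div_distrib nat_power_eq s)
  then show ?thesis using mem_cell_iff[OF s] by auto
qed

lemma unit_interval_cells: "{0..<1::real} = (\<Union>u<2 ^ M::nat. cell M u)"
proof (intro set_eqI iffI)
  fix s :: real assume s: "s \<in> {0..<1}"
  then have "nat \<lfloor>2 ^ M * s\<rfloor> < 2 ^ M"
    by (auto simp: nat_less_iff floor_less_iff)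
  then show "s \<in> (\<Union>u<2 ^ M::nat. cell M u)" using s mem_cell_iff[of s M] by auto
next
  fix s assume "s \<in> (\<Union>u<2 ^ M::nat. cell M u)"
  then obtain u where u: "u < 2 ^ M" "s \<in> cell M u" by blast
  then have "real u / 2 ^ M \<le> s" "s < (real u + 1) / 2 ^ M" by (auto simp: cell_def)
  moreover have "(real u + 1) / 2 ^ M \<le> 1"
  proof -
    have "real (u + 1) \<le> real (2 ^ M)" using u(1) by (intro of_nat_mono) simp
    then show ?thesis by simp
  qed
  moreover have "0 \<le> real u / 2 ^ M" by simp
  ultimately have "0 \<le> s" "s < 1" by linarith+
  then show "s \<in> {0..<1}" by simp
qed

lemma integral_step:
  fixes f :: "real \<Rightarrow> real"
  assumes "\<And>u s. u < 2 ^ M \<Longrightarrow> s \<in> cell M u \<Longrightarrow> f s = g u"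
  shows "(LBINT s:{0..<1}. f s) = (\<Sum>u<2 ^ M. g u) / 2 ^ M"
proof -
  have cell_borel: "cell M u \<in> sets borel" for u by (simp add: cell_def)
  have disj: "disjoint_family_on (cell M) {..<2 ^ M}"
  proof (unfold disjoint_family_on_def, intro ballI impI)
    fix u v :: nat assume "u \<noteq> v"
    show "cell M u \<inter> cell M v = {}"
    proof (rule equals0I)
      fix s assume s: "s \<in> cell M u \<inter> cell M v"
      then have "u div 2 ^ (M - M) = v" using mem_cell_coarser[of s M u M v] by blast
      with \<open>u \<noteq> v\<close> show False by simp
    qed
  qed
  have "(LBINT s:{0..<1}. f s) = (LBINT s:(\<Union>u<2 ^ M::nat. cell M u). f s)"
    using unit_interval_cells[of M] by simp
  also have "\<dots> = (\<Sum>u<2 ^ M. LBINT s:cell M u. f s)"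
  proof (rule set_integral_finite_Union)
    show "set_integrable lborel (cell M u) f" if "u \<in> {..<2 ^ M}" for u
    proof -
      have "integrable lborel (\<lambda>s. indicator {real u / 2 ^ M ..< (real u + 1) / 2 ^ M} s *\<^sub>R g u)"
        using cell_less[of u M] by (intro integrable_scaleR_left integrable_real_indicator) auto
      moreover have "indicator (cell M u) s *\<^sub>R f s
          = indicator {real u / 2 ^ M ..< (real u + 1) / 2 ^ M} s *\<^sub>R g u" for s
        using assms[of u s] that by (auto simp: indicator_def cell_def)
      ultimately show ?thesis by (simp add: set_integrable_def)
    qed
  qed (use disj in \<open>simp_all add: cell_borel\<close>)
  also have "\<dots> = (\<Sum>u<2 ^ M. LBINT s:cell M u. g u)"
    by (intro sum.cong refl set_lebesgue_integral_cong allI impI) (simp_all add: cell_borel assms)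
  also have "\<dots> = (\<Sum>u<2 ^ M. g u / 2 ^ M)"
  proof (intro sum.cong refl)
    fix u
    have "(LBINT s:cell M u. g u) = g u * ilen (cell M u)"
      by (simp add: set_lebesgue_integral_def mult.commute)
    then show "(LBINT s:cell M u. g u) = g u / 2 ^ M" by (simp add: ilen_cell)
  qed
  finally show ?thesis by (simp add: sum_divide_distrib)
qed

text \<open>The mixed norm of the function with value \<open>g u v\<close> on the product of the cells \<open>u\<close> and \<open>v\<close> of level \<open>M\<close>.\<close>

definition cell_norm :: "real \<Rightarrow> real \<Rightarrow> nat \<Rightarrow> (nat \<Rightarrow> nat \<Rightarrow> real) \<Rightarrow> real" where
  "cell_norm p q M g =
     ((\<Sum>u<2 ^ M. ((\<Sum>v<2 ^ M. \<bar>g u v\<bar> powr q) / 2 ^ M) powr (p / q)) / 2 ^ M) powr (1 / p)"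

text \<open>Everything below takes place on such finite sums: a finite combination of Haar functions has a square function that is constant on
  the products of cells of a fine level.\<close>

lemma mixed_norm_step:
  assumes "\<And>u v s t. u < 2 ^ M \<Longrightarrow> v < 2 ^ M \<Longrightarrow> s \<in> cell M u \<Longrightarrow> t \<in> cell M v \<Longrightarrow> f (s, t) = g u v"
  shows "mixed_norm p q f = cell_norm p q M g"
proof -
  have inner: "(LBINT t:{0..<1}. \<bar>f (s, t)\<bar> powr q) = (\<Sum>v<2 ^ M. \<bar>g u v\<bar> powr q) / 2 ^ M"
    if "u < 2 ^ M" "s \<in> cell M u" for u s
    by (rule integral_step) (simp add: assms[OF that(1) _ that(2)])
  show ?thesis
    unfolding mixed_norm_def cell_norm_def
    by (rule arg_cong[where f = "\<lambda>x. x powr (1 / p)"], rule integral_step) (simp add: inner)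
qed

lemma cell_norm_mono:
  assumes "1 \<le> p" "1 \<le> q" "\<And>u v. u < 2 ^ M \<Longrightarrow> v < 2 ^ M \<Longrightarrow> \<bar>f u v\<bar> \<le> \<bar>g u v\<bar>"
  shows "cell_norm p q M f \<le> cell_norm p q M g"
  unfolding cell_norm_def using assms
  by (intro powr_mono2 divide_right_mono sum_mono sum_nonneg divide_nonneg_nonneg) auto

lemma cell_norm_scale:
  assumes "1 \<le> p" "1 \<le> q" "0 \<le> c"
  shows "cell_norm p q M (\<lambda>u v. c * g u v) = c * cell_norm p q M g"
proof -
  have 1: "(\<Sum>v<2 ^ M. \<bar>c * g u v\<bar> powr q) / 2 ^ M = c powr q * ((\<Sum>v<2 ^ M. \<bar>g u v\<bar> powr q) / 2 ^ M)" for u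
    using assms by (simp add: abs_mult powr_mult sum_distrib_left)
  have 2: "((\<Sum>v<2 ^ M. \<bar>c * g u v\<bar> powr q) / 2 ^ M) powr (p / q)
      = c powr p * ((\<Sum>v<2 ^ M. \<bar>g u v\<bar> powr q) / 2 ^ M) powr (p / q)" for u
    unfolding 1 using assms by (subst powr_mult) (auto simp: powr_powr intro!: divide_nonneg_nonneg sum_nonneg)
  have "(\<Sum>u<2 ^ M. ((\<Sum>v<2 ^ M. \<bar>c * g u v\<bar> powr q) / 2 ^ M) powr (p / q)) / 2 ^ M
    = c powr p * ((\<Sum>u<2 ^ M. ((\<Sum>v<2 ^ M. \<bar>g u v\<bar> powr q) / 2 ^ M) powr (p / q)) / 2 ^ M)"
    unfolding 2 by (simp add: sum_distrib_left)
  then show ?thesis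
    unfolding cell_norm_def using assms
    by (simp only:) (subst powr_mult, auto simp: powr_powr intro!: divide_nonneg_nonneg sum_nonneg)
qed

lemma cell_norm_reindex:
  assumes "bij_betw \<phi> {..<2 ^ M} {..<2 ^ M}" "bij_betw \<psi> {..<2 ^ M} {..<2 ^ M}"
  shows "cell_norm p q M (\<lambda>u v. g (\<phi> u) (\<psi> v)) = cell_norm p q M g"
proof -
  have "(\<Sum>v<2 ^ M. \<bar>g u (\<psi> v)\<bar> powr q) = (\<Sum>v<2 ^ M. \<bar>g u v\<bar> powr q)" for u
    by (rule sum.reindex_bij_betw[OF assms(2)])
  then show ?thesis
    unfolding cell_norm_def
    using sum.reindex_bij_betw[OF assms(1), of "\<lambda>u. ((\<Sum>v<2 ^ M. \<bar>g u v\<bar> powr q) / 2 ^ M) powr (p / q)"]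
    by simp
qed

lemma cell_norm_eq_0_imp:
  assumes "cell_norm p q M g = 0" "u < 2 ^ M" "v < 2 ^ M"
  shows "g u v = 0"
proof -
  have "(\<Sum>u<2 ^ M. ((\<Sum>v<2 ^ M. \<bar>g u v\<bar> powr q) / 2 ^ M) powr (p / q)) = 0"
    using assms(1) by (simp add: cell_norm_def)
  then have "((\<Sum>v<2 ^ M. \<bar>g u v\<bar> powr q) / 2 ^ M) powr (p / q) = 0"
    using assms(2) by (subst (asm) sum_nonneg_eq_0_iff) auto
  then have "(\<Sum>v<2 ^ M. \<bar>g u v\<bar> powr q) = 0" by simp
  then have "\<bar>g u v\<bar> powr q = 0"
    using assms(3) by (subst (asm) sum_nonneg_eq_0_iff) auto
  then show ?thesis by simp
qed

lemma cell_norm_cong: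
  assumes "\<And>u v. u < 2 ^ M \<Longrightarrow> v < 2 ^ M \<Longrightarrow> f u v = g u v"
  shows "cell_norm p q M f = cell_norm p q M g"
  unfolding cell_norm_def using assms by simp

section \<open>The enumeration of dyadic rectangles\<close>

lemma ord_N2_bounds: "(max m n)\<^sup>2 \<le> ord_N2 m n" "ord_N2 m n < (Suc (max m n))\<^sup>2"
  by (auto simp: ord_N2_def power2_eq_square max_def)

lemma ord_N2_mono_max: "ord_N2 m n \<le> ord_N2 m' n' \<Longrightarrow> max m n \<le> max m' n'"
proof -
  assume "ord_N2 m n \<le> ord_N2 m' n'"
  then have "(max m n)\<^sup>2 < (Suc (max m' n'))\<^sup>2"
    using ord_N2_bounds by (meson le_less_trans less_le_trans)
  then show ?thesis using power_less_imp_less_base by fastforce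
qed

lemma ord_N2_inject: "ord_N2 m n = ord_N2 m' n' \<longleftrightarrow> m = m' \<and> n = n'"
proof
  assume *: "ord_N2 m n = ord_N2 m' n'"
  then have "max m n = max m' n'" by (intro antisym ord_N2_mono_max) simp_all
  then show "m = m' \<and> n = n'"
    using * by (auto simp: ord_N2_def max_def power2_eq_square split: if_splits)
qed auto

lemma le_ord_N2: "m \<le> ord_N2 m n" "n \<le> ord_N2 m n"
proof -
  have "max m n \<le> (max m n)\<^sup>2" unfolding power2_eq_square by (rule le_square)
  then have "max m n \<le> ord_N2 m n" using ord_N2_bounds(1) le_trans by blast
  then show "m \<le> ord_N2 m n" "n \<le> ord_N2 m n" by simp_all
qed

definition codes :: "(nat \<times> nat \<times> nat \<times> nat) set" where
  "codes = {(m, i, n, j). i < 2 ^ m \<and> j < 2 ^ n}"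

definition code_rect :: "nat \<times> nat \<times> nat \<times> nat \<Rightarrow> rect" where
  "code_rect = (\<lambda>(m, i, n, j). (cell m i, cell n j))"

text \<open>A natural number whose order is the lexicographic order of rectangles: as \<open>ord_N2 m n\<close> bounds \<open>m\<close> and
  \<open>n\<close>, the position part \<open>i * 2 ^ n + j\<close> is less than \<open>4 ^ ord_N2 m n\<close> and cannot outweigh the leading term.\<close>

definition code_key :: "nat \<times> nat \<times> nat \<times> nat \<Rightarrow> nat" where
  "code_key = (\<lambda>(m, i, n, j). 4 ^ Suc (ord_N2 m n) + i * 2 ^ n + j)"

lemma bij_code_rect: "bij_betw code_rect codes dyadic_rects"
  unfolding bij_betw_def
proof
  show "inj_on code_rect codes" by (auto simp: inj_on_def code_rect_def cell_inject)
  show "code_rect ` codes = dyadic_rects"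
    by (force simp: dyadic_rects_def dyadic_intervals_eq codes_def code_rect_def image_iff)
qed

lemma code_key_less:
  assumes "(m, i, n, j) \<in> codes" "(m', i', n', j') \<in> codes" "ord_N2 m n < ord_N2 m' n'"
  shows "code_key (m, i, n, j) < code_key (m', i', n', j')"
proof -
  have "i * 2 ^ n + j < i * 2 ^ n + 2 ^ n" using assms(1) by (simp add: codes_def)
  also have "\<dots> = Suc i * 2 ^ n" by simp
  also have "\<dots> \<le> 2 ^ m * 2 ^ n" using assms(1) by (intro mult_right_mono) (auto simp: codes_def)
  also have "\<dots> \<le> 2 ^ ord_N2 m n * 2 ^ ord_N2 m n"
    by (intro mult_mono power_increasing le_ord_N2) auto
  also have "\<dots> = (4::nat) ^ ord_N2 m n" by (simp flip: power_mult_distrib)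
  finally have "code_key (m, i, n, j) < 4 * 4 ^ ord_N2 m n + 4 ^ ord_N2 m n"
    by (simp add: code_key_def)
  also have "\<dots> \<le> 4 ^ Suc (Suc (ord_N2 m n))" by simp
  also have "\<dots> \<le> 4 ^ Suc (ord_N2 m' n')" using assms(3) by (intro power_increasing) auto
  also have "\<dots> \<le> code_key (m', i', n', j')" by (simp add: code_key_def)
  finally show ?thesis .
qed

lemma base_digits_less:
  fixes a a' b b' c :: nat
  assumes "b < c" "b' < c"
  shows "a * c + b < a' * c + b' \<longleftrightarrow> a < a' \<or> a = a' \<and> b < b'"
proof (cases a a' rule: linorder_cases)
  case less
  then have "Suc a * c \<le> a' * c" by (intro mult_right_mono) auto
  with less assms show ?thesis by simp
next
  case greater
  then have "Suc a' * c \<le> a * c" by (intro mult_right_mono) auto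
  with greater assms show ?thesis by simp
qed simp

lemma rect_less_code:
  assumes "c \<in> codes" "c' \<in> codes"
  shows "code_rect c \<lhd>\<^sub>R code_rect c' \<longleftrightarrow> code_key c < code_key c'"
proof -
  obtain m i n j where c: "c = (m, i, n, j)" by (cases c)
  obtain m' i' n' j' where c': "c' = (m', i', n', j')" by (cases c')
  have len: "1 / (2::real) ^ a = 1 / 2 ^ b \<longleftrightarrow> a = b" for a b :: nat
    by simp
  have "code_rect c \<lhd>\<^sub>R code_rect c' \<longleftrightarrow> ord_N2 m n < ord_N2 m' n' \<or> ord_N2 m n = ord_N2 m' n' \<and>
     (real i / 2 ^ m < real i' / 2 ^ m' \<or> real i / 2 ^ m = real i' / 2 ^ m' \<and> real j / 2 ^ n < real j' / 2 ^ n')"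
    unfolding c c' rect_less_def code_rect_def
    by (simp only: prod.case fst_conv snd_conv ilen_cell len Inf_cell in_lex_prod mem_Collect_eq) auto
  also have "\<dots> \<longleftrightarrow> code_key c < code_key c'"
  proof (cases "ord_N2 m n" "ord_N2 m' n'" rule: linorder_cases)
    case less
    then show ?thesis using code_key_less[of m i n j m' i' n' j'] assms c c' by simp
  next
    case greater
    then show ?thesis using code_key_less[of m' i' n' j' m i n j] assms c c' by simp
  next
    case equal
    then have mn: "m = m'" "n = n'" by (simp_all add: ord_N2_inject)
    have "code_key c < code_key c' \<longleftrightarrow> i * 2 ^ n + j < i' * 2 ^ n + j'"
      unfolding c c' mn code_key_def by simp
    also have "\<dots> \<longleftrightarrow> i < i' \<or> i = i' \<and> j < j'"
      using assms by (intro base_digits_less) (auto simp: c c' codes_def mn)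
    finally show ?thesis by (simp add: mn divide_less_cancel)
  qed
  finally show ?thesis .
qed

lemma inj_code_key: "inj_on code_key codes"
proof
  fix c c' assume *: "c \<in> codes" "c' \<in> codes" "code_key c = code_key c'"
  obtain m i n j where c: "c = (m, i, n, j)" by (cases c)
  obtain m' i' n' j' where c': "c' = (m', i', n', j')" by (cases c')
  have "ord_N2 m n = ord_N2 m' n'"
    using code_key_less[of m i n j m' i' n' j'] code_key_less[of m' i' n' j' m i n j] *
    unfolding c c' by (metis less_irrefl linorder_neqE_nat)
  then have mn: "m = m'" "n = n'" by (simp_all add: ord_N2_inject)
  have j: "j < 2 ^ n" "j' < 2 ^ n" using * by (simp_all add: c c' mn codes_def)
  have "i * 2 ^ n + j = i' * 2 ^ n + j'"
    using * unfolding c c' mn code_key_def by simp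
  then have "i = i' \<and> j = j'"
    using base_digits_less[OF j, of i i'] base_digits_less[OF j(2,1), of i' i] by (metis less_irrefl linorder_neqE_nat)
  then show "c = c'" by (simp add: c c' mn)
qed

text \<open>The keys form an infinite set of natural numbers, whose increasing enumeration gives the required
  bijection. There is no other one: the transition between two of them and its inverse are strictly increasing
  maps of the natural numbers, and such a map lies above the identity.\<close>

lemma rect_enum_props:
  "bij_betw rect_enum UNIV dyadic_rects \<and> (\<forall>k l. k < l \<longrightarrow> rect_enum k \<lhd>\<^sub>R rect_enum l)"
proof -
  define K where "K = code_key ` codes"
  have "infinite codes"
  proof
    assume "finite codes"
    moreover have "range (\<lambda>m. (m, 0, 0, 0)) \<subseteq> codes" by (auto simp: codes_def)
    ultimately have "finite (range (\<lambda>m::nat. (m, 0::nat, 0::nat, 0::nat)))" using finite_subset by blast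
    then show False by (subst (asm) finite_image_iff) (auto simp: inj_on_def)
  qed
  then have inf: "infinite K" unfolding K_def using finite_image_iff inj_code_key by blast
  define \<rho> where "\<rho> k = code_rect (inv_into codes code_key (enumerate K k))" for k
  have enumK: "bij_betw (enumerate K) UNIV K" by (rule bij_enumerate[OF inf])
  have bij: "bij_betw \<rho> UNIV dyadic_rects"
  proof -
    have "bij_betw (inv_into codes code_key) K codes"
      unfolding K_def by (rule bij_betw_inv_into) (simp add: inj_code_key bij_betw_def)
    from bij_betw_trans[OF bij_betw_trans[OF enumK this] bij_code_rect]
    show ?thesis by (simp add: \<rho>_def[abs_def] comp_def)
  qed
  have incr: "\<rho> k \<lhd>\<^sub>R \<rho> l" if "k < l" for k l
  proof -
    have inK: "enumerate K r \<in> K" for r using enumK by (auto simp: bij_betw_def)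
    have "enumerate K k < enumerate K l" using that inf by (rule enumerate_mono)
    then show ?thesis
      unfolding \<rho>_def using inK inv_into_into[of _ code_key codes] f_inv_into_f[of _ code_key codes]
      by (subst rect_less_code) (auto simp: K_def)
  qed
  have rl: "\<not> (R \<lhd>\<^sub>R S \<and> S \<lhd>\<^sub>R R)" if RS: "R \<in> dyadic_rects" "S \<in> dyadic_rects" for R S
  proof -
    obtain c d where "c \<in> codes" "d \<in> codes" "R = code_rect c" "S = code_rect d"
      using RS bij_code_rect by (metis bij_betw_imp_surj_on imageE)
    then show ?thesis using rect_less_code by auto
  qed
  have unique: "\<rho>' = \<rho>"
    if \<rho>': "bij_betw \<rho>' UNIV dyadic_rects \<and> (\<forall>k l. k < l \<longrightarrow> \<rho>' k \<lhd>\<^sub>R \<rho>' l)" for \<rho>'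
  proof -
    \<comment> \<open>The two transition maps.\<close>
    define f where "f k = inv \<rho> (\<rho>' k)" for k
    define g where "g k = inv \<rho>' (\<rho> k)" for k
    have \<rho>f: "\<rho> (f k) = \<rho>' k" for k
      unfolding f_def using \<rho>' bij by (metis bij_betw_def f_inv_into_f rangeI)
    have \<rho>g: "\<rho>' (g k) = \<rho> k" for k
      unfolding g_def using \<rho>' bij by (metis bij_betw_def f_inv_into_f rangeI)
    have inr: "\<rho> k \<in> dyadic_rects" "\<rho>' k \<in> dyadic_rects" for k
      using \<rho>' bij by (auto simp: bij_betw_def)
    have "f k < f l" if "k < l" for k l
      using that \<rho>' incr rl inr by (metis \<rho>f linorder_neqE_nat)
    then have "k \<le> f k" for k by (intro strict_mono_imp_increasing strict_monoI)
    moreover have "g k < g l" if "k < l" for k l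
      using that \<rho>' incr rl inr by (metis \<rho>g linorder_neqE_nat)
    then have "k \<le> g k" for k by (intro strict_mono_imp_increasing strict_monoI)
    then have "f k \<le> g (f k)" for k .
    moreover have "g (f k) = k" for k
      using \<rho>' by (metis \<rho>f \<rho>g bij_betw_imp_inj_on injD)
    ultimately have "f k = k" for k by (simp add: antisym)
    then show ?thesis using \<rho>f by auto
  qed
  show ?thesis
    unfolding rect_enum_def
    using theI[of "\<lambda>\<rho>. bij_betw \<rho> UNIV dyadic_rects \<and> (\<forall>k l. k < l \<longrightarrow> \<rho> k \<lhd>\<^sub>R \<rho> l)" \<rho>]
      bij incr unique by blast
qed

lemma rect_enum_codes:
  obtains lev1 pos1 lev2 pos2 where
    "\<And>k. rect_enum k = (cell (lev1 k) (pos1 k), cell (lev2 k) (pos2 k))"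
    "bij_betw (\<lambda>k. (lev1 k, pos1 k, lev2 k, pos2 k)) UNIV codes"
    "\<And>k l. k \<le> l \<Longrightarrow> max (lev1 k) (lev2 k) \<le> max (lev1 l) (lev2 l)"
proof -
  define c where "c k = inv_into codes code_rect (rect_enum k)" for k
  have bij: "bij_betw c UNIV codes"
    using bij_betw_trans[OF conjunct1[OF rect_enum_props] bij_betw_inv_into[OF bij_code_rect]]
    by (simp add: c_def[abs_def] comp_def)
  have c: "c k \<in> codes" for k using bij by (auto simp: bij_betw_def)
  have rect: "code_rect (c k) = rect_enum k" for k
    unfolding c_def using rect_enum_props bij_code_rect by (metis bij_betw_def f_inv_into_f rangeI)
  define lev1 pos1 lev2 pos2 where "lev1 k = fst (c k)" "pos1 k = fst (snd (c k))"
    "lev2 k = fst (snd (snd (c k)))" "pos2 k = snd (snd (snd (c k)))" for k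
  note * = this
  have ck: "c k = (lev1 k, pos1 k, lev2 k, pos2 k)" for k by (simp add: *)
  show thesis
  proof (rule that)
    show "rect_enum k = (cell (lev1 k) (pos1 k), cell (lev2 k) (pos2 k))" for k
      using rect[of k] by (simp add: ck code_rect_def)
    show "bij_betw (\<lambda>k. (lev1 k, pos1 k, lev2 k, pos2 k)) UNIV codes"
      using bij unfolding ck[abs_def] .
    show "max (lev1 k) (lev2 k) \<le> max (lev1 l) (lev2 l)" if "k \<le> l" for k l
    proof (cases "k = l")
      case False
      with that have "rect_enum k \<lhd>\<^sub>R rect_enum l" using rect_enum_props by auto
      then have "code_key (c k) < code_key (c l)"
        using rect_less_code[OF c c] rect by simp
      then have "\<not> ord_N2 (lev1 l) (lev2 l) < ord_N2 (lev1 k) (lev2 k)"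
        using code_key_less c ck by (metis order_less_asym)
      then show ?thesis by (simp only: not_less ord_N2_mono_max)
    qed simp
  qed
qed

section \<open>Reading the binary digits at selected positions\<close>

text \<open>Positions of binary digits are counted from the most significant digit, starting with \<open>1\<close>, so that a cell of level
  \<open>M\<close> knows the digits at the positions \<open>1, \<dots>, M\<close> of its points.\<close>

definition digit_count :: "nat set \<Rightarrow> nat \<Rightarrow> nat" where
  "digit_count D M = card (D \<inter> {1..M})"

text \<open>If \<open>s\<close> is the index of a cell of level \<open>M\<close>, this is the index of the cell of level \<open>digit_count D M\<close> into which
  it is mapped when only the digits at positions in \<open>D\<close> are kept.\<close>

primrec read_digits :: "nat set \<Rightarrow> nat \<Rightarrow> nat \<Rightarrow> nat" where
  "read_digits D 0 s = 0"
| "read_digits D (Suc M) s =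
     (if Suc M \<in> D then 2 * read_digits D M (s div 2) + s mod 2 else read_digits D M (s div 2))"

lemma digit_count_0 [simp]: "digit_count D 0 = 0"
  by (simp add: digit_count_def)

lemma digit_count_Suc [simp]:
  "digit_count D (Suc M) = (if Suc M \<in> D then Suc (digit_count D M) else digit_count D M)"
  by (simp add: digit_count_def atLeastAtMostSuc_conv)

lemma digit_count_mono: "M \<le> M' \<Longrightarrow> digit_count D M \<le> digit_count D M'"
  unfolding digit_count_def by (intro card_mono) auto

lemma digit_count_cong: "D \<inter> {1..M} = D' \<inter> {1..M} \<Longrightarrow> digit_count D M = digit_count D' M"
  by (simp add: digit_count_def)

lemma read_digits_cong: "D \<inter> {1..M} = D' \<inter> {1..M} \<Longrightarrow> read_digits D M s = read_digits D' M s"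
proof (induction M arbitrary: s)
  case (Suc M)
  have "D \<inter> {1..M} = D' \<inter> {1..M}" "Suc M \<in> D \<longleftrightarrow> Suc M \<in> D'"
    using Suc.prems by (auto simp: atLeastAtMostSuc_conv set_eq_iff) 
  then show ?case using Suc.IH by simp
qed simp

text \<open>The count starts at \<open>0\<close> and grows in steps of at most one.\<close>

lemma digit_count_attained:
  assumes "j \<le> digit_count D M" obtains a where "a \<le> M" "digit_count D a = j"
  using assms
proof (induction M arbitrary: thesis)
  case (Suc M)
  show ?case
  proof (cases "j \<le> digit_count D M")
    case True
    then show ?thesis using Suc by (metis le_Suc_eq)
  next
    case False
    then have "digit_count D (Suc M) = j" using Suc.prems(2) by (auto split: if_splits)
    then show ?thesis using Suc.prems(1) by blast
  qed
qed auto

text \<open>Passing to the ancestor of a cell only forgets final digits, hence commutes with reading digits.\<close>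

lemma read_digits_coarser:
  assumes "a \<le> M"
  shows "read_digits D a (s div 2 ^ (M - a)) = read_digits D M s div 2 ^ (digit_count D M - digit_count D a)"
  using assms
proof (induction M arbitrary: s)
  case (Suc M)
  show ?case
  proof (cases "a = Suc M")
    case False
    then have a: "a \<le> M" using Suc.prems by simp
    have "s div 2 ^ (Suc M - a) = s div 2 div 2 ^ (M - a)"
      using a by (simp add: Suc_diff_le div_mult2_eq)
    then have 1: "read_digits D a (s div 2 ^ (Suc M - a))
        = read_digits D M (s div 2) div 2 ^ (digit_count D M - digit_count D a)"
      using Suc.IH[OF a, of "s div 2"] by simp
    have "read_digits D M (s div 2) = read_digits D (Suc M) s div 2" if "Suc M \<in> D"
      using that by simp
    moreover have "digit_count D a \<le> digit_count D M" by (rule digit_count_mono[OF a])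
    ultimately show ?thesis
      unfolding 1 by (auto simp: Suc_diff_le div_mult2_eq)
  qed simp
qed simp

lemma sum_split_bit: "(\<Sum>s<2 ^ Suc M. h s) = (\<Sum>s<2 ^ M. h (2 * s) + h (2 * s + 1))"
  for h :: "nat \<Rightarrow> 'b::comm_monoid_add"
proof -
  have "(\<Sum>s<2 * n. h s) = (\<Sum>s<n. h (2 * s) + h (2 * s + 1))" for n
    by (induction n) (auto simp: add.assoc)
  then show ?thesis by simp
qed

text \<open>Keeping only the digits in \<open>D\<close> preserves measure. In the induction on the level, a new digit either is
  kept and splits the cells on both sides in two, or is forgotten and doubles the sum on the left together with its
  denominator.\<close>

lemma mean_read_digits:
  fixes h :: "nat \<Rightarrow> real"
  shows "(\<Sum>s<2 ^ M. h (read_digits D M s)) / 2 ^ M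
    = (\<Sum>\<sigma><2 ^ digit_count D M. h \<sigma>) / 2 ^ digit_count D M"
proof (induction M arbitrary: h)
  case (Suc M)
  show ?case
  proof (cases "Suc M \<in> D")
    case True
    have "(\<Sum>s<2 ^ Suc M. h (read_digits D (Suc M) s))
       = (\<Sum>s<2 ^ M. h (2 * read_digits D M s) + h (2 * read_digits D M s + 1))"
      using True by (simp only: sum_split_bit) simp
    then show ?thesis
      using True Suc.IH[of "\<lambda>s. h (2 * s) + h (2 * s + 1)"] sum_split_bit[of h "digit_count D M"]
      by simp
  next
    case False
    have "(\<Sum>s<2 ^ Suc M. h (read_digits D (Suc M) s)) = (\<Sum>s<2 ^ M. 2 * h (read_digits D M s))"
      using False by (simp only: sum_split_bit) simp
    then show ?thesis
      using False Suc.IH[of h] by (simp flip: sum_distrib_left)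
  qed
qed simp

text \<open>Measure preservation, applied to the indicator function of one cell, rules out an empty fibre.\<close>

lemma read_digits_surj:
  assumes "i < 2 ^ digit_count D M" shows "\<exists>s<2 ^ M. read_digits D M s = i"
proof (rule ccontr)
  assume "\<not> ?thesis"
  then have "(\<Sum>s<2 ^ M. of_bool (read_digits D M s = i) :: real) = 0"
    by (intro sum.neutral) auto
  then have "(\<Sum>\<sigma><2 ^ digit_count D M. of_bool (\<sigma> = i) :: real) = 0"
    using mean_read_digits[of "\<lambda>\<sigma>. of_bool (\<sigma> = i)" D M] by simp
  then show False using assms by (simp add: sum_nonneg_eq_0_iff)
qed

lemma xor_div_power: "xor s g div 2 ^ k = xor (s div 2 ^ k) (g div 2 ^ k)" for s g :: nat
  by (simp flip: drop_bit_eq_div)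

lemma xor_less_power: "s < 2 ^ M \<Longrightarrow> g < 2 ^ M \<Longrightarrow> xor s g < 2 ^ M" for s g :: nat
  by (metis take_bit_nat_eq_self_iff take_bit_xor)

lemma xor_cancel: "xor (xor s g) g = s" for s g :: nat
  by (simp add: xor.assoc)

lemma bij_xor: "g < 2 ^ M \<Longrightarrow> bij_betw (\<lambda>s. xor s g) {..<2 ^ M} {..<2 ^ M::nat}" for g :: nat
  by (rule bij_betw_byWitness[where f' = "\<lambda>s. xor s g"]) (auto simp: xor_cancel xor_less_power)

text \<open>Flipping the digits of \<open>s\<close> that are set in \<open>g\<close> is \<open>xor\<close> with \<open>g\<close>. Digits are read one by one, so that this operation commutes with reading.\<close>

lemma read_digits_xor: "read_digits D M (xor s g) = xor (read_digits D M s) (read_digits D M g)"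
proof (induction M arbitrary: s g)
  case (Suc M)
  have half: "xor s g div 2 = xor (s div 2) (g div 2)"
    using xor_div_power[of s g 1] by simp
  have parity: "xor s g mod 2 = of_bool (odd s \<noteq> odd g)"
    by (simp add: mod_2_eq_odd even_xor_iff)
  have "2 * xor a b + xor s g mod 2 = xor (2 * a + s mod 2) (2 * b + g mod 2)" for a b
    by (subst (2) xor_nat_rec) (simp add: parity)
  then show ?case by (simp add: Suc half)
qed simp

lemma read_digits_refine:
  assumes "a \<le> M"
  shows "read_digits D M (x * 2 ^ (M - a)) = read_digits D a x * 2 ^ (digit_count D M - digit_count D a)"
  using assms
proof (induction M)
  case (Suc M)
  show ?case
  proof (cases "a = Suc M")
    case False
    then have a: "a \<le> M" using Suc.prems by simp
    have double: "x * 2 ^ (Suc M - a) = 2 * (x * 2 ^ (M - a))" using a by (simp add: Suc_diff_le)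
    have "x * 2 ^ (Suc M - a) div 2 = x * 2 ^ (M - a)" "x * 2 ^ (Suc M - a) mod 2 = 0"
      unfolding double by simp_all
    then show ?thesis
      using Suc.IH[OF a] digit_count_mono[OF a, of D] by (simp add: Suc_diff_le)
  qed simp
qed simp

lemma eq_xor_iff: "a = xor b c \<longleftrightarrow> xor a c = b" for a b c :: nat
proof
  assume "xor a c = b"
  then have "xor (xor a c) c = xor b c" by (rule arg_cong)
  then show "a = xor b c" by (simp only: xor_cancel)
qed (simp only: xor_cancel)

text \<open>The mixed norm is invariant under composition with a measure preserving map in each variable.\<close>

lemma cell_norm_read_digits:
  "cell_norm p q M (\<lambda>u v. g (read_digits D M u) (read_digits D M v)) = cell_norm p q (digit_count D M) g"
proof -
  have "(\<Sum>v<2 ^ M. \<bar>g u (read_digits D M v)\<bar> powr q) / 2 ^ M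
      = (\<Sum>v<2 ^ digit_count D M. \<bar>g u v\<bar> powr q) / 2 ^ digit_count D M" for u
    by (rule mean_read_digits)
  then show ?thesis
    unfolding cell_norm_def
    using mean_read_digits[of "\<lambda>u. ((\<Sum>v<2 ^ digit_count D M. \<bar>g u v\<bar> powr q) / 2 ^ digit_count D M) powr (p / q)" D M]
    by simp
qed

section \<open>Bases with suppression constant one\<close>

lemma sum_rotate:
  "(\<Sum>i\<in>A. \<Sum>g\<in>B. \<Sum>h\<in>C. f i g h) = (\<Sum>g\<in>B. \<Sum>h\<in>C. \<Sum>i\<in>A. f i g h)"
  by (rule trans[OF sum.swap]) (intro sum.cong refl sum.swap)

lemma impartially_equivalent_isometric:
  assumes "1 \<le> C"
    and "\<And>S a. finite S \<Longrightarrow> norm (\<Sum>k\<in>S. a k *\<^sub>R x k) = norm (\<Sum>k\<in>S. a k *\<^sub>R y k)"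
  shows "impartially_equivalent C x y"
proof -
  have "1 / sqrt C * n \<le> n" "n \<le> sqrt C * n" if "0 \<le> n" for n :: real
  proof -
    have C: "1 \<le> sqrt C" using assms(1) by simp
    then show "n \<le> sqrt C * n" using that by (simp add: mult_right_mono[of 1 "sqrt C" n, simplified])
    have "1 / sqrt C \<le> 1" using C by simp
    then show "1 / sqrt C * n \<le> n" using that mult_right_mono[of "1 / sqrt C" 1 n] by simp
  qed
  then show ?thesis
    unfolding impartially_equivalent_def using assms(2) by simp
qed

text \<open>A dense sequence for which deleting terms from a finite combination never increases its norm; this is how the
  unconditionality of the Haar system is used.\<close>

locale suppression_basis =
  fixes e :: "nat \<Rightarrow> 'a::banach"
  assumes nonzero: "e i \<noteq> 0"
    and suppress: "finite B \<Longrightarrow> A \<subseteq> B \<Longrightarrow>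
      norm (\<Sum>i\<in>A. c i *\<^sub>R e i) \<le> norm (\<Sum>i\<in>B. c i *\<^sub>R e i)"
    and dense: "closure {\<Sum>i\<in>A. c i *\<^sub>R e i | A c. finite A} = UNIV"
begin

text \<open>The coefficients of approximating finite combinations form Cauchy sequences, and by suppression their limits approximate
  \<open>x\<close> uniformly over all finite index sets that contain the support of a good approximation.\<close>

lemma expansion_exists: "\<exists>a. ((\<lambda>i. a i *\<^sub>R e i) has_sum x) UNIV"
proof -
  have "x \<in> closure {\<Sum>i\<in>A. c i *\<^sub>R e i | A c. finite A}" using dense by simp
  then obtain y where y: "\<And>n. y n \<in> {\<Sum>i\<in>A. c i *\<^sub>R e i | A c. finite A}" and lim: "y \<longlonglongrightarrow> x"
    unfolding closure_sequential by blast
  have "\<forall>n. \<exists>A c. finite A \<and> y n = (\<Sum>i\<in>A. c i *\<^sub>R e i)" using y by blast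
  then obtain A c where fin: "\<And>n. finite (A n)" and yn: "\<And>n. y n = (\<Sum>i\<in>A n. c n i *\<^sub>R e i)"
    by metis
  \<comment> \<open>Extending by zero allows finite combinations to be compared on a common index set.\<close>
  define d where "d n i = (if i \<in> A n then c n i else 0)" for n i
  have yd: "y n = (\<Sum>i\<in>B. d n i *\<^sub>R e i)" if "finite B" "A n \<subseteq> B" for n B
    unfolding yn d_def using that by (intro sum.mono_neutral_cong_left) auto
  have diff: "norm (\<Sum>i\<in>B. (d n i - d m i) *\<^sub>R e i) \<le> norm (y n - y m)" if "finite B" for B n m
  proof -
    let ?B = "B \<union> A n \<union> A m"
    have "norm (\<Sum>i\<in>B. (d n i - d m i) *\<^sub>R e i) \<le> norm (\<Sum>i\<in>?B. (d n i - d m i) *\<^sub>R e i)"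
      using that fin by (intro suppress) auto
    also have "(\<Sum>i\<in>?B. (d n i - d m i) *\<^sub>R e i) = y n - y m"
    proof -
      have "finite ?B" "A n \<subseteq> ?B" "A m \<subseteq> ?B" using that fin by auto
      then show ?thesis
        using yd[of ?B n] yd[of ?B m] by (simp only: scaleR_diff_left sum_subtractf)
    qed
    finally show ?thesis .
  qed
  have "Cauchy y" using lim by (simp add: LIMSEQ_imp_Cauchy)
  have "convergent (\<lambda>n. d n i)" for i
  proof -
    have "Cauchy (\<lambda>n. d n i)"
    proof (rule metric_CauchyI)
      fix r :: real assume "0 < r"
      then have "0 < r * norm (e i)" using nonzero by simp
      then obtain M where M: "\<And>m n. M \<le> m \<Longrightarrow> M \<le> n \<Longrightarrow> dist (y m) (y n) < r * norm (e i)"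
        using \<open>Cauchy y\<close> unfolding Cauchy_def by blast
      have "dist (d m i) (d n i) < r" if "M \<le> m" "M \<le> n" for m n
      proof -
        have "\<bar>d m i - d n i\<bar> * norm (e i) < r * norm (e i)"
          using diff[of "{i}" m n] M[OF that] by (simp add: dist_norm)
        then show ?thesis by (simp add: dist_real_def mult_less_cancel_right)
      qed
      then show "\<exists>M. \<forall>m\<ge>M. \<forall>n\<ge>M. dist (d m i) (d n i) < r" by blast
    qed
    then show ?thesis using Cauchy_convergent_iff by blast
  qed
  then have "\<forall>i. \<exists>l. (\<lambda>n. d n i) \<longlonglongrightarrow> l" unfolding convergent_def by blast
  then obtain a where a: "\<And>i. (\<lambda>n. d n i) \<longlonglongrightarrow> a i" by metis
  have "((\<lambda>i. a i *\<^sub>R e i) has_sum x) UNIV"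
    unfolding has_sum_def
  proof (rule tendstoI)
    fix r :: real assume r: "0 < r"
    then obtain N1 where N1: "\<And>m n. N1 \<le> m \<Longrightarrow> N1 \<le> n \<Longrightarrow> dist (y m) (y n) < r / 2"
      using \<open>Cauchy y\<close> unfolding Cauchy_def by (meson half_gt_zero)
    obtain N2 where N2: "\<And>n. N2 \<le> n \<Longrightarrow> dist (y n) x < r / 2"
      using lim r unfolding lim_sequentially by (meson half_gt_zero)
    define n where "n = max N1 N2"
    have "dist (\<Sum>i\<in>B. a i *\<^sub>R e i) x < r" if B: "finite B" "A n \<subseteq> B" for B
    proof -
      have "(\<lambda>m. norm (\<Sum>i\<in>B. (d m i - d n i) *\<^sub>R e i)) \<longlonglongrightarrow> norm (\<Sum>i\<in>B. (a i - d n i) *\<^sub>R e i)"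
        by (intro tendsto_intros a)
      moreover have "norm (\<Sum>i\<in>B. (d m i - d n i) *\<^sub>R e i) \<le> r / 2" if "m \<ge> n" for m
        using diff[OF B(1), of m n] N1[of m n] that by (simp add: n_def dist_norm)
      ultimately have "norm (\<Sum>i\<in>B. (a i - d n i) *\<^sub>R e i) \<le> r / 2"
        using LIMSEQ_le_const2 by blast
      moreover have "(\<Sum>i\<in>B. (a i - d n i) *\<^sub>R e i) = (\<Sum>i\<in>B. a i *\<^sub>R e i) - y n"
        using yd[OF B] by (simp add: scaleR_diff_left sum_subtractf)
      moreover have "dist (y n) x < r / 2" by (rule N2) (simp add: n_def)
      ultimately show ?thesis
        using dist_triangle[of "\<Sum>i\<in>B. a i *\<^sub>R e i" x "y n"] by (simp add: dist_norm)
    qed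
    then show "\<forall>\<^sub>F B in finite_subsets_at_top UNIV. dist (\<Sum>i\<in>B. a i *\<^sub>R e i) x < r"
      unfolding eventually_finite_subsets_at_top by (intro exI[of _ "A n"]) (simp add: fin)
  qed
  then show ?thesis by blast
qed

lemma coefficient_bound:
  assumes "(\<lambda>i. a i *\<^sub>R e i) sums x"
  shows "\<bar>a k\<bar> * norm (e k) \<le> norm x"
proof -
  have "(\<lambda>n. norm (\<Sum>i<n. a i *\<^sub>R e i)) \<longlonglongrightarrow> norm x"
    using assms unfolding sums_def by (rule tendsto_norm)
  moreover have "\<bar>a k\<bar> * norm (e k) \<le> norm (\<Sum>i<n. a i *\<^sub>R e i)" if "n \<ge> Suc k" for n
    using suppress[of "{..<n}" "{k}" a] that by simp
  ultimately show ?thesis using LIMSEQ_le_const by blast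
qed

lemma expansion_unique:
  assumes "(\<lambda>i. a i *\<^sub>R e i) sums x" "(\<lambda>i. b i *\<^sub>R e i) sums x"
  shows "a = b"
proof
  fix k
  have "(\<lambda>i. (a i - b i) *\<^sub>R e i) sums 0"
    using sums_diff[OF assms] by (simp add: scaleR_diff_left)
  then show "a k = b k" using coefficient_bound[of "\<lambda>i. a i - b i" 0 k] nonzero[of k]
    by (simp add: mult_le_0_iff)
qed

lemma unconditional_basis: "unconditional_basis e"
  unfolding unconditional_basis_def schauder_basis_def
proof (intro conjI allI impI)
  fix x
  obtain a where "((\<lambda>i. a i *\<^sub>R e i) has_sum x) UNIV" using expansion_exists by blast
  then have "(\<lambda>i. a i *\<^sub>R e i) sums x" by (rule has_sum_imp_sums)
  then show "\<exists>!a. (\<lambda>i. a i *\<^sub>R e i) sums x" using expansion_unique by blast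
next
  fix a x assume *: "(\<lambda>i. a i *\<^sub>R e i) sums x"
  obtain b where b: "((\<lambda>i. b i *\<^sub>R e i) has_sum x) UNIV" using expansion_exists by blast
  then have "a = b" using has_sum_imp_sums expansion_unique * by blast
  then show "((\<lambda>i. a i *\<^sub>R e i) has_sum x) UNIV" using b by simp
qed

text \<open>Uniqueness of expansions makes the coefficient maps linear, and suppression bounds them. A functional is
  determined by its values on the basis, so the coefficient functionals are the only biorthogonal ones, and the definite description is
  well defined.\<close>

lemma biorthogonal: "blinfun_apply (biorthogonal_functionals e i) (e j) = (if i = j then 1 else 0)"
proof -
  obtain a where a: "\<And>x. (\<lambda>i. a x i *\<^sub>R e i) sums x"
    using expansion_exists has_sum_imp_sums by metis
  have a_eq: "a x = b" if "(\<lambda>i. b i *\<^sub>R e i) sums x" for x b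
    using expansion_unique a that by blast
  have bl: "bounded_linear (\<lambda>x. a x i)" for i
  proof (rule bounded_linear_intro[where K = "1 / norm (e i)"])
    fix x y
    have "(\<lambda>i. (a x i + a y i) *\<^sub>R e i) sums (x + y)"
      using sums_add[OF a a] by (simp add: scaleR_add_left)
    from a_eq[OF this] show "a (x + y) i = a x i + a y i" by simp
  next
    fix r x
    have "(\<lambda>i. (r * a x i) *\<^sub>R e i) sums (r *\<^sub>R x)"
      using sums_scaleR_right[OF a, of r] by simp
    from a_eq[OF this] show "a (r *\<^sub>R x) i = r *\<^sub>R a x i" by simp
  next
    fix x show "norm (a x i) \<le> norm x * (1 / norm (e i))"
      using coefficient_bound[OF a, of x i] nonzero[of i] by (simp add: field_simps)
  qed
  define e' where "e' i = Blinfun (\<lambda>x. a x i)" for i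
  have e'_apply: "blinfun_apply (e' i) x = a x i" for i x
    by (simp add: e'_def bounded_linear_Blinfun_apply bl)
  have "a (e j) = (\<lambda>i. if i = j then 1 else 0)" for j
  proof (rule a_eq)
    have "(\<lambda>i. (if i = j then 1 else 0) *\<^sub>R e i) = (\<lambda>i. if i = j then e i else 0)" by auto
    then show "(\<lambda>i. (if i = j then 1 else 0) *\<^sub>R e i) sums e j" using sums_single[of j e] by simp
  qed
  then have e'_biorth: "\<forall>i j. blinfun_apply (e' i) (e j) = (if i = j then 1 else 0)"
    by (simp add: e'_apply)
  have "f = e'" if f: "\<forall>i j. blinfun_apply (f i) (e j) = (if i = j then 1 else 0)" for f
  proof
    fix i show "f i = e' i"
    proof (rule blinfun_eqI)
      fix x
      have "(\<lambda>j. blinfun_apply (f i) (a x j *\<^sub>R e j)) sums blinfun_apply (f i) x"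
        "(\<lambda>j. blinfun_apply (e' i) (a x j *\<^sub>R e j)) sums blinfun_apply (e' i) x"
        by (intro bounded_linear.sums[OF blinfun.bounded_linear_right] a)+
      moreover have "blinfun_apply (f i) (a x j *\<^sub>R e j) = blinfun_apply (e' i) (a x j *\<^sub>R e j)" for j
        using f e'_biorth by (simp add: blinfun.scaleR_right)
      ultimately show "blinfun_apply (f i) x = blinfun_apply (e' i) x"
        by (simp add: sums_unique2)
    qed
  qed
  then have "biorthogonal_functionals e = e'"
    unfolding biorthogonal_functionals_def using e'_biorth by (intro the_equality) blast+
  then show ?thesis using e'_biorth by simp
qed

lemma biorthogonal_sum:
  "finite F \<Longrightarrow> blinfun_apply (biorthogonal_functionals e i) (\<Sum>j\<in>F. c j *\<^sub>R e j) = (if i \<in> F then c i else 0)"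
  by (simp add: blinfun.sum_right blinfun.scaleR_right biorthogonal if_distrib cong: if_cong)

lemma functional_norm_le:
  fixes f :: "'a \<Rightarrow>\<^sub>L real"
  assumes "\<And>F c. finite F \<Longrightarrow>
    \<bar>blinfun_apply f (\<Sum>i\<in>F. c i *\<^sub>R e i)\<bar> \<le> K * norm (\<Sum>i\<in>F. c i *\<^sub>R e i)" and "0 \<le> K"
  shows "norm f \<le> K"
proof (rule norm_blinfun_bound)
  fix x
  obtain a where a: "(\<lambda>i. a i *\<^sub>R e i) sums x"
    using expansion_exists has_sum_imp_sums by metis
  have 1: "(\<lambda>n. \<Sum>i<n. a i *\<^sub>R e i) \<longlonglongrightarrow> x" using a by (simp add: sums_def)
  have "(\<lambda>n. norm (blinfun_apply f (\<Sum>i<n. a i *\<^sub>R e i))) \<longlonglongrightarrow> norm (blinfun_apply f x)"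
    by (intro tendsto_norm blinfun.tendsto tendsto_const 1)
  moreover have "(\<lambda>n. K * norm (\<Sum>i<n. a i *\<^sub>R e i)) \<longlonglongrightarrow> K * norm x"
    by (intro tendsto_intros 1)
  ultimately show "norm (blinfun_apply f x) \<le> K * norm x"
    by (rule LIMSEQ_le) (use assms(1) in auto)
qed fact

end

section \<open>Distance to subspaces of finite codimension\<close>

text \<open>The algebra common to closed subspaces of a space and weak-star closed subspaces of its dual. The induction adds
  to \<open>G\<close> one direction \<open>b\<close> of a complement at a time: separating functionals for the larger subspace arise by
  correcting those of \<open>G\<close> with a multiple of a functional that separates \<open>b\<close> from \<open>G\<close>.\<close>

lemma finite_codim_projection:
  fixes G :: "'b::real_vector set" and \<Phi> :: "('b \<Rightarrow> real) set"
  assumes "finite B" "subspace G" "span (G \<union> B) = UNIV"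
    and linear: "\<And>\<phi>. \<phi> \<in> \<Phi> \<Longrightarrow> linear \<phi>"
    and comb: "\<And>\<phi> \<psi> c. \<phi> \<in> \<Phi> \<Longrightarrow> \<psi> \<in> \<Phi> \<Longrightarrow> (\<lambda>x. \<phi> x - c * \<psi> x) \<in> \<Phi>"
    and separation: "\<And>b. b \<notin> G \<Longrightarrow> \<exists>\<phi>\<in>\<Phi>. \<phi> b = 1 \<and> (\<forall>g\<in>G. \<phi> g = 0)"
  shows "\<exists>n \<phi> b. (\<forall>i<n::nat. \<phi> i \<in> \<Phi>) \<and> (\<forall>x. x - (\<Sum>i<n. \<phi> i x *\<^sub>R b i) \<in> G)"
  using assms(1-3) separation
proof (induction B arbitrary: G rule: finite_induct)
  case empty
  then have "G = UNIV" by (metis Un_empty_right span_eq_iff)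
  then show ?case by (intro exI[of _ 0]) auto
next
  case (insert b B)
  show ?case
  proof (cases "b \<in> G")
    case True
    then have "span (G \<union> B) = UNIV"
      using insert.prems(2) by (metis Un_insert_left Un_insert_right insert_absorb)
    then show ?thesis using insert.IH insert.prems by blast
  next
    case False
    then obtain \<psi> where \<psi>: "\<psi> \<in> \<Phi>" "\<psi> b = 1" "\<And>g. g \<in> G \<Longrightarrow> \<psi> g = 0"
      using insert.prems(3) by blast
    have lin_\<psi>: "linear \<psi>" by (rule linear[OF \<psi>(1)])
    define G' where "G' = span (insert b G)"
    have mem_G': "x \<in> G' \<longleftrightarrow> (\<exists>t. x - t *\<^sub>R b \<in> G)" for x
      using insert.prems(1) unfolding G'_def by (simp add: span_insert span_eq_iff[THEN iffD2])
    have "G \<union> insert b B \<subseteq> G' \<union> B"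
      using span_superset[of "insert b G"] by (auto simp: G'_def)
    then have "span (G' \<union> B) = UNIV"
      using insert.prems(2) span_mono by blast
    moreover have "\<exists>\<phi>\<in>\<Phi>. \<phi> b' = 1 \<and> (\<forall>g\<in>G'. \<phi> g = 0)" if "b' \<notin> G'" for b'
    proof -
      have "b' - \<psi> b' *\<^sub>R b \<notin> G" using that mem_G' by blast
      then obtain \<phi> where \<phi>: "\<phi> \<in> \<Phi>" "\<phi> (b' - \<psi> b' *\<^sub>R b) = 1" "\<And>g. g \<in> G \<Longrightarrow> \<phi> g = 0"
        using insert.prems(3) by blast
      have lin_\<phi>: "linear \<phi>" by (rule linear[OF \<phi>(1)])
      let ?\<theta> = "\<lambda>x. \<phi> x - \<phi> b * \<psi> x"
      have "?\<theta> \<in> \<Phi>" by (rule comb[OF \<phi>(1) \<psi>(1)])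
      moreover have "?\<theta> b' = 1"
        using \<phi>(2) by (simp add: linear_diff[OF lin_\<phi>] linear_scale[OF lin_\<phi>] mult.commute)
      moreover have "?\<theta> g = 0" if g: "g \<in> G'" for g
      proof -
        obtain t where t: "g - t *\<^sub>R b \<in> G" using g mem_G' by blast
        have "\<phi> g = t * \<phi> b" "\<psi> g = t"
          using \<phi>(3)[OF t] \<psi>(3)[OF t] \<psi>(2)
          by (simp_all add: linear_diff[OF lin_\<phi>] linear_scale[OF lin_\<phi>]
              linear_diff[OF lin_\<psi>] linear_scale[OF lin_\<psi>])
        then show ?thesis by simp
      qed
      ultimately show ?thesis by (intro bexI[of _ ?\<theta>]) auto
    qed
    moreover have "subspace G'" by (simp add: G'_def)
    ultimately have "\<exists>n \<phi> c. (\<forall>i<n::nat. \<phi> i \<in> \<Phi>) \<and> (\<forall>x. x - (\<Sum>i<n. \<phi> i x *\<^sub>R c i) \<in> G')"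
      by (intro insert.IH)
    then obtain n \<phi> c where
      "(\<forall>i<n::nat. \<phi> i \<in> \<Phi>) \<and> (\<forall>x. x - (\<Sum>i<n. \<phi> i x *\<^sub>R c i) \<in> G')" by (elim exE)
    then have IH: "\<And>i. i < n \<Longrightarrow> \<phi> i \<in> \<Phi>" "\<And>x. x - (\<Sum>i<n. \<phi> i x *\<^sub>R c i) \<in> G'" by simp_all
    \<comment> \<open>The coordinate along \<open>b\<close> of what the projection onto \<open>G'\<close> leaves.\<close>
    define \<theta> where "\<theta> x = \<psi> x - (\<Sum>i<n. \<phi> i x * \<psi> (c i))" for x
    have "(\<lambda>x. \<psi> x - (\<Sum>i<k. \<phi> i x * \<psi> (c i))) \<in> \<Phi>" if "k \<le> n" for k
      using that
    proof (induction k)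
      case (Suc k)
      then show ?case
        using comb[of "\<lambda>x. \<psi> x - (\<Sum>i<k. \<phi> i x * \<psi> (c i))" "\<phi> k" "\<psi> (c k)"] IH(1)[of k]
        by (simp add: algebra_simps)
    qed (simp add: \<psi>)
    then have "\<theta> \<in> \<Phi>" unfolding \<theta>_def[abs_def] by blast
    moreover have "x - (\<Sum>i<n. \<phi> i x *\<^sub>R c i) - \<theta> x *\<^sub>R b \<in> G" for x
    proof -
      obtain t where t: "x - (\<Sum>i<n. \<phi> i x *\<^sub>R c i) - t *\<^sub>R b \<in> G" using IH(2) mem_G' by blast
      have "\<theta> x = t"
        using \<psi>(3)[OF t] \<psi>(2)
        by (simp add: \<theta>_def linear_diff[OF lin_\<psi>] linear_scale[OF lin_\<psi>] linear_sum[OF lin_\<psi>])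
      then show ?thesis using t by simp
    qed
    then have "x - (\<Sum>i<Suc n. (\<phi>(n := \<theta>)) i x *\<^sub>R (c(n := b)) i) \<in> G" for x
      by (simp add: diff_diff_eq)
    moreover have "\<forall>i<Suc n. (\<phi>(n := \<theta>)) i \<in> \<Phi>" using IH(1) \<open>\<theta> \<in> \<Phi>\<close> by (simp add: less_Suc_eq)
    ultimately show ?thesis by blast
  qed
qed

lemma subspace_dist_scale:
  fixes x :: "'b::real_normed_vector"
  assumes "subspace W" "x - t *\<^sub>R b \<in> W"
  shows "\<bar>t\<bar> * infdist b W \<le> norm x"
proof (cases "t = 0")
  case False
  have "b - (1 / t) *\<^sub>R x = (- (1 / t)) *\<^sub>R (x - t *\<^sub>R b)"
    using False by (simp add: scaleR_diff_right)
  also have "\<dots> \<in> W" using assms subspace_scale by blast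
  finally have "infdist b W \<le> dist b (b - (1 / t) *\<^sub>R x)" by (rule infdist_le)
  also have "\<dots> = norm x / \<bar>t\<bar>" by (simp add: dist_norm)
  finally show ?thesis using False by (simp add: field_simps)
qed simp

text \<open>The coefficients at \<open>b\<close> of a convergent sequence form a Cauchy sequence, since \<open>b\<close> has positive distance to \<open>W\<close>.\<close>

lemma closed_span_insert:
  fixes W :: "'b::real_normed_vector set"
  assumes "closed W" "subspace W"
  shows "closed (span (insert b W))"
proof (cases "b \<in> W")
  case True
  then show ?thesis using assms by (simp add: insert_absorb span_eq_iff[THEN iffD2])
next
  case False
  have d: "0 < infdist b W"
    using assms False subspace_0[OF assms(2)] in_closed_iff_infdist_zero[of W b] infdist_nonneg[of b W] by force
  have mem: "x \<in> span (insert b W) \<longleftrightarrow> (\<exists>t. x - t *\<^sub>R b \<in> W)" for x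
    using assms(2) by (simp add: span_insert span_eq_iff[THEN iffD2])
  show ?thesis
    unfolding closed_sequential_limits
  proof (intro allI impI)
    fix y x assume y: "(\<forall>n. y n \<in> span (insert b W)) \<and> y \<longlonglongrightarrow> x"
    then have "\<forall>n. \<exists>t. y n - t *\<^sub>R b \<in> W" using mem by blast
    then obtain t where t: "\<And>n. y n - t n *\<^sub>R b \<in> W" by metis
    have bound: "\<bar>t m - t n\<bar> * infdist b W \<le> norm (y m - y n)" for m n
    proof (rule subspace_dist_scale[OF assms(2)])
      show "y m - y n - (t m - t n) *\<^sub>R b \<in> W"
        using subspace_diff[OF assms(2) t[of m] t[of n]] by (simp add: algebra_simps)
    qed
    have "Cauchy y" using y LIMSEQ_imp_Cauchy by blast
    have "Cauchy t"
    proof (rule metric_CauchyI)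
      fix r :: real assume "0 < r"
      then have "0 < r * infdist b W" using d by simp
      then obtain M where M: "\<And>m n. M \<le> m \<Longrightarrow> M \<le> n \<Longrightarrow> dist (y m) (y n) < r * infdist b W"
        using \<open>Cauchy y\<close> unfolding Cauchy_def by blast
      have "dist (t m) (t n) < r" if "M \<le> m" "M \<le> n" for m n
      proof -
        have "\<bar>t m - t n\<bar> * infdist b W < r * infdist b W"
          using bound[of m n] M[OF that] by (simp add: dist_norm)
        then show ?thesis using d by (simp add: dist_real_def mult_less_cancel_right)
      qed
      then show "\<exists>M. \<forall>m\<ge>M. \<forall>n\<ge>M. dist (t m) (t n) < r" by blast
    qed
    then obtain l where l: "t \<longlonglongrightarrow> l" using Cauchy_convergent_iff convergent_def by blast
    have "(\<lambda>n. y n - t n *\<^sub>R b) \<longlonglongrightarrow> x - l *\<^sub>R b"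
      using y l by (intro tendsto_intros) auto
    then have "x - l *\<^sub>R b \<in> W"
      using closed_sequentially[OF assms(1), of "\<lambda>n. y n - t n *\<^sub>R b"] t by simp
    then show "x \<in> span (insert b W)" using mem by blast
  qed
qed

lemma closed_span_Un_finite:
  fixes W :: "'b::real_normed_vector set"
  assumes "finite B" "closed W" "subspace W"
  shows "closed (span (B \<union> W))"
  using assms(1)
proof (induction B rule: finite_induct)
  case empty
  then show ?case using assms by (simp add: span_eq_iff[THEN iffD2])
next
  case (insert b B)
  have "span (insert b B \<union> W) = span (insert b (span (B \<union> W)))"
    by (simp add: span_insert span_span)
  then show ?case using closed_span_insert[OF insert.IH] by simp
qed

text \<open>A finite-codimensional case of the Hahn--Banach theorem. Enlarge \<open>W\<close> by as many vectors
  of a finite complementing set as possible without reaching \<open>b\<close>. The result \<open>V\<close> is closed, and by maximality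
  \<open>V\<close> and \<open>b\<close> together span the whole space, so the coordinate along \<open>b\<close> is a functional; it is bounded because \<open>b\<close> has
  positive distance to \<open>V\<close>.\<close>

lemma closed_finite_codim_separation:
  fixes W :: "'b::real_normed_vector set"
  assumes "W \<in> cof" "b \<notin> W"
  shows "\<exists>f::'b \<Rightarrow>\<^sub>L real. blinfun_apply f b = 1 \<and> (\<forall>g\<in>W. blinfun_apply f g = 0)"
proof -
  obtain B where W: "closed W" "subspace W" "finite B" "span (W \<union> B) = UNIV"
    using assms(1) by (auto simp: cof_def finite_codim_subspace_def)
  define Bs where "Bs = {B'. B' \<subseteq> B \<and> b \<notin> span (B' \<union> W)}"
  have "finite Bs" "{} \<in> Bs"
    using W assms(2) by (auto simp: Bs_def span_eq_iff[THEN iffD2])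
  then obtain B' where B': "B' \<in> Bs" and max: "\<And>C. C \<in> Bs \<Longrightarrow> B' \<subseteq> C \<Longrightarrow> C = B'"
    using finite_has_maximal[of Bs] by (metis empty_iff)
  define V where "V = span (B' \<union> W)"
  have V: "closed V" "subspace V" "b \<notin> V" "W \<subseteq> V"
    using B' W finite_subset[of B' B] closed_span_Un_finite[of B' W] span_superset[of "B' \<union> W"]
    by (auto simp: V_def Bs_def)
  have ex: "\<exists>t. x - t *\<^sub>R b \<in> V" for x
  proof -
    have sub: "subspace {x. \<exists>t. x - t *\<^sub>R b \<in> V}"
    proof -
      have "{x. \<exists>t. x - t *\<^sub>R b \<in> V} = span (insert b V)"
        using V(2) by (simp add: span_insert span_eq_iff[THEN iffD2])
      then show ?thesis by simp
    qed
    have "c \<in> {x. \<exists>t. x - t *\<^sub>R b \<in> V}" if c: "c \<in> B" for c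
    proof (cases "c \<in> V")
      case True
      then show ?thesis by (auto intro: exI[of _ 0])
    next
      case False
      then have "insert c B' \<notin> Bs" using max[of "insert c B'"] span_base[of c "B' \<union> W"] by (auto simp: V_def)
      then have "b \<in> span (insert c V)"
        using c B' unfolding Bs_def V_def by (auto simp: span_insert span_span)
      then obtain t where t: "b - t *\<^sub>R c \<in> V"
        using V(2) by (auto simp: span_insert span_eq_iff[THEN iffD2])
      then have "t \<noteq> 0" using V(3) by auto
      then have "c - (1 / t) *\<^sub>R b = (- (1 / t)) *\<^sub>R (b - t *\<^sub>R c)"
        by (simp add: scaleR_diff_right)
      also have "\<dots> \<in> V" using t V(2) subspace_scale by blast
      finally show ?thesis by blast
    qed
    moreover have "W \<subseteq> {x. \<exists>t. x - t *\<^sub>R b \<in> V}"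
    proof
      fix x assume "x \<in> W"
      then have "x - 0 *\<^sub>R b \<in> V" using V(4) by auto
      then show "x \<in> {x. \<exists>t. x - t *\<^sub>R b \<in> V}" by blast
    qed
    ultimately have "span (W \<union> B) \<subseteq> {x. \<exists>t. x - t *\<^sub>R b \<in> V}"
      using sub by (intro span_minimal) auto
    then show ?thesis using W(4) by auto
  qed
  then obtain f where f: "\<And>x. x - f x *\<^sub>R b \<in> V" by metis
  have d: "0 < infdist b V"
    using V subspace_0[OF V(2)] in_closed_iff_infdist_zero[of V b] infdist_nonneg[of b V] by force
  have f_eq: "f x = t" if "x - t *\<^sub>R b \<in> V" for x t
  proof -
    have "0 - (t - f x) *\<^sub>R b \<in> V"
      using subspace_diff[OF V(2) that f[of x]] by (simp add: algebra_simps)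
    then have "\<bar>t - f x\<bar> * infdist b V \<le> norm (0::'b)" by (rule subspace_dist_scale[OF V(2)])
    then show ?thesis using d by (simp add: mult_le_0_iff)
  qed
  have "bounded_linear f"
  proof (rule bounded_linear_intro[where K = "1 / infdist b V"])
    show "f (x + y) = f x + f y" for x y
      using subspace_add[OF V(2) f[of x] f[of y]] by (intro f_eq) (simp add: algebra_simps)
    show "f (r *\<^sub>R x) = r *\<^sub>R f x" for r x
      using subspace_scale[OF V(2) f[of x], of r] by (intro f_eq) (simp add: algebra_simps)
    show "norm (f x) \<le> norm x * (1 / infdist b V)" for x
      using subspace_dist_scale[OF V(2) f[of x]] d by (simp add: field_simps)
  qed
  moreover have "f b = 1" using subspace_0[OF V(2)] by (intro f_eq) simp
  moreover have "f g = 0" if "g \<in> W" for g using that V(4) by (intro f_eq) auto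
  ultimately show ?thesis
    by (intro exI[of _ "Blinfun f"]) (simp add: bounded_linear_Blinfun_apply)
qed

text \<open>The image of \<open>G\<close> under finitely many evaluations is a subspace of a finite-dimensional space: it contains the image
  of \<open>b\<close>, or a linear combination of the evaluations separates the two. The induction eliminates one
  evaluation at a time, as in Gaussian elimination, with a pivot \<open>g0\<close> in \<open>G\<close> if there is one.\<close>

lemma finitely_many_evaluations_separation:
  fixes G :: "('b::real_normed_vector \<Rightarrow>\<^sub>L real) set" and x :: "'i \<Rightarrow> 'b"
  assumes "finite A" "subspace G"
  shows "(\<exists>g\<in>G. \<forall>i\<in>A. blinfun_apply g (x i) = blinfun_apply b (x i)) \<or>
    (\<exists>w. blinfun_apply b w = 1 \<and> (\<forall>g\<in>G. blinfun_apply g w = 0))"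
  using assms
proof (induction A arbitrary: G x b rule: finite_induct)
  case empty
  then show ?case using subspace_0 by auto
next
  case (insert i A)
  show ?case
  proof (cases "\<forall>g\<in>G. blinfun_apply g (x i) = 0")
    case True
    show ?thesis
    proof (cases "blinfun_apply b (x i) = 0")
      case b0: True
      then show ?thesis using insert.IH[OF insert.prems, of x b] True by auto
    next
      case False
      then have "blinfun_apply b ((1 / blinfun_apply b (x i)) *\<^sub>R x i) = 1"
        by (simp add: blinfun.scaleR_right)
      moreover have "\<forall>g\<in>G. blinfun_apply g ((1 / blinfun_apply b (x i)) *\<^sub>R x i) = 0"
        using True by (simp add: blinfun.scaleR_right)
      ultimately show ?thesis by blast
    qed
  next
    case False
    then obtain g1 where g1: "g1 \<in> G" "blinfun_apply g1 (x i) \<noteq> 0" by blast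
    define g0 where "g0 = (1 / blinfun_apply g1 (x i)) *\<^sub>R g1"
    have g0: "g0 \<in> G" "blinfun_apply g0 (x i) = 1"
      using g1 subspace_scale[OF insert.prems g1(1)] by (auto simp: g0_def blinfun.scaleR_left)
    define G' where "G' = {g \<in> G. blinfun_apply g (x i) = 0}"
    have sub: "subspace G'"
      using insert.prems unfolding G'_def subspace_def
      by (auto simp: blinfun.add_left blinfun.scaleR_left)
    define b' where "b' = b - blinfun_apply b (x i) *\<^sub>R g0"
    define x' where "x' j = x j - blinfun_apply g0 (x j) *\<^sub>R x i" for j
    have b'i: "blinfun_apply b' (x i) = 0" by (simp add: b'_def blinfun.diff_left blinfun.scaleR_left g0)
    from insert.IH[OF sub, of x' b'] show ?thesis
    proof
      assume "\<exists>g\<in>G'. \<forall>j\<in>A. blinfun_apply g (x' j) = blinfun_apply b' (x' j)"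
      then obtain g where g: "g \<in> G" "blinfun_apply g (x i) = 0"
        "\<And>j. j \<in> A \<Longrightarrow> blinfun_apply g (x' j) = blinfun_apply b' (x' j)"
        unfolding G'_def by blast
      let ?g = "g + blinfun_apply b (x i) *\<^sub>R g0"
      have "?g \<in> G" using g g0 insert.prems by (simp add: subspace_add subspace_scale)
      moreover have "blinfun_apply ?g (x j) = blinfun_apply b (x j)" if "j \<in> insert i A" for j
      proof (cases "j = i")
        case True
        then show ?thesis by (simp add: blinfun.add_left blinfun.scaleR_left g g0)
      next
        case False
        then have "blinfun_apply g (x j) = blinfun_apply b' (x j)"
          using g(3)[of j] that b'i g(2) by (simp add: x'_def blinfun.diff_right blinfun.scaleR_right)
        then show ?thesis by (simp add: blinfun.add_left blinfun.scaleR_left b'_def blinfun.diff_left)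
      qed
      ultimately show ?thesis by blast
    next
      assume "\<exists>w. blinfun_apply b' w = 1 \<and> (\<forall>g\<in>G'. blinfun_apply g w = 0)"
      then obtain w where w: "blinfun_apply b' w = 1" "\<And>g. g \<in> G' \<Longrightarrow> blinfun_apply g w = 0" by blast
      let ?w = "w - blinfun_apply g0 w *\<^sub>R x i"
      have "blinfun_apply b ?w = 1"
        using w(1) by (simp add: b'_def blinfun.diff_left blinfun.diff_right blinfun.scaleR_left
          blinfun.scaleR_right mult.commute)
      moreover have "blinfun_apply g ?w = 0" if g: "g \<in> G" for g
      proof -
        have "g - blinfun_apply g (x i) *\<^sub>R g0 \<in> G'"
          using g g0 insert.prems
          by (simp add: G'_def subspace_diff subspace_scale blinfun.diff_left blinfun.scaleR_left)
        from w(2)[OF this] show ?thesis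
          by (simp add: blinfun.diff_left blinfun.diff_right blinfun.scaleR_left
            blinfun.scaleR_right mult.commute)
      qed
      ultimately show ?thesis by blast
    qed
  qed
qed

text \<open>A weak-star neighbourhood of \<open>b\<close> that misses \<open>G\<close> restricts only finitely many evaluations, so on these \<open>b\<close> agrees with no
  element of \<open>G\<close>.\<close>

lemma wstar_closed_separation:
  fixes G :: "('b::real_normed_vector \<Rightarrow>\<^sub>L real) set"
  assumes "G \<in> cof_wstar" "b \<notin> G"
  shows "\<exists>w. blinfun_apply b w = 1 \<and> (\<forall>g\<in>G. blinfun_apply g w = 0)"
proof -
  have G: "closedin strong_operator_topology G" "subspace G"
    using assms(1) by (auto simp: cof_wstar_def finite_codim_subspace_def)
  have "openin strong_operator_topology (- G)"
    using G(1) by (simp add: closedin_def strong_operator_topology_topspace Compl_eq_Diff_UNIV)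
  then obtain U where U: "open U" "- G = blinfun_apply -` U"
    unfolding strong_operator_topology_def openin_pullback_topology by auto
  have "openin (product_topology (\<lambda>_. euclidean) UNIV) U"
    using U(1) by (simp add: open_fun_def)
  moreover have "blinfun_apply b \<in> U" using U(2) assms(2) by auto
  ultimately obtain X where X: "blinfun_apply b \<in> (\<Pi>\<^sub>E i\<in>UNIV. X i)"
    "finite {i. X i \<noteq> UNIV}" "(\<Pi>\<^sub>E i\<in>UNIV. X i) \<subseteq> U"
    using product_topology_open_contains_basis[of "\<lambda>_. euclidean" UNIV U "blinfun_apply b"]
    by (auto simp: topspace_euclidean)
  have "\<not> (\<exists>g\<in>G. \<forall>i\<in>{i. X i \<noteq> UNIV}. blinfun_apply g i = blinfun_apply b i)"
  proof
    assume "\<exists>g\<in>G. \<forall>i\<in>{i. X i \<noteq> UNIV}. blinfun_apply g i = blinfun_apply b i"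
    then obtain g where g: "g \<in> G" "\<And>i. X i \<noteq> UNIV \<Longrightarrow> blinfun_apply g i = blinfun_apply b i" by blast
    have "blinfun_apply g i \<in> X i" for i
      using X(1) g(2)[of i] by (cases "X i = UNIV") (auto simp: PiE_def Pi_def)
    then have "blinfun_apply g \<in> U" using X(3) by (auto simp: PiE_def Pi_def)
    then show False using U(2) g(1) by auto
  qed
  then show ?thesis
    using finitely_many_evaluations_separation[OF X(2) G(2), of "\<lambda>i. i" b] by blast
qed

lemma infdist_projection_le:
  fixes G :: "'b::real_normed_vector set"
  assumes "x - (\<Sum>i<n. \<phi> i x *\<^sub>R b i) \<in> G"
  shows "infdist x G \<le> (\<Sum>i<n. \<bar>\<phi> i x\<bar> * norm (b i))"
proof -
  have "infdist x G \<le> norm (\<Sum>i<n. \<phi> i x *\<^sub>R b i)"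
    using infdist_le[OF assms, of x] by (simp add: dist_norm)
  also have "\<dots> \<le> (\<Sum>i<n. \<bar>\<phi> i x\<bar> * norm (b i))"
    by (rule order_trans[OF norm_sum]) simp
  finally show ?thesis .
qed

text \<open>The first form of control on the moves of player (I): a vector is close to \<open>W\<close> once finitely many functionals are
  small on it.\<close>

lemma cof_infdist_bound:
  fixes W :: "'b::real_normed_vector set"
  assumes "W \<in> cof"
  shows "\<exists>n (f :: nat \<Rightarrow> 'b \<Rightarrow>\<^sub>L real) K. (\<forall>i. 0 \<le> K i) \<and>
    (\<forall>x. infdist x W \<le> (\<Sum>i<n. \<bar>blinfun_apply (f i) x\<bar> * K i))"
proof -
  obtain B where W: "subspace W" "finite B" "span (W \<union> B) = UNIV"
    using assms by (auto simp: cof_def finite_codim_subspace_def)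
  have "\<exists>n \<phi> b. (\<forall>i<n::nat. \<phi> i \<in> range (blinfun_apply :: ('b \<Rightarrow>\<^sub>L real) \<Rightarrow> _)) \<and>
      (\<forall>x. x - (\<Sum>i<n. \<phi> i x *\<^sub>R b i) \<in> W)"
  proof (rule finite_codim_projection[OF W(2,1,3)])
    show "linear \<phi>" if "\<phi> \<in> range (blinfun_apply :: ('b \<Rightarrow>\<^sub>L real) \<Rightarrow> _)" for \<phi>
      using that by (auto intro: bounded_linear.linear blinfun.bounded_linear_right)
    show "(\<lambda>x. \<phi> x - c * \<psi> x) \<in> range (blinfun_apply :: ('b \<Rightarrow>\<^sub>L real) \<Rightarrow> _)"
      if \<phi>\<psi>: "\<phi> \<in> range (blinfun_apply :: ('b \<Rightarrow>\<^sub>L real) \<Rightarrow> _)" "\<psi> \<in> range (blinfun_apply :: ('b \<Rightarrow>\<^sub>L real) \<Rightarrow> _)"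
      for \<phi> \<psi> c
    proof -
      obtain f g :: "'b \<Rightarrow>\<^sub>L real" where "\<phi> = blinfun_apply f" "\<psi> = blinfun_apply g" using \<phi>\<psi> by auto
      then have "(\<lambda>x. \<phi> x - c * \<psi> x) = blinfun_apply (f - c *\<^sub>R g)"
        by (auto simp: blinfun.diff_left blinfun.scaleR_left)
      then show ?thesis by blast
    qed
    show "\<exists>\<phi>\<in>range (blinfun_apply :: ('b \<Rightarrow>\<^sub>L real) \<Rightarrow> _). \<phi> b = 1 \<and> (\<forall>g\<in>W. \<phi> g = 0)"
      if "b \<notin> W" for b
      using closed_finite_codim_separation[OF assms that] by blast
  qed
  then obtain n \<phi> b where "\<forall>i<n::nat. \<exists>f :: 'b \<Rightarrow>\<^sub>L real. \<phi> i = blinfun_apply f"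
    and mem: "\<And>x. x - (\<Sum>i<n. \<phi> i x *\<^sub>R b i) \<in> W" by blast
  then obtain f :: "nat \<Rightarrow> 'b \<Rightarrow>\<^sub>L real" where f: "\<And>i. i < n \<Longrightarrow> \<phi> i = blinfun_apply (f i)" by metis
  show ?thesis
  proof (intro exI[of _ n] exI[of _ f] exI[of _ "\<lambda>i. norm (b i)"] conjI allI)
    show "infdist x W \<le> (\<Sum>i<n. \<bar>blinfun_apply (f i) x\<bar> * norm (b i))" for x
      using infdist_projection_le[where x = x and \<phi> = \<phi> and b = b and n = n, OF mem] f by simp
  qed simp
qed

text \<open>The dual form: closeness to \<open>G\<close> is tested on finitely many vectors.\<close>

lemma cof_wstar_infdist_bound:
  fixes G :: "('b::real_normed_vector \<Rightarrow>\<^sub>L real) set"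
  assumes "G \<in> cof_wstar"
  shows "\<exists>n (w :: nat \<Rightarrow> 'b) K. (\<forall>i. 0 \<le> K i) \<and>
    (\<forall>g. infdist g G \<le> (\<Sum>i<n. \<bar>blinfun_apply g (w i)\<bar> * K i))"
proof -
  let ?\<Phi> = "range (\<lambda>(w::'b) (g::'b \<Rightarrow>\<^sub>L real). blinfun_apply g w)"
  obtain B where G: "subspace G" "finite B" "span (G \<union> B) = UNIV"
    using assms by (auto simp: cof_wstar_def finite_codim_subspace_def)
  have "\<exists>n \<phi> b. (\<forall>i<n::nat. \<phi> i \<in> ?\<Phi>) \<and> (\<forall>x. x - (\<Sum>i<n. \<phi> i x *\<^sub>R b i) \<in> G)"
  proof (rule finite_codim_projection[OF G(2,1,3)])
    show "linear \<phi>" if "\<phi> \<in> ?\<Phi>" for \<phi>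
      using that by (auto intro: bounded_linear.linear blinfun.bounded_linear_left)
    show "(\<lambda>x. \<phi> x - c * \<psi> x) \<in> ?\<Phi>" if \<phi>\<psi>: "\<phi> \<in> ?\<Phi>" "\<psi> \<in> ?\<Phi>" for \<phi> \<psi> c
    proof -
      obtain v w where "\<phi> = (\<lambda>g. blinfun_apply g v)" "\<psi> = (\<lambda>g. blinfun_apply g w)" using \<phi>\<psi> by auto
      then have "(\<lambda>x. \<phi> x - c * \<psi> x) = (\<lambda>g. blinfun_apply g (v - c *\<^sub>R w))"
        by (auto simp: blinfun.diff_right blinfun.scaleR_right)
      then show ?thesis by blast
    qed
    show "\<exists>\<phi>\<in>?\<Phi>. \<phi> b = 1 \<and> (\<forall>g\<in>G. \<phi> g = 0)" if "b \<notin> G" for b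
      using wstar_closed_separation[OF assms that] by auto
  qed
  then obtain n \<phi> b where "\<forall>i<n::nat. \<exists>w. \<phi> i = (\<lambda>g. blinfun_apply g w)"
    and mem: "\<And>x. x - (\<Sum>i<n. \<phi> i x *\<^sub>R b i) \<in> G" by blast
  then obtain w where w: "\<And>i. i < n \<Longrightarrow> \<phi> i = (\<lambda>g. blinfun_apply g (w i))" by metis
  show ?thesis
  proof (intro exI[of _ n] exI[of _ w] exI[of _ "\<lambda>i. norm (b i)"] conjI allI)
    show "infdist g G \<le> (\<Sum>i<n. \<bar>blinfun_apply g (w i)\<bar> * norm (b i))" for g
      using infdist_projection_le[where x = g and \<phi> = \<phi> and b = b and n = n, OF mem] w by simp
  qed simp
qed

section \<open>The Haar basis in terms of levels and positions\<close>

text \<open>The factor by which normalization multiplies a Haar function of levels \<open>m\<close> and \<open>n\<close>.\<close>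

definition weight :: "real \<Rightarrow> real \<Rightarrow> nat \<Rightarrow> nat \<Rightarrow> real" where
  "weight p q m n = 2 powr (real m / p + real n / q)"

lemma weight_pos: "0 < weight p q m n"
  by (simp add: weight_def)

text \<open>The normalized Haar basis, with the rectangle of index \<open>k\<close> given by the levels \<open>lev1 k\<close>, \<open>lev2 k\<close> and the positions
  \<open>pos1 k\<close>, \<open>pos2 k\<close> of its sides. The norm is written on the cells of any level \<open>M\<close> that is fine enough. The
  order enters through the monotonicity of the larger level.\<close>

locale haar_model =
  fixes p q :: real and e :: "nat \<Rightarrow> 'a::banach" and lev1 pos1 lev2 pos2 :: "nat \<Rightarrow> nat"
  assumes p: "1 \<le> p" and q: "1 \<le> q"
    and bij_code: "bij_betw (\<lambda>k. (lev1 k, pos1 k, lev2 k, pos2 k)) UNIV codes"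
    and norm_sum: "finite F \<Longrightarrow> (\<And>k. k \<in> F \<Longrightarrow> lev1 k \<le> M \<and> lev2 k \<le> M) \<Longrightarrow>
      norm (\<Sum>k\<in>F. c k *\<^sub>R e k) = cell_norm p q M (\<lambda>u v. sqrt (\<Sum>k\<in>F.
        (c k * weight p q (lev1 k) (lev2 k))\<^sup>2 * of_bool (u div 2 ^ (M - lev1 k) = pos1 k \<and> v div 2 ^ (M - lev2 k) = pos2 k)))"
    and dense_span: "closure {\<Sum>i\<in>A. c i *\<^sub>R e i | A c. finite A} = UNIV"
    and shell_mono: "k \<le> l \<Longrightarrow> max (lev1 k) (lev2 k) \<le> max (lev1 l) (lev2 l)"
begin

definition index :: "nat \<times> nat \<times> nat \<times> nat \<Rightarrow> nat" where
  "index = inv (\<lambda>k. (lev1 k, pos1 k, lev2 k, pos2 k))"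

lemma index_eq_iff:
  assumes "i < 2 ^ m" "j < 2 ^ n"
  shows "index (m, i, n, j) = k \<longleftrightarrow> lev1 k = m \<and> pos1 k = i \<and> lev2 k = n \<and> pos2 k = j"
proof -
  have "(m, i, n, j) \<in> range (\<lambda>k. (lev1 k, pos1 k, lev2 k, pos2 k))"
    using bij_code assms by (simp add: bij_betw_def codes_def)
  from f_inv_into_f[OF this] have "(\<lambda>k. (lev1 k, pos1 k, lev2 k, pos2 k)) (index (m, i, n, j)) = (m, i, n, j)"
    unfolding index_def .
  then show ?thesis
    using injD[OF bij_betw_imp_inj_on[OF bij_code], of "index (m, i, n, j)" k] by auto
qed

lemma pos_less: "pos1 k < 2 ^ lev1 k" "pos2 k < 2 ^ lev2 k"
proof -
  have "(lev1 k, pos1 k, lev2 k, pos2 k) \<in> codes" using bij_betwE[OF bij_code] by blast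
  then show "pos1 k < 2 ^ lev1 k" "pos2 k < 2 ^ lev2 k" by (simp_all add: codes_def)
qed

lemma index_code [simp]:
  assumes "i < 2 ^ m" "j < 2 ^ n"
  shows "lev1 (index (m, i, n, j)) = m" "pos1 (index (m, i, n, j)) = i"
    "lev2 (index (m, i, n, j)) = n" "pos2 (index (m, i, n, j)) = j"
  using index_eq_iff[OF assms, of "index (m, i, n, j)"] by auto

lemma level_bound:
  assumes "finite F" obtains M where "\<And>k. k \<in> F \<Longrightarrow> lev1 k \<le> M \<and> lev2 k \<le> M"
proof
  show "lev1 k \<le> (\<Sum>k\<in>F. lev1 k + lev2 k) \<and> lev2 k \<le> (\<Sum>k\<in>F. lev1 k + lev2 k)" if "k \<in> F" for k
    using member_le_sum[of k F "\<lambda>k. lev1 k + lev2 k"] that assms by simp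
qed

definition square_fn :: "nat set \<Rightarrow> (nat \<Rightarrow> real) \<Rightarrow> nat \<Rightarrow> nat \<Rightarrow> nat \<Rightarrow> real" where
  "square_fn F c M u v = sqrt (\<Sum>k\<in>F. (c k * weight p q (lev1 k) (lev2 k))\<^sup>2 *
     of_bool (u div 2 ^ (M - lev1 k) = pos1 k \<and> v div 2 ^ (M - lev2 k) = pos2 k))"

lemma norm_eq:
  assumes "finite F" "\<And>k. k \<in> F \<Longrightarrow> lev1 k \<le> M \<and> lev2 k \<le> M"
  shows "norm (\<Sum>k\<in>F. c k *\<^sub>R e k) = cell_norm p q M (square_fn F c M)"
  unfolding square_fn_def[abs_def] by (rule norm_sum) (use assms in auto)

lemma norm_mono:
  assumes "finite F'" "F \<subseteq> F'" "\<And>k. k \<in> F \<Longrightarrow> \<bar>c k\<bar> \<le> \<bar>d k\<bar>"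
  shows "norm (\<Sum>k\<in>F. c k *\<^sub>R e k) \<le> norm (\<Sum>k\<in>F'. d k *\<^sub>R e k)"
proof -
  obtain M where M: "\<And>k. k \<in> F' \<Longrightarrow> lev1 k \<le> M \<and> lev2 k \<le> M" using level_bound[OF assms(1)] by metis
  have "finite F" using assms finite_subset by blast
  have sq: "(c k * weight p q (lev1 k) (lev2 k))\<^sup>2 \<le> (d k * weight p q (lev1 k) (lev2 k))\<^sup>2" if "k \<in> F" for k
    using assms(3)[OF that] by (auto simp: abs_mult mult_right_mono intro!: power2_le_iff_abs_le[THEN iffD2] simp flip: abs_le_square_iff)
  have MF: "lev1 k \<le> M \<and> lev2 k \<le> M" if "k \<in> F" for k using M that assms(2) by blast
  have "cell_norm p q M (square_fn F c M) \<le> cell_norm p q M (square_fn F' d M)"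
  proof (rule cell_norm_mono[OF p q])
    fix u v :: nat
    let ?\<theta> = "\<lambda>k. of_bool (u div 2 ^ (M - lev1 k) = pos1 k \<and> v div 2 ^ (M - lev2 k) = pos2 k) :: real"
    have "(\<Sum>k\<in>F. (c k * weight p q (lev1 k) (lev2 k))\<^sup>2 * ?\<theta> k)
        \<le> (\<Sum>k\<in>F. (d k * weight p q (lev1 k) (lev2 k))\<^sup>2 * ?\<theta> k)"
      by (intro sum_mono mult_right_mono sq) auto
    also have "\<dots> \<le> (\<Sum>k\<in>F'. (d k * weight p q (lev1 k) (lev2 k))\<^sup>2 * ?\<theta> k)"
      using assms by (intro sum_mono2) auto
    finally show "\<bar>square_fn F c M u v\<bar> \<le> \<bar>square_fn F' d M u v\<bar>"
      by (simp add: square_fn_def sum_nonneg)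
  qed
  then show ?thesis
    using norm_eq[OF \<open>finite F\<close> MF, where c = c] norm_eq[OF assms(1) M, where c = d] by simp
qed

lemma e_nonzero: "e k \<noteq> 0"
proof
  assume "e k = 0"
  define M where "M = max (lev1 k) (lev2 k)"
  have "norm (\<Sum>i\<in>{k}. 1 *\<^sub>R e i) = 0" using \<open>e k = 0\<close> by simp
  then have "cell_norm p q M (square_fn {k} (\<lambda>_. 1) M) = 0"
    by (subst (asm) norm_eq[where M = M]) (auto simp: M_def)
  from cell_norm_eq_0_imp[OF this]
  have zero: "square_fn {k} (\<lambda>_. 1) M u v = 0" if "u < 2 ^ M" "v < 2 ^ M" for u v using that by blast
  have "x * 2 ^ (M - m) < 2 ^ M" if "x < 2 ^ m" "m \<le> M" for x m :: nat
  proof -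
    have "x * 2 ^ (M - m) < 2 ^ m * 2 ^ (M - m)" using that by (intro mult_strict_right_mono) auto
    then show ?thesis using that by (simp flip: power_add)
  qed
  then have "pos1 k * 2 ^ (M - lev1 k) < 2 ^ M" "pos2 k * 2 ^ (M - lev2 k) < 2 ^ M"
    using pos_less[of k] by (auto simp: M_def)
  from zero[OF this] have "weight p q (lev1 k) (lev2 k) = 0" by (simp add: square_fn_def)
  then show False using weight_pos[of p q "lev1 k" "lev2 k"] by simp
qed

sublocale suppression_basis e
proof
  show "norm (\<Sum>i\<in>A. c i *\<^sub>R e i) \<le> norm (\<Sum>i\<in>B. c i *\<^sub>R e i)" if "finite B" "A \<subseteq> B" for A B c
    using that by (intro norm_mono) auto
qed (use e_nonzero dense_span in auto)

text \<open>The index of the rectangle that arises when the digits of the first side are flipped where \<open>g\<close> has a one, and those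
  of the second side where \<open>h\<close> has a one. The masks refer to level \<open>M\<close>; at coarser levels only their leading digits act.\<close>

definition shift :: "nat \<Rightarrow> nat \<Rightarrow> nat \<Rightarrow> nat \<Rightarrow> nat" where
  "shift M g h k = index (lev1 k, xor (pos1 k) (g div 2 ^ (M - lev1 k)), lev2 k, xor (pos2 k) (h div 2 ^ (M - lev2 k)))"

lemma shift_code:
  assumes "g < 2 ^ M" "h < 2 ^ M" "lev1 k \<le> M" "lev2 k \<le> M"
  shows "lev1 (shift M g h k) = lev1 k" "pos1 (shift M g h k) = xor (pos1 k) (g div 2 ^ (M - lev1 k))"
    "lev2 (shift M g h k) = lev2 k" "pos2 (shift M g h k) = xor (pos2 k) (h div 2 ^ (M - lev2 k))"
proof -
  have "g div 2 ^ (M - lev1 k) < 2 ^ lev1 k" "h div 2 ^ (M - lev2 k) < 2 ^ lev2 k"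
    using assms by (auto simp: less_mult_imp_div_less simp flip: power_add)
  then have "xor (pos1 k) (g div 2 ^ (M - lev1 k)) < 2 ^ lev1 k" "xor (pos2 k) (h div 2 ^ (M - lev2 k)) < 2 ^ lev2 k"
    using pos_less xor_less_power by blast+
  then show "lev1 (shift M g h k) = lev1 k" "pos1 (shift M g h k) = xor (pos1 k) (g div 2 ^ (M - lev1 k))"
    "lev2 (shift M g h k) = lev2 k" "pos2 (shift M g h k) = xor (pos2 k) (h div 2 ^ (M - lev2 k))"
    by (simp_all add: shift_def)
qed

lemma code_eqI: "lev1 k = lev1 l \<Longrightarrow> pos1 k = pos1 l \<Longrightarrow> lev2 k = lev2 l \<Longrightarrow> pos2 k = pos2 l \<Longrightarrow> k = l"
  using injD[OF bij_betw_imp_inj_on[OF bij_code], of k l] by simp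

lemma shift_shift:
  assumes "g < 2 ^ M" "h < 2 ^ M" "g' < 2 ^ M" "h' < 2 ^ M" "lev1 k \<le> M" "lev2 k \<le> M"
  shows "shift M g h (shift M g' h' k) = shift M (xor g g') (xor h h') k"
proof -
  have swap: "xor (xor a b) c = xor a (xor c b)" for a b c :: nat
    by (simp only: xor.assoc xor.commute[of c b])
  have xor: "xor g g' < 2 ^ M" "xor h h' < 2 ^ M" using assms xor_less_power by auto
  note once = shift_code[OF assms(3,4,5,6)]
  have lev: "lev1 (shift M g' h' k) \<le> M" "lev2 (shift M g' h' k) \<le> M" using assms once by simp_all
  note twice = shift_code[OF assms(1,2) lev]
  show ?thesis
    by (rule code_eqI) (simp_all only: twice once shift_code[OF xor assms(5,6)] xor_div_power swap)
qed

lemma shift_0 [simp]: "shift M 0 0 k = k"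
  using index_eq_iff[OF pos_less, of k k] by (simp add: shift_def)

text \<open>A flip permutes the cells of level \<open>M\<close> in each variable, so it is an isometry on combinations of basis vectors up to that level.\<close>

lemma norm_shift:
  assumes "finite F" "\<And>k. k \<in> F \<Longrightarrow> lev1 k \<le> M \<and> lev2 k \<le> M" "g < 2 ^ M" "h < 2 ^ M"
  shows "norm (\<Sum>k\<in>F. c k *\<^sub>R e (shift M g h k)) = norm (\<Sum>k\<in>F. c k *\<^sub>R e k)"
proof -
  let ?T = "shift M g h"
  have inv: "?T (?T k) = k" if "k \<in> F" for k
    using assms(2)[OF that] assms(3,4) by (simp add: shift_shift)
  have inj: "inj_on ?T F" by (rule inj_on_inverseI[where g = ?T]) (rule inv)
  have lev: "lev1 (?T k) = lev1 k" "lev2 (?T k) = lev2 k" if "k \<in> F" for k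
    using assms(2)[OF that] assms(3,4) by (simp_all add: shift_code)
  have "norm (\<Sum>k\<in>F. c k *\<^sub>R e (?T k)) = norm (\<Sum>k\<in>?T ` F. c (?T k) *\<^sub>R e k)"
    by (subst sum.reindex[OF inj]) (simp add: inv)
  also have "\<dots> = cell_norm p q M (square_fn (?T ` F) (\<lambda>k. c (?T k)) M)"
  proof (rule norm_eq)
    fix l assume "l \<in> ?T ` F"
    then obtain k where "k \<in> F" "l = ?T k" by blast
    then show "lev1 l \<le> M \<and> lev2 l \<le> M" using lev assms(2) by simp
  qed (simp add: assms(1))
  also have "\<dots> = cell_norm p q M (\<lambda>u v. square_fn F c M (xor u g) (xor v h))"
  proof -
    have "of_bool (u div 2 ^ (M - lev1 (?T k)) = pos1 (?T k) \<and> v div 2 ^ (M - lev2 (?T k)) = pos2 (?T k))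
      = (of_bool (xor u g div 2 ^ (M - lev1 k) = pos1 k \<and> xor v h div 2 ^ (M - lev2 k) = pos2 k) :: real)"
      if "k \<in> F" for k u v
    proof -
      have k: "lev1 k \<le> M" "lev2 k \<le> M" using assms(2)[OF that] by simp_all
      show ?thesis
        unfolding shift_code[OF assms(3,4) k] xor_div_power
          eq_xor_iff[of "u div 2 ^ (M - lev1 k)"] eq_xor_iff[of "v div 2 ^ (M - lev2 k)"] ..
    qed
    then have "(\<Sum>k\<in>?T ` F. (c (?T k) * weight p q (lev1 k) (lev2 k))\<^sup>2 *
        of_bool (u div 2 ^ (M - lev1 k) = pos1 k \<and> v div 2 ^ (M - lev2 k) = pos2 k))
      = (\<Sum>k\<in>F. (c k * weight p q (lev1 k) (lev2 k))\<^sup>2 *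
        of_bool (xor u g div 2 ^ (M - lev1 k) = pos1 k \<and> xor v h div 2 ^ (M - lev2 k) = pos2 k))" for u v
      by (subst sum.reindex[OF inj]) (auto simp: inv lev intro!: sum.cong)
    then show ?thesis by (simp add: square_fn_def[abs_def])
  qed
  also have "\<dots> = cell_norm p q M (square_fn F c M)"
    by (rule cell_norm_reindex[OF bij_xor[OF assms(3)] bij_xor[OF assms(4)]])
  also have "\<dots> = norm (\<Sum>k\<in>F. c k *\<^sub>R e k)"
    by (rule norm_eq[symmetric, OF assms(1,2)])
  finally show ?thesis .
qed

section \<open>Blocks of Haar functions\<close>

text \<open>The rectangles of levels \<open>a\<close> and \<open>b\<close> that are mapped into the rectangle of index \<open>r\<close> by reading the digits
  in \<open>D\<close>.\<close>

definition block :: "nat set \<Rightarrow> nat \<Rightarrow> nat \<Rightarrow> nat \<Rightarrow> nat set" where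
  "block D a b r = {k. lev1 k = a \<and> lev2 k = b \<and>
     read_digits D a (pos1 k) = pos1 r \<and> read_digits D b (pos2 k) = pos2 r}"

text \<open>For levels with this property, the intervals of a block have fixed exactly those digits in \<open>D\<close> that decide membership in
  the preimage of the rectangle, and no further ones.\<close>

definition admissible :: "nat set \<Rightarrow> nat \<Rightarrow> nat \<Rightarrow> nat \<Rightarrow> bool" where
  "admissible D a b r \<longleftrightarrow> digit_count D a = lev1 r \<and> digit_count D b = lev2 r"

text \<open>With this coefficient a block vector has the same square function as the basis vector, up to the digit map.\<close>

definition lam :: "nat \<Rightarrow> nat \<Rightarrow> nat \<Rightarrow> real" where
  "lam a b r = weight p q (lev1 r) (lev2 r) / weight p q a b"

lemma lam_pos: "0 < lam a b r"
  by (simp add: lam_def weight_pos)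

lemma finite_block: "finite (block D a b r)"
proof -
  have "block D a b r \<subseteq> (\<lambda>(i, j). index (a, i, b, j)) ` ({..<2 ^ a} \<times> {..<2 ^ b})"
  proof
    fix k assume "k \<in> block D a b r"
    then have "lev1 k = a" "lev2 k = b" by (auto simp: block_def)
    then have "index (a, pos1 k, b, pos2 k) = k" "pos1 k < 2 ^ a" "pos2 k < 2 ^ b"
      using index_eq_iff[OF pos_less, of k k] pos_less[of k] by auto
    then show "k \<in> (\<lambda>(i, j). index (a, i, b, j)) ` ({..<2 ^ a} \<times> {..<2 ^ b})" by force
  qed
  then show ?thesis by (rule finite_subset) simp
qed

lemma block_nonempty:
  assumes "admissible D a b r" shows "block D a b r \<noteq> {}"
proof -
  obtain i j where ij: "i < 2 ^ a" "read_digits D a i = pos1 r" "j < 2 ^ b" "read_digits D b j = pos2 r"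
    using read_digits_surj[of "pos1 r" D a] read_digits_surj[of "pos2 r" D b] pos_less[of r] assms
    by (auto simp: admissible_def)
  then have "index (a, i, b, j) \<in> block D a b r" by (simp add: block_def)
  then show ?thesis by blast
qed

lemma block_cong:
  assumes "D \<inter> {1..a} = D' \<inter> {1..a}" "D \<inter> {1..b} = D' \<inter> {1..b}"
  shows "block D a b r = block D' a b r"
  unfolding block_def read_digits_cong[OF assms(1)] read_digits_cong[OF assms(2)] ..

text \<open>The rectangles of a block tile the preimage of the rectangle of index \<open>r\<close>.\<close>

lemma sum_block_indicator:
  assumes "admissible D a b r" "a \<le> M" "b \<le> M" "u < 2 ^ M" "v < 2 ^ M"
  shows "(\<Sum>k\<in>block D a b r. of_bool (u div 2 ^ (M - lev1 k) = pos1 k \<and> v div 2 ^ (M - lev2 k) = pos2 k))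
    = (of_bool (read_digits D M u div 2 ^ (digit_count D M - lev1 r) = pos1 r \<and>
        read_digits D M v div 2 ^ (digit_count D M - lev2 r) = pos2 r) :: real)"
proof -
  define k0 where "k0 = index (a, u div 2 ^ (M - a), b, v div 2 ^ (M - b))"
  have less: "u div 2 ^ (M - a) < 2 ^ a" "v div 2 ^ (M - b) < 2 ^ b"
    using assms by (auto simp: less_mult_imp_div_less simp flip: power_add)
  have "(\<Sum>k\<in>block D a b r. of_bool (u div 2 ^ (M - lev1 k) = pos1 k \<and> v div 2 ^ (M - lev2 k) = pos2 k))
      = (\<Sum>k\<in>block D a b r. if k0 = k then 1 else 0 :: real)"
  proof (intro sum.cong refl)
    fix k assume "k \<in> block D a b r"
    then have k: "lev1 k = a" "lev2 k = b" by (auto simp: block_def)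
    show "of_bool (u div 2 ^ (M - lev1 k) = pos1 k \<and> v div 2 ^ (M - lev2 k) = pos2 k) = (if k0 = k then 1 else 0 :: real)"
      unfolding k0_def index_eq_iff[OF less] k by auto
  qed
  also have "\<dots> = of_bool (k0 \<in> block D a b r)" by (simp add: finite_block)
  also have "k0 \<in> block D a b r \<longleftrightarrow>
      read_digits D a (u div 2 ^ (M - a)) = pos1 r \<and> read_digits D b (v div 2 ^ (M - b)) = pos2 r"
    by (simp add: block_def k0_def less)
  also have "\<dots> \<longleftrightarrow> read_digits D M u div 2 ^ (digit_count D M - lev1 r) = pos1 r \<and>
        read_digits D M v div 2 ^ (digit_count D M - lev2 r) = pos2 r"
    using assms by (simp add: read_digits_coarser admissible_def)
  finally show ?thesis .
qed

text \<open>The turn to which a basis index belongs, recovered from its levels. Distinct turns use distinct pairs of levels, so that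
  blocks do not overlap.\<close>

definition owner :: "nat set \<Rightarrow> (nat \<Rightarrow> nat) \<Rightarrow> (nat \<Rightarrow> nat) \<Rightarrow> nat \<Rightarrow> nat" where
  "owner S A B i = the_inv_into S (\<lambda>k. (A k, B k)) (lev1 i, lev2 i)"

lemma owner_eq:
  assumes "inj_on (\<lambda>k. (A k, B k)) S" "k \<in> S" "i \<in> block D (A k) (B k) r"
  shows "owner S A B i = k"
  using the_inv_into_f_f[OF assms(1,2)] assms(3) by (simp add: owner_def block_def)

lemma sum_over_blocks:
  fixes f :: "nat \<Rightarrow> nat \<Rightarrow> 'c::comm_monoid_add"
  assumes "finite S" "inj_on (\<lambda>k. (A k, B k)) S"
  shows "(\<Sum>k\<in>S. \<Sum>i\<in>block D (A k) (B k) (R k). f k i)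
      = (\<Sum>i\<in>(\<Union>k\<in>S. block D (A k) (B k) (R k)). f (owner S A B i) i)"
proof -
  let ?E = "\<lambda>k. block D (A k) (B k) (R k)"
  have "(\<Sum>i\<in>(\<Union>k\<in>S. ?E k). f (owner S A B i) i) = (\<Sum>k\<in>S. \<Sum>i\<in>?E k. f (owner S A B i) i)"
  proof (rule sum.UNION_disjoint[OF assms(1)])
    show "\<forall>k\<in>S. \<forall>l\<in>S. k \<noteq> l \<longrightarrow> ?E k \<inter> ?E l = {}"
      using owner_eq[OF assms(2)] by blast
  qed (simp add: finite_block)
  also have "\<dots> = (\<Sum>k\<in>S. \<Sum>i\<in>?E k. f k i)"
    by (intro sum.cong refl) (simp add: owner_eq[OF assms(2)])
  finally show ?thesis by simp
qed

text \<open>Inside one block the squared coefficients with their weights are constant, so the square function of the blocks is that of the rectangles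
  composed with the digit map, which is then removed by measure preservation. The rectangles
  \<open>R k\<close> may coincide: they are distinct for the equivalence with the basis, and all equal for weak nullity.\<close>

lemma norm_blocks:
  fixes A B R :: "nat \<Rightarrow> nat"
  assumes "finite S" "inj_on (\<lambda>k. (A k, B k)) S"
    and adm: "\<And>k. k \<in> S \<Longrightarrow> admissible D (A k) (B k) (R k)"
    and M: "\<And>k. k \<in> S \<Longrightarrow> A k \<le> M \<and> B k \<le> M"
    and sign: "\<And>k i. k \<in> S \<Longrightarrow> i \<in> block D (A k) (B k) (R k) \<Longrightarrow> \<bar>\<epsilon> k i\<bar> = 1"
  shows "norm (\<Sum>k\<in>S. \<Sum>i\<in>block D (A k) (B k) (R k). (\<alpha> k * \<epsilon> k i * lam (A k) (B k) (R k)) *\<^sub>R e i)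
    = cell_norm p q (digit_count D M) (\<lambda>u v. sqrt (\<Sum>k\<in>S. (\<alpha> k * weight p q (lev1 (R k)) (lev2 (R k)))\<^sup>2 *
       of_bool (u div 2 ^ (digit_count D M - lev1 (R k)) = pos1 (R k) \<and>
                v div 2 ^ (digit_count D M - lev2 (R k)) = pos2 (R k))))"
proof -
  let ?E = "\<lambda>k. block D (A k) (B k) (R k)"
  let ?U = "\<Union>k\<in>S. ?E k"
  let ?f = "\<lambda>k i. \<alpha> k * \<epsilon> k i * lam (A k) (B k) (R k)"
  let ?own = "owner S A B"
  define c where "c i = ?f (?own i) i" for i
  have finU: "finite ?U" using assms(1) finite_block by blast
  have lev: "lev1 i \<le> M \<and> lev2 i \<le> M" if "i \<in> ?U" for i using that M by (auto simp: block_def)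
  have "norm (\<Sum>k\<in>S. \<Sum>i\<in>?E k. ?f k i *\<^sub>R e i) = norm (\<Sum>i\<in>?U. c i *\<^sub>R e i)"
    unfolding c_def by (subst sum_over_blocks[OF assms(1,2)]) simp
  also have "\<dots> = cell_norm p q M (square_fn ?U c M)" by (rule norm_eq[OF finU lev])
  also have "\<dots> = cell_norm p q M (\<lambda>u v. (\<lambda>u v. sqrt (\<Sum>k\<in>S. (\<alpha> k * weight p q (lev1 (R k)) (lev2 (R k)))\<^sup>2 *
       of_bool (u div 2 ^ (digit_count D M - lev1 (R k)) = pos1 (R k) \<and>
                v div 2 ^ (digit_count D M - lev2 (R k)) = pos2 (R k)))) (read_digits D M u) (read_digits D M v))"
  proof (rule cell_norm_cong)
    fix u v :: nat assume uv: "u < 2 ^ M" "v < 2 ^ M"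
    let ?\<theta> = "\<lambda>i. of_bool (u div 2 ^ (M - lev1 i) = pos1 i \<and> v div 2 ^ (M - lev2 i) = pos2 i) :: real"
    have "(\<Sum>i\<in>?U. (c i * weight p q (lev1 i) (lev2 i))\<^sup>2 * ?\<theta> i)
        = (\<Sum>k\<in>S. \<Sum>i\<in>?E k. (?f k i * weight p q (lev1 i) (lev2 i))\<^sup>2 * ?\<theta> i)"
      unfolding c_def by (rule sum_over_blocks[OF assms(1,2), symmetric])
    also have "\<dots> = (\<Sum>k\<in>S. \<Sum>i\<in>?E k. (\<alpha> k * weight p q (lev1 (R k)) (lev2 (R k)))\<^sup>2 * ?\<theta> i)"
    proof (intro sum.cong refl)
      fix k i assume ki: "k \<in> S" "i \<in> ?E k"
      have "lev1 i = A k" "lev2 i = B k" using ki by (auto simp: block_def)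
      then have 1: "?f k i * weight p q (lev1 i) (lev2 i) = \<epsilon> k i * (\<alpha> k * weight p q (lev1 (R k)) (lev2 (R k)))"
        using weight_pos[of p q "A k" "B k"] by (simp add: lam_def)
      have 2: "(\<epsilon> k i)\<^sup>2 = 1" using sign[OF ki] power2_abs[of "\<epsilon> k i"] by simp
      show "(?f k i * weight p q (lev1 i) (lev2 i))\<^sup>2 * ?\<theta> i = (\<alpha> k * weight p q (lev1 (R k)) (lev2 (R k)))\<^sup>2 * ?\<theta> i"
        by (simp only: 1 2 power_mult_distrib mult_1)
    qed
    also have "\<dots> = (\<Sum>k\<in>S. (\<alpha> k * weight p q (lev1 (R k)) (lev2 (R k)))\<^sup>2 *
       of_bool (read_digits D M u div 2 ^ (digit_count D M - lev1 (R k)) = pos1 (R k) \<and>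
                read_digits D M v div 2 ^ (digit_count D M - lev2 (R k)) = pos2 (R k)))"
      unfolding sum_distrib_left[symmetric]
      by (intro sum.cong refl arg_cong2[where f = "(*)"] sum_block_indicator) (use adm M uv in auto)
    finally show "square_fn ?U c M u v = sqrt (\<Sum>k\<in>S. (\<alpha> k * weight p q (lev1 (R k)) (lev2 (R k)))\<^sup>2 *
       of_bool (read_digits D M u div 2 ^ (digit_count D M - lev1 (R k)) = pos1 (R k) \<and>
                read_digits D M v div 2 ^ (digit_count D M - lev2 (R k)) = pos2 (R k)))"
      unfolding square_fn_def by (rule arg_cong)
  qed
  also have "\<dots> = cell_norm p q (digit_count D M) (\<lambda>u v. sqrt (\<Sum>k\<in>S. (\<alpha> k * weight p q (lev1 (R k)) (lev2 (R k)))\<^sup>2 *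
       of_bool (u div 2 ^ (digit_count D M - lev1 (R k)) = pos1 (R k) \<and>
                v div 2 ^ (digit_count D M - lev2 (R k)) = pos2 (R k))))"
    by (rule cell_norm_read_digits)
  finally show ?thesis .
qed

lemma bounded_levels:
  fixes A B :: "nat \<Rightarrow> nat"
  assumes "finite S" obtains M where "\<And>k. k \<in> S \<Longrightarrow> A k \<le> M \<and> B k \<le> M"
proof
  show "A k \<le> (\<Sum>k\<in>S. A k + B k) \<and> B k \<le> (\<Sum>k\<in>S. A k + B k)" if "k \<in> S" for k
    using member_le_sum[of k S "\<lambda>k. A k + B k"] that assms by simp
qed

lemma norm_blocks_distinct:
  fixes A B R :: "nat \<Rightarrow> nat"
  assumes S: "finite S" "inj_on (\<lambda>k. (A k, B k)) S" and "inj_on R S"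
    and adm: "\<And>k. k \<in> S \<Longrightarrow> admissible D (A k) (B k) (R k)"
    and sign: "\<And>k i. k \<in> S \<Longrightarrow> i \<in> block D (A k) (B k) (R k) \<Longrightarrow> \<bar>\<epsilon> k i\<bar> = 1"
  shows "norm (\<Sum>k\<in>S. \<Sum>i\<in>block D (A k) (B k) (R k). (\<alpha> k * \<epsilon> k i * lam (A k) (B k) (R k)) *\<^sub>R e i)
    = norm (\<Sum>k\<in>S. \<alpha> k *\<^sub>R e (R k))"
proof -
  obtain M where M: "\<And>k. k \<in> S \<Longrightarrow> A k \<le> M \<and> B k \<le> M" using bounded_levels[OF S(1)] by metis
  define \<beta> where "\<beta> i = \<alpha> (the_inv_into S R i)" for i
  have \<beta>: "\<beta> (R k) = \<alpha> k" if "k \<in> S" for k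
    using the_inv_into_f_f[OF assms(3) that] by (simp add: \<beta>_def)
  have "norm (\<Sum>k\<in>S. \<alpha> k *\<^sub>R e (R k)) = norm (\<Sum>i\<in>R ` S. \<beta> i *\<^sub>R e i)"
    by (subst sum.reindex[OF assms(3)]) (simp add: \<beta>)
  also have "\<dots> = cell_norm p q (digit_count D M) (square_fn (R ` S) \<beta> (digit_count D M))"
  proof (rule norm_eq)
    fix i assume "i \<in> R ` S"
    then obtain k where k: "k \<in> S" "i = R k" by blast
    then have "lev1 i = digit_count D (A k)" "lev2 i = digit_count D (B k)"
      using adm by (simp_all add: admissible_def)
    then show "lev1 i \<le> digit_count D M \<and> lev2 i \<le> digit_count D M"
      using M[OF k(1)] digit_count_mono by simp
  qed (simp add: S)
  also have "square_fn (R ` S) \<beta> (digit_count D M) = (\<lambda>u v. sqrt (\<Sum>k\<in>S. (\<alpha> k * weight p q (lev1 (R k)) (lev2 (R k)))\<^sup>2 *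
       of_bool (u div 2 ^ (digit_count D M - lev1 (R k)) = pos1 (R k) \<and>
                v div 2 ^ (digit_count D M - lev2 (R k)) = pos2 (R k))))"
    unfolding square_fn_def[abs_def] by (subst sum.reindex[OF assms(3)]) (simp add: \<beta>)
  finally show ?thesis using norm_blocks[OF S adm M sign, where \<alpha> = \<alpha>] by simp
qed

text \<open>Blocks for one rectangle at different levels behave like an orthogonal sequence.\<close>

lemma norm_blocks_repeated:
  fixes A B :: "nat \<Rightarrow> nat"
  assumes S: "finite S" "inj_on (\<lambda>k. (A k, B k)) S"
    and adm: "\<And>k. k \<in> S \<Longrightarrow> admissible D (A k) (B k) r"
    and sign: "\<And>k i. k \<in> S \<Longrightarrow> i \<in> block D (A k) (B k) r \<Longrightarrow> \<bar>\<epsilon> k i\<bar> = 1"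
  shows "norm (\<Sum>k\<in>S. \<Sum>i\<in>block D (A k) (B k) r. (\<epsilon> k i * lam (A k) (B k) r) *\<^sub>R e i)
    = sqrt (card S) * norm (e r)"
proof (cases "S = {}")
  case False
  then obtain k0 where k0: "k0 \<in> S" by blast
  obtain M where M: "\<And>k. k \<in> S \<Longrightarrow> A k \<le> M \<and> B k \<le> M" using bounded_levels[OF S(1)] by metis
  let ?M = "digit_count D M"
  have "lev1 r \<le> ?M \<and> lev2 r \<le> ?M"
    using adm[OF k0] M[OF k0] digit_count_mono unfolding admissible_def by metis
  then have "norm (\<Sum>k\<in>{r}. 1 *\<^sub>R e k) = cell_norm p q ?M (square_fn {r} (\<lambda>_. 1) ?M)"
    by (intro norm_eq) auto
  moreover have "norm (\<Sum>k\<in>S. \<Sum>i\<in>block D (A k) (B k) r. (1 * \<epsilon> k i * lam (A k) (B k) r) *\<^sub>R e i)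
      = cell_norm p q ?M (\<lambda>u v. sqrt (card S) * square_fn {r} (\<lambda>_. 1) ?M u v)"
    by (rule trans[OF norm_blocks[OF S, where R = "\<lambda>_. r" and \<alpha> = "\<lambda>_. 1", OF adm M sign]])
      (auto simp: square_fn_def real_sqrt_mult intro!: cell_norm_cong)
  ultimately show ?thesis by (simp add: cell_norm_scale[OF p q])
qed simp

section \<open>Averaging over digit flips\<close>

text \<open>The group of flips at positions outside \<open>D\<close>.\<close>

definition null_shifts :: "nat set \<Rightarrow> nat \<Rightarrow> nat set" where
  "null_shifts D M = {g. g < 2 ^ M \<and> read_digits D M g = 0}"

lemma finite_null_shifts: "finite (null_shifts D M)"
  by (simp add: null_shifts_def)

lemma zero_null_shift: "0 \<in> null_shifts D M"
proof -
  have "read_digits D M 0 = 0" by (induction M) auto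
  then show ?thesis by (simp add: null_shifts_def)
qed

lemma xor_null_shift: "g \<in> null_shifts D M \<Longrightarrow> h \<in> null_shifts D M \<Longrightarrow> xor g h \<in> null_shifts D M"
  by (simp add: null_shifts_def xor_less_power read_digits_xor)

lemma sum_null_shifts_xor:
  assumes "g0 \<in> null_shifts D M"
  shows "(\<Sum>g\<in>null_shifts D M. f (xor g g0)) = (\<Sum>g\<in>null_shifts D M. f g)"
  by (rule sum.reindex_bij_witness[where i = "\<lambda>g. xor g g0" and j = "\<lambda>g. xor g g0"])
    (simp_all add: xor_null_shift assms xor_cancel)

lemma null_shift_coarser:
  assumes "g \<in> null_shifts D M" "a \<le> M"
  shows "read_digits D a (xor x (g div 2 ^ (M - a))) = read_digits D a x"
  using assms by (simp add: read_digits_xor read_digits_coarser null_shifts_def)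

lemma shift_block:
  assumes "g \<in> null_shifts D M" "h \<in> null_shifts D M" "a \<le> M" "b \<le> M" "i \<in> block D a b r"
  shows "shift M g h i \<in> block D a b r"
proof -
  have i: "lev1 i = a" "lev2 i = b" "read_digits D a (pos1 i) = pos1 r" "read_digits D b (pos2 i) = pos2 r"
    using assms(5) by (auto simp: block_def)
  have "g < 2 ^ M" "h < 2 ^ M" "lev1 i \<le> M" "lev2 i \<le> M" using assms i by (auto simp: null_shifts_def)
  note code = shift_code[OF this]
  show ?thesis
    unfolding block_def mem_Collect_eq code i
    using null_shift_coarser[OF assms(1,3)] null_shift_coarser[OF assms(2,4)] i by simp
qed

text \<open>Two intervals of a block differ only at positions outside \<open>D\<close>; flip exactly there.\<close>

lemma block_transitive:
  assumes "i \<in> block D a b r" "i' \<in> block D a b r" "a \<le> M" "b \<le> M"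
  obtains g h where "g \<in> null_shifts D M" "h \<in> null_shifts D M" "shift M g h i = i'"
proof -
  have i: "lev1 i = a" "lev2 i = b" "read_digits D a (pos1 i) = pos1 r" "read_digits D b (pos2 i) = pos2 r"
    using assms(1) by (auto simp: block_def)
  have i': "lev1 i' = a" "lev2 i' = b" "read_digits D a (pos1 i') = pos1 r" "read_digits D b (pos2 i') = pos2 r"
    using assms(2) by (auto simp: block_def)
  have lift: "xor x y * 2 ^ (M - c) \<in> null_shifts D M"
    if "x < 2 ^ c" "y < 2 ^ c" "read_digits D c x = read_digits D c y" "c \<le> M" for x y c :: nat
  proof -
    have "xor x y * 2 ^ (M - c) < 2 ^ c * 2 ^ (M - c)"
      by (intro mult_strict_right_mono xor_less_power that) simp
    then show ?thesis
      using that by (simp add: null_shifts_def read_digits_refine read_digits_xor flip: power_add)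
  qed
  \<comment> \<open>The differing digits, moved to the leading \<open>a\<close>, respectively \<open>b\<close>, of \<open>M\<close> places.\<close>
  let ?g = "xor (pos1 i) (pos1 i') * 2 ^ (M - a)" and ?h = "xor (pos2 i) (pos2 i') * 2 ^ (M - b)"
  have gh: "?g \<in> null_shifts D M" "?h \<in> null_shifts D M"
    using pos_less[of i] pos_less[of i'] i i' assms by (auto intro!: lift)
  have "?g < 2 ^ M" "?h < 2 ^ M" "lev1 i \<le> M" "lev2 i \<le> M" using gh assms i by (auto simp: null_shifts_def)
  note code = shift_code[OF this]
  have undo: "xor x (xor x y) = y" for x y :: nat by (simp flip: xor.assoc)
  have "shift M ?g ?h i = i'"
    by (rule code_eqI) (simp_all only: code i i', simp_all add: undo)
  then show thesis using that gh by blast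
qed

text \<open>The sum over the group is constant on the block by transitivity, so it equals its own mean over the block; since each
  flip permutes the block, this mean is computed by exchanging the sums.\<close>

lemma shift_average:
  assumes i: "i \<in> block D a b r" and M: "a \<le> M" "b \<le> M"
  shows "(\<Sum>g\<in>null_shifts D M. \<Sum>h\<in>null_shifts D M. f (shift M g h i))
    = (real (card (null_shifts D M)))\<^sup>2 * ((\<Sum>i\<in>block D a b r. f i) / real (card (block D a b r)))"
proof -
  let ?G = "null_shifts D M" and ?E = "block D a b r"
  define C where "C i = (\<Sum>g\<in>?G. \<Sum>h\<in>?G. f (shift M g h i))" for i
  have less: "g < 2 ^ M" if "g \<in> ?G" for g using that by (simp add: null_shifts_def)
  have levels: "lev1 i \<le> M" "lev2 i \<le> M" if "i \<in> ?E" for i using that M by (auto simp: block_def)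
  have const: "C i' = C i" if i': "i' \<in> ?E" for i'
  proof -
    obtain g0 h0 where g0: "g0 \<in> ?G" "h0 \<in> ?G" "shift M g0 h0 i = i'"
      by (rule block_transitive[OF i i' M])
    have "C i' = (\<Sum>g\<in>?G. \<Sum>h\<in>?G. f (shift M (xor g g0) (xor h h0) i))"
      unfolding C_def
      by (intro sum.cong refl) (simp add: g0(3)[symmetric] shift_shift less g0(1,2) levels[OF i])
    also have "\<dots> = (\<Sum>g\<in>?G. \<Sum>h\<in>?G. f (shift M (xor g g0) h i))"
      by (intro sum.cong refl sum_null_shifts_xor[OF g0(2)])
    also have "\<dots> = C i"
      unfolding C_def by (rule sum_null_shifts_xor[OF g0(1)])
    finally show ?thesis .
  qed
  have "real (card ?E) * C i = (\<Sum>i'\<in>?E. C i')" using const by simp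
  also have "\<dots> = (\<Sum>g\<in>?G. \<Sum>h\<in>?G. \<Sum>i'\<in>?E. f (shift M g h i'))"
    unfolding C_def by (rule sum_rotate)
  also have "\<dots> = (\<Sum>g\<in>?G. \<Sum>h\<in>?G. \<Sum>i'\<in>?E. f i')"
  proof (rule sum.cong[OF refl], rule sum.cong[OF refl])
    fix g h assume gh: "g \<in> ?G" "h \<in> ?G"
    show "(\<Sum>i'\<in>?E. f (shift M g h i')) = (\<Sum>i'\<in>?E. f i')"
      by (rule sum.reindex_bij_witness[where i = "shift M g h" and j = "shift M g h"])
        (use gh M in \<open>auto simp: shift_block shift_shift less levels\<close>)
  qed
  also have "\<dots> = (real (card ?G))\<^sup>2 * (\<Sum>i'\<in>?E. f i')" by (simp add: power2_eq_square)
  finally have "real (card ?E) * C i = (real (card ?G))\<^sup>2 * (\<Sum>i'\<in>?E. f i')" .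
  moreover have "card ?E \<noteq> 0" using i finite_block by auto
  ultimately show ?thesis by (simp add: C_def field_simps)
qed

text \<open>The contractivity of the block projection. The averaged vector is a mean of flipped copies of the vector with
  coefficients \<open>\<bar>c i\<bar>\<close>, restricted to the blocks, and each copy has norm at most that of the original.\<close>

lemma norm_block_averages:
  fixes A B R :: "nat \<Rightarrow> nat"
  assumes S: "finite S" "inj_on (\<lambda>k. (A k, B k)) S" and "finite F" and off: "\<And>i. i \<notin> F \<Longrightarrow> c i = 0"
  shows "norm (\<Sum>k\<in>S. \<Sum>i\<in>block D (A k) (B k) (R k).
      ((\<Sum>i\<in>block D (A k) (B k) (R k). \<bar>c i\<bar>) / real (card (block D (A k) (B k) (R k)))) *\<^sub>R e i)
    \<le> norm (\<Sum>i\<in>F. c i *\<^sub>R e i)"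
proof -
  obtain M where M: "\<And>k. k \<in> S \<Longrightarrow> A k \<le> M \<and> B k \<le> M" using bounded_levels[OF S(1)] by metis
  let ?E = "\<lambda>k. block D (A k) (B k) (R k)" and ?G = "null_shifts D M"
  let ?U = "\<Union>k\<in>S. ?E k" and ?own = "owner S A B"
  define avg where "avg k = (\<Sum>i\<in>?E k. \<bar>c i\<bar>) / real (card (?E k))" for k
  have finU: "finite ?U" using S finite_block by blast
  have levels: "lev1 i \<le> M \<and> lev2 i \<le> M" if "i \<in> ?U" for i using that M by (auto simp: block_def)
  have less: "g < 2 ^ M" if "g \<in> ?G" for g using that by (simp add: null_shifts_def)
  have "(\<Sum>g\<in>?G. \<Sum>h\<in>?G. \<Sum>i\<in>?U. \<bar>c i\<bar> *\<^sub>R e (shift M g h i))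
      = (\<Sum>g\<in>?G. \<Sum>h\<in>?G. \<Sum>i\<in>?U. \<bar>c (shift M g h i)\<bar> *\<^sub>R e i)"
  proof (rule sum.cong[OF refl], rule sum.cong[OF refl])
    fix g h assume gh: "g \<in> ?G" "h \<in> ?G"
    have stay: "shift M g h i \<in> ?U" if "i \<in> ?U" for i
      using that gh M shift_block[of g D M h] by blast
    have inv: "shift M g h (shift M g h i) = i" if "i \<in> ?U" for i
      using gh levels[OF that] by (simp add: shift_shift less)
    show "(\<Sum>i\<in>?U. \<bar>c i\<bar> *\<^sub>R e (shift M g h i)) = (\<Sum>i\<in>?U. \<bar>c (shift M g h i)\<bar> *\<^sub>R e i)"
      by (rule sum.reindex_bij_witness[where i = "shift M g h" and j = "shift M g h"])
        (simp_all only: stay inv)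
  qed
  also have "\<dots> = (\<Sum>i\<in>?U. (\<Sum>g\<in>?G. \<Sum>h\<in>?G. \<bar>c (shift M g h i)\<bar>) *\<^sub>R e i)"
    unfolding scaleR_sum_left
    by (rule sum_rotate[symmetric])
  also have "\<dots> = (\<Sum>i\<in>?U. ((real (card ?G))\<^sup>2 * avg (?own i)) *\<^sub>R e i)"
  proof (intro sum.cong refl arg_cong2[where f = scaleR])
    fix i assume "i \<in> ?U"
    then obtain k where k: "k \<in> S" "i \<in> ?E k" by blast
    show "(\<Sum>g\<in>?G. \<Sum>h\<in>?G. \<bar>c (shift M g h i)\<bar>) = (real (card ?G))\<^sup>2 * avg (?own i)"
      using shift_average[OF k(2), of M "\<lambda>i. \<bar>c i\<bar>"] M[OF k(1)]
      by (simp add: avg_def owner_eq[OF S(2) k])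
  qed
  also have "\<dots> = (real (card ?G))\<^sup>2 *\<^sub>R (\<Sum>i\<in>?U. avg (?own i) *\<^sub>R e i)"
    by (simp add: scaleR_sum_right)
  also have "(\<Sum>i\<in>?U. avg (?own i) *\<^sub>R e i) = (\<Sum>k\<in>S. \<Sum>i\<in>?E k. avg k *\<^sub>R e i)"
    by (rule sum_over_blocks[OF S, symmetric])
  finally have avg: "(\<Sum>g\<in>?G. \<Sum>h\<in>?G. \<Sum>i\<in>?U. \<bar>c i\<bar> *\<^sub>R e (shift M g h i))
    = (real (card ?G))\<^sup>2 *\<^sub>R (\<Sum>k\<in>S. \<Sum>i\<in>?E k. avg k *\<^sub>R e i)" .
  have bound: "norm (\<Sum>i\<in>?U. \<bar>c i\<bar> *\<^sub>R e (shift M g h i)) \<le> norm (\<Sum>i\<in>F. c i *\<^sub>R e i)"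
    if "g \<in> ?G" "h \<in> ?G" for g h
  proof -
    have "norm (\<Sum>i\<in>?U. \<bar>c i\<bar> *\<^sub>R e (shift M g h i)) = norm (\<Sum>i\<in>?U. \<bar>c i\<bar> *\<^sub>R e i)"
      by (rule norm_shift[OF finU levels less[OF that(1)] less[OF that(2)]])
    also have "\<dots> \<le> norm (\<Sum>i\<in>?U \<union> F. c i *\<^sub>R e i)"
      using finU assms(3) by (intro norm_mono) auto
    also have "(\<Sum>i\<in>?U \<union> F. c i *\<^sub>R e i) = (\<Sum>i\<in>F. c i *\<^sub>R e i)"
      using finU assms(3) off by (intro sum.mono_neutral_right) auto
    finally show ?thesis .
  qed
  have "(real (card ?G))\<^sup>2 * norm (\<Sum>k\<in>S. \<Sum>i\<in>?E k. avg k *\<^sub>R e i)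
      = norm (\<Sum>g\<in>?G. \<Sum>h\<in>?G. \<Sum>i\<in>?U. \<bar>c i\<bar> *\<^sub>R e (shift M g h i))"
    unfolding avg by simp
  also have "\<dots> \<le> (\<Sum>g\<in>?G. \<Sum>h\<in>?G. norm (\<Sum>i\<in>F. c i *\<^sub>R e i))"
    by (intro sum_norm_le bound)
  also have "\<dots> = (real (card ?G))\<^sup>2 * norm (\<Sum>i\<in>F. c i *\<^sub>R e i)" by (simp add: power2_eq_square)
  finally have "(real (card ?G))\<^sup>2 * norm (\<Sum>k\<in>S. \<Sum>i\<in>?E k. avg k *\<^sub>R e i)
    \<le> (real (card ?G))\<^sup>2 * norm (\<Sum>i\<in>F. c i *\<^sub>R e i)" .
  moreover have "card ?G \<noteq> 0" using zero_null_shift[of D M] finite_null_shifts[of D M] by auto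
  ultimately show ?thesis unfolding avg_def by simp
qed

section \<open>Block vectors and block functionals\<close>

text \<open>The second family of coefficients is forced by the requirement that the products sum to one, as both families are constant on
  the block.\<close>

definition move :: "nat set \<Rightarrow> nat \<Rightarrow> nat \<Rightarrow> nat \<Rightarrow> move2" where
  "move D a b r = (block D a b r, \<lambda>_. lam a b r, \<lambda>_. 1 / (real (card (block D a b r)) * lam a b r))"

lemma game_vec_move: "game_vec e (move D a b r) \<epsilon> = (\<Sum>i\<in>block D a b r. (\<epsilon> i * lam a b r) *\<^sub>R e i)"
  by (simp add: game_vec_def move_def)

lemma game_fun_move:
  assumes "finite F" "\<And>i. i \<notin> F \<Longrightarrow> c i = 0"
  shows "blinfun_apply (game_fun e (move D a b r) \<epsilon>) (\<Sum>i\<in>F. c i *\<^sub>R e i)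
    = (\<Sum>i\<in>block D a b r. \<epsilon> i * c i) / (real (card (block D a b r)) * lam a b r)"
proof -
  have "blinfun_apply (biorthogonal_functionals e i) (\<Sum>i\<in>F. c i *\<^sub>R e i) = c i" for i
    using assms by (auto simp: biorthogonal_sum)
  then show ?thesis
    by (simp add: game_fun_def move_def blinfun.sum_left blinfun.scaleR_left sum_divide_distrib)
qed

lemma legal2_move:
  assumes "admissible D a b r" shows "legal2 (move D a b r)"
proof -
  have "card (block D a b r) \<noteq> 0" using block_nonempty[OF assms] finite_block by auto
  then show ?thesis
    using lam_pos[of a b r] by (simp add: legal2_def move_def finite_block)
qed

lemma legal3_move_sign: "legal3 (move D a b r) \<epsilon> \<Longrightarrow> i \<in> block D a b r \<Longrightarrow> \<bar>\<epsilon> i\<bar> = 1"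
  unfolding legal3_def move_def by (auto dest: PiE_mem)

text \<open>The signs disappear because the value of a block functional is bounded by the mean of the moduli of the
  coefficients, and those means are controlled by the averaging over flips.\<close>

lemma norm_game_fun_coefficients:
  fixes A B R :: "nat \<Rightarrow> nat"
  assumes S: "finite S" "inj_on (\<lambda>k. (A k, B k)) S" and R: "inj_on R S"
    and adm: "\<And>k. k \<in> S \<Longrightarrow> admissible D (A k) (B k) (R k)"
    and sign: "\<And>k. k \<in> S \<Longrightarrow> legal3 (move D (A k) (B k) (R k)) (\<epsilon> k)"
    and F: "finite F" "\<And>i. i \<notin> F \<Longrightarrow> c i = 0"
  shows "norm (\<Sum>k\<in>S. blinfun_apply (game_fun e (move D (A k) (B k) (R k)) (\<epsilon> k)) (\<Sum>i\<in>F. c i *\<^sub>R e i) *\<^sub>R e (R k))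
    \<le> norm (\<Sum>i\<in>F. c i *\<^sub>R e i)"
proof -
  let ?E = "\<lambda>k. block D (A k) (B k) (R k)" and ?l = "\<lambda>k. lam (A k) (B k) (R k)"
  let ?U = "\<Union>k\<in>S. ?E k" and ?own = "owner S A B"
  define \<alpha> where "\<alpha> k = blinfun_apply (game_fun e (move D (A k) (B k) (R k)) (\<epsilon> k)) (\<Sum>i\<in>F. c i *\<^sub>R e i)" for k
  define avg where "avg k = (\<Sum>i\<in>?E k. \<bar>c i\<bar>) / real (card (?E k))" for k
  have "\<bar>\<alpha> k\<bar> * ?l k \<le> avg k" if k: "k \<in> S" for k
  proof -
    have "\<bar>\<Sum>i\<in>?E k. \<epsilon> k i * c i\<bar> \<le> (\<Sum>i\<in>?E k. \<bar>\<epsilon> k i * c i\<bar>)" by (rule sum_abs)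
    also have "\<dots> = (\<Sum>i\<in>?E k. \<bar>c i\<bar>)"
      by (intro sum.cong refl) (simp add: abs_mult legal3_move_sign[OF sign[OF k]])
    finally have "\<bar>\<Sum>i\<in>?E k. \<epsilon> k i * c i\<bar> / real (card (?E k)) \<le> avg k"
      by (simp add: avg_def divide_right_mono)
    then show ?thesis
      using lam_pos[of "A k" "B k" "R k"] by (simp add: \<alpha>_def game_fun_move[OF F] abs_mult abs_of_pos)
  qed
  then have le: "\<bar>\<alpha> k * 1 * ?l k\<bar> \<le> \<bar>avg k\<bar>" if "k \<in> S" for k
    using that lam_pos[of "A k" "B k" "R k"] by (simp add: abs_mult order_trans[OF _ abs_ge_self])
  have "norm (\<Sum>k\<in>S. \<alpha> k *\<^sub>R e (R k)) = norm (\<Sum>k\<in>S. \<Sum>i\<in>?E k. (\<alpha> k * 1 * ?l k) *\<^sub>R e i)"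
    by (rule norm_blocks_distinct[OF S R adm, symmetric]) auto
  also have "\<dots> = norm (\<Sum>i\<in>?U. (\<alpha> (?own i) * 1 * ?l (?own i)) *\<^sub>R e i)"
    by (subst sum_over_blocks[OF S]) simp
  also have "\<dots> \<le> norm (\<Sum>i\<in>?U. avg (?own i) *\<^sub>R e i)"
  proof (rule norm_mono)
    show "finite ?U" using S finite_block by blast
    show "\<bar>\<alpha> (?own i) * 1 * ?l (?own i)\<bar> \<le> \<bar>avg (?own i)\<bar>" if "i \<in> ?U" for i
      using that owner_eq[OF S(2)] le by auto
  qed simp
  also have "(\<Sum>i\<in>?U. avg (?own i) *\<^sub>R e i) = (\<Sum>k\<in>S. \<Sum>i\<in>?E k. avg k *\<^sub>R e i)"
    by (rule sum_over_blocks[OF S, symmetric])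
  also have "norm \<dots> \<le> norm (\<Sum>i\<in>F. c i *\<^sub>R e i)"
    unfolding avg_def by (rule norm_block_averages[OF S F])
  finally show ?thesis unfolding \<alpha>_def .
qed

lemma norm_sum_game_vec:
  fixes A B :: "nat \<Rightarrow> nat"
  assumes "finite S" "inj_on (\<lambda>k. (A k, B k)) S"
    and "\<And>k. k \<in> S \<Longrightarrow> admissible D (A k) (B k) k"
    and "\<And>k. k \<in> S \<Longrightarrow> legal3 (move D (A k) (B k) k) (\<epsilon> k)"
  shows "norm (\<Sum>k\<in>S. a k *\<^sub>R game_vec e (move D (A k) (B k) k) (\<epsilon> k)) = norm (\<Sum>k\<in>S. a k *\<^sub>R e k)"
proof -
  have "\<bar>\<epsilon> k i\<bar> = 1" if "k \<in> S" "i \<in> block D (A k) (B k) k" for k i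
    using legal3_move_sign[OF assms(4)[OF that(1)] that(2)] .
  from norm_blocks_distinct[OF assms(1,2), where R = "\<lambda>k. k" and \<alpha> = a, OF _ assms(3) this]
  show ?thesis by (simp add: game_vec_move scaleR_sum_right mult.assoc)
qed

lemma game_fun_game_vec:
  assumes adm: "admissible D (A k) (B k) k" and inj: "inj (\<lambda>k. (A k, B k))"
    and sign: "legal3 (move D (A k) (B k) k) (\<epsilon> k)"
  shows "blinfun_apply (game_fun e (move D (A k) (B k) k) (\<epsilon> k)) (game_vec e (move D (A l) (B l) l) (\<epsilon> l))
    = (if k = l then 1 else 0)"
proof -
  let ?E = "\<lambda>k. block D (A k) (B k) k" and ?l = "\<lambda>k. lam (A k) (B k) k"
  define c where "c i = (if i \<in> ?E l then \<epsilon> l i * ?l l else 0)" for i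
  have vec: "game_vec e (move D (A l) (B l) l) (\<epsilon> l) = (\<Sum>i\<in>?E l. c i *\<^sub>R e i)"
    unfolding game_vec_move by (intro sum.cong refl) (simp add: c_def)
  have eq: "blinfun_apply (game_fun e (move D (A k) (B k) k) (\<epsilon> k)) (game_vec e (move D (A l) (B l) l) (\<epsilon> l))
     = (\<Sum>i\<in>?E k. \<epsilon> k i * c i) / (real (card (?E k)) * ?l k)"
    unfolding vec by (rule game_fun_move[OF finite_block]) (simp add: c_def)
  show ?thesis
  proof (cases "k = l")
    case True
    have "\<epsilon> k i * c i = ?l k" if "i \<in> ?E k" for i
    proof -
      have "\<epsilon> k i * \<epsilon> k i = 1" using legal3_move_sign[OF sign that] by (metis abs_mult_self_eq mult_1)
      then show ?thesis using that True by (simp add: c_def flip: mult.assoc)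
    qed
    then have "(\<Sum>i\<in>?E k. \<epsilon> k i * c i) = real (card (?E k)) * ?l k" by simp
    moreover have "card (?E k) \<noteq> 0" using block_nonempty[OF adm] finite_block by auto
    ultimately show ?thesis using True lam_pos[of "A k" "B k" k] unfolding eq by simp
  next
    case False
    have "c i = 0" if "i \<in> ?E k" for i
    proof -
      have "i \<notin> ?E l"
      proof
        assume "i \<in> ?E l"
        with that have "(A k, B k) = (A l, B l)" by (simp add: block_def)
        with False show False using injD[OF inj] by blast
      qed
      then show ?thesis by (simp add: c_def)
    qed
    then show ?thesis using False unfolding eq by simp
  qed
qed

text \<open>Both inequalities are dualized isometries: the block projection, which is a contraction, bounds the block functionals by the
  biorthogonal ones, and the isometric embedding of the basis as block vectors gives the converse.\<close>

lemma norm_sum_game_fun: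
  fixes A B :: "nat \<Rightarrow> nat"
  assumes S: "finite S" and inj: "inj (\<lambda>k. (A k, B k))"
    and adm: "\<And>k. admissible D (A k) (B k) k"
    and sign: "\<And>k. legal3 (move D (A k) (B k) k) (\<epsilon> k)"
  shows "norm (\<Sum>k\<in>S. a k *\<^sub>R game_fun e (move D (A k) (B k) k) (\<epsilon> k))
    = norm (\<Sum>k\<in>S. a k *\<^sub>R biorthogonal_functionals e k)"
proof (rule antisym)
  let ?v = "\<lambda>k. game_vec e (move D (A k) (B k) k) (\<epsilon> k)"
    and ?f = "\<lambda>k. game_fun e (move D (A k) (B k) k) (\<epsilon> k)"
  have inj_on: "inj_on (\<lambda>k. (A k, B k)) T" for T using inj by (rule inj_on_subset) simp
  show "norm (\<Sum>k\<in>S. a k *\<^sub>R ?f k) \<le> norm (\<Sum>k\<in>S. a k *\<^sub>R biorthogonal_functionals e k)"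
  proof (rule functional_norm_le)
    fix F :: "nat set" and c :: "nat \<Rightarrow> real" assume F: "finite F"
    define d where "d i = (if i \<in> F then c i else 0)" for i
    have y: "(\<Sum>i\<in>F. c i *\<^sub>R e i) = (\<Sum>i\<in>F. d i *\<^sub>R e i)"
      by (intro sum.cong refl) (simp add: d_def)
    let ?y = "\<Sum>i\<in>F. d i *\<^sub>R e i"
    have d: "\<And>i. i \<notin> F \<Longrightarrow> d i = 0" by (simp add: d_def)
    \<comment> \<open>The block projection of \<open>?y\<close>, read off in the basis.\<close>
    let ?z = "\<Sum>k\<in>S. blinfun_apply (?f k) ?y *\<^sub>R e k"
    have "blinfun_apply (\<Sum>k\<in>S. a k *\<^sub>R ?f k) ?y = blinfun_apply (\<Sum>k\<in>S. a k *\<^sub>R biorthogonal_functionals e k) ?z"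
      using S by (simp add: blinfun.sum_left blinfun.scaleR_left biorthogonal_sum)
    then have "\<bar>blinfun_apply (\<Sum>k\<in>S. a k *\<^sub>R ?f k) ?y\<bar>
        \<le> norm (\<Sum>k\<in>S. a k *\<^sub>R biorthogonal_functionals e k) * norm ?z"
      using norm_blinfun[of "\<Sum>k\<in>S. a k *\<^sub>R biorthogonal_functionals e k" ?z] by simp
    also have "\<dots> \<le> norm (\<Sum>k\<in>S. a k *\<^sub>R biorthogonal_functionals e k) * norm ?y"
      using norm_game_fun_coefficients[OF S inj_on, where R = "\<lambda>k. k", OF _ adm sign F d]
      by (intro mult_left_mono) auto
    finally show "\<bar>blinfun_apply (\<Sum>k\<in>S. a k *\<^sub>R ?f k) (\<Sum>i\<in>F. c i *\<^sub>R e i)\<bar>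
      \<le> norm (\<Sum>k\<in>S. a k *\<^sub>R biorthogonal_functionals e k) * norm (\<Sum>i\<in>F. c i *\<^sub>R e i)"
      unfolding y .
  qed simp
  show "norm (\<Sum>k\<in>S. a k *\<^sub>R biorthogonal_functionals e k) \<le> norm (\<Sum>k\<in>S. a k *\<^sub>R ?f k)"
  proof (rule functional_norm_le)
    fix F :: "nat set" and c :: "nat \<Rightarrow> real" assume F: "finite F"
    let ?y = "\<Sum>i\<in>F. c i *\<^sub>R e i" and ?x = "\<Sum>i\<in>F. c i *\<^sub>R ?v i"
    have "blinfun_apply (?f k) ?x = blinfun_apply (biorthogonal_functionals e k) ?y" for k
      using F game_fun_game_vec[where A = A and B = B and \<epsilon> = \<epsilon>, OF adm inj sign]
      by (simp add: blinfun.sum_right blinfun.scaleR_right biorthogonal)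
    then have "\<bar>blinfun_apply (\<Sum>k\<in>S. a k *\<^sub>R biorthogonal_functionals e k) ?y\<bar>
        = \<bar>blinfun_apply (\<Sum>k\<in>S. a k *\<^sub>R ?f k) ?x\<bar>"
      by (simp add: blinfun.sum_left blinfun.scaleR_left)
    also have "\<dots> \<le> norm (\<Sum>k\<in>S. a k *\<^sub>R ?f k) * norm ?x"
      using norm_blinfun[of "\<Sum>k\<in>S. a k *\<^sub>R ?f k" ?x] by simp
    also have "norm ?x = norm ?y"
      by (rule norm_sum_game_vec[OF F inj_on adm sign])
    finally show "\<bar>blinfun_apply (\<Sum>k\<in>S. a k *\<^sub>R biorthogonal_functionals e k) ?y\<bar>
      \<le> norm (\<Sum>k\<in>S. a k *\<^sub>R ?f k) * norm ?y" .
  qed simp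
qed

text \<open>If the functional were at least \<open>\<delta>\<close> in modulus on infinitely many block vectors, then on a sum of \<open>N\<close> of them with
  suitable signs it would be at least \<open>N * \<delta>\<close>, while the norm of this sum grows only like \<open>sqrt N\<close>.\<close>

lemma functional_small_on_late_blocks:
  fixes A B :: "nat \<Rightarrow> nat" and f :: "'a \<Rightarrow>\<^sub>L real"
  assumes inj: "inj (\<lambda>l. (A l, B l))" and adm: "\<And>l. admissible D (A l) (B l) r" and "0 < \<delta>"
  shows "\<forall>\<^sub>F l in sequentially. \<forall>\<epsilon>. legal3 (move D (A l) (B l) r) \<epsilon> \<longrightarrow>
    \<bar>blinfun_apply f (game_vec e (move D (A l) (B l) r) \<epsilon>)\<bar> < \<delta>"
proof (rule ccontr)
  let ?P = "\<lambda>l \<epsilon>. legal3 (move D (A l) (B l) r) \<epsilon> \<and>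
    \<delta> \<le> \<bar>blinfun_apply f (game_vec e (move D (A l) (B l) r) \<epsilon>)\<bar>"
  assume "\<not> ?thesis"
  then have "\<exists>\<^sub>F l in sequentially. \<exists>\<epsilon>. ?P l \<epsilon>"
    unfolding frequently_def by (simp add: not_le)
  then have inf: "infinite {l. \<exists>\<epsilon>. ?P l \<epsilon>}"
    by (simp add: frequently_cofinite flip: cofinite_eq_sequentially)
  define \<epsilon> where "\<epsilon> l = (SOME \<epsilon>. ?P l \<epsilon>)" for l
  have \<epsilon>: "?P l (\<epsilon> l)" if "\<exists>\<epsilon>. ?P l \<epsilon>" for l
    unfolding \<epsilon>_def using someI_ex[OF that] .
  \<comment> \<open>The threshold at which \<open>N * \<delta>\<close> overtakes \<open>norm f * sqrt N * norm (e r)\<close>.\<close>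
  obtain N :: nat where N: "(norm f * norm (e r) / \<delta>)\<^sup>2 < real N" using reals_Archimedean2 by blast
  obtain S where S: "S \<subseteq> {l. \<exists>\<epsilon>. ?P l \<epsilon>}" "finite S" "card S = N"
    using infinite_arbitrarily_large[OF inf] by blast
  have SP: "?P l (\<epsilon> l)" if "l \<in> S" for l using \<epsilon> S(1) that by blast
  define s where "s l = sgn (blinfun_apply f (game_vec e (move D (A l) (B l) r) (\<epsilon> l)))" for l
  have s1: "\<bar>s l\<bar> = 1" if "l \<in> S" for l
    using SP[OF that] assms(3) by (auto simp: s_def abs_sgn_eq)
  let ?x = "\<lambda>l. \<Sum>i\<in>block D (A l) (B l) r. (s l * \<epsilon> l i * lam (A l) (B l) r) *\<^sub>R e i"
  have x: "?x l = s l *\<^sub>R game_vec e (move D (A l) (B l) r) (\<epsilon> l)" for l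
    by (simp add: game_vec_move scaleR_sum_right mult.assoc)
  have fx: "\<delta> \<le> blinfun_apply f (?x l)" if "l \<in> S" for l
    using SP[OF that] unfolding x by (simp add: blinfun.scaleR_right s_def abs_sgn mult.commute)
  have "norm (\<Sum>l\<in>S. ?x l) = sqrt (card S) * norm (e r)"
  proof (rule norm_blocks_repeated[OF S(2) _ adm])
    show "inj_on (\<lambda>l. (A l, B l)) S" using inj by (rule inj_on_subset) simp
    show "\<bar>s l * \<epsilon> l i\<bar> = 1" if "l \<in> S" "i \<in> block D (A l) (B l) r" for l i
      using s1[OF that(1)] legal3_move_sign[of D "A l" "B l" r "\<epsilon> l" i] SP[OF that(1)] that(2)
      by (simp add: abs_mult)
  qed
  moreover have "real N * \<delta> \<le> blinfun_apply f (\<Sum>l\<in>S. ?x l)"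
    using sum_bounded_below[of S \<delta> "\<lambda>l. blinfun_apply f (?x l)"] fx S(3) by (simp add: blinfun.sum_right)
  moreover have "blinfun_apply f (\<Sum>l\<in>S. ?x l) \<le> norm f * norm (\<Sum>l\<in>S. ?x l)"
    using norm_blinfun[of f "\<Sum>l\<in>S. ?x l"] by simp
  ultimately have "real N * \<delta> \<le> norm f * (sqrt (real N) * norm (e r))" using S(3) by simp
  moreover have "real N > 0" using N by (meson le_less_trans zero_le_power2)
  ultimately have "sqrt (real N) * (sqrt (real N) * \<delta>) \<le> sqrt (real N) * (norm f * norm (e r))"
    by (simp add: algebra_simps flip: real_sqrt_mult)
  then have "sqrt (real N) * \<delta> \<le> norm f * norm (e r)"
    using \<open>real N > 0\<close> by (simp only: mult_le_cancel_left_pos real_sqrt_gt_zero)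
  then have "sqrt (real N) \<le> norm f * norm (e r) / \<delta>"
    using assms(3) by (simp add: pos_le_divide_eq)
  then have "(sqrt (real N))\<^sup>2 \<le> (norm f * norm (e r) / \<delta>)\<^sup>2" by (intro power_mono) auto
  then show False using N by simp
qed

lemma norm_game_fun_le:
  assumes "admissible D a b r" "legal3 (move D a b r) \<epsilon>"
  shows "norm (game_fun e (move D a b r) \<epsilon>) \<le> 1 / norm (e r)"
proof (rule functional_norm_le)
  fix F :: "nat set" and c :: "nat \<Rightarrow> real" assume F: "finite F"
  define d where "d i = (if i \<in> F then c i else 0)" for i
  have y: "(\<Sum>i\<in>F. c i *\<^sub>R e i) = (\<Sum>i\<in>F. d i *\<^sub>R e i)"
    by (intro sum.cong refl) (simp add: d_def)
  have "norm (\<Sum>k\<in>{0::nat}. blinfun_apply (game_fun e (move D a b r) \<epsilon>) (\<Sum>i\<in>F. d i *\<^sub>R e i) *\<^sub>R e r)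
      \<le> norm (\<Sum>i\<in>F. d i *\<^sub>R e i)"
    by (rule norm_game_fun_coefficients[where A = "\<lambda>_. a" and B = "\<lambda>_. b" and R = "\<lambda>_. r" and \<epsilon> = "\<lambda>_. \<epsilon>"])
      (simp_all add: assms F d_def)
  then show "\<bar>blinfun_apply (game_fun e (move D a b r) \<epsilon>) (\<Sum>i\<in>F. c i *\<^sub>R e i)\<bar>
      \<le> 1 / norm (e r) * norm (\<Sum>i\<in>F. c i *\<^sub>R e i)"
    unfolding y using e_nonzero[of r] by (simp add: field_simps)
qed simp

text \<open>The functionals are uniformly bounded, and a finite combination of basis vectors meets only finitely many of the
  blocks.\<close>

lemma late_block_functionals_small:
  fixes A B :: "nat \<Rightarrow> nat" and w :: 'a
  assumes inj: "inj (\<lambda>l. (A l, B l))" and adm: "\<And>l. admissible D (A l) (B l) r" and "0 < \<delta>"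
  shows "\<forall>\<^sub>F l in sequentially. \<forall>\<epsilon>. legal3 (move D (A l) (B l) r) \<epsilon> \<longrightarrow>
    \<bar>blinfun_apply (game_fun e (move D (A l) (B l) r) \<epsilon>) w\<bar> < \<delta>"
proof -
  have "0 < \<delta> * norm (e r)" using assms(3) e_nonzero[of r] by simp
  moreover have "w \<in> closure {\<Sum>i\<in>A. c i *\<^sub>R e i | A c. finite A}" using dense_span by simp
  ultimately obtain F c where F: "finite F" and close: "dist (\<Sum>i\<in>F. c i *\<^sub>R e i) w < \<delta> * norm (e r)"
    unfolding closure_approachable by blast
  define d where "d i = (if i \<in> F then c i else 0)" for i
  have y: "(\<Sum>i\<in>F. c i *\<^sub>R e i) = (\<Sum>i\<in>F. d i *\<^sub>R e i)"
    by (intro sum.cong refl) (simp add: d_def)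
  let ?y = "\<Sum>i\<in>F. d i *\<^sub>R e i"
  have "finite {l. (A l, B l) \<in> (\<lambda>i. (lev1 i, lev2 i)) ` F}"
    using finite_vimageI[OF finite_imageI[OF F] inj, of "\<lambda>i. (lev1 i, lev2 i)"] by (simp add: vimage_def)
  then have "\<forall>\<^sub>F l in sequentially. (A l, B l) \<notin> (\<lambda>i. (lev1 i, lev2 i)) ` F"
    by (simp add: eventually_cofinite flip: cofinite_eq_sequentially)
  then show ?thesis
  proof (rule eventually_mono, intro allI impI)
    fix l \<epsilon> assume l: "(A l, B l) \<notin> (\<lambda>i. (lev1 i, lev2 i)) ` F" and \<epsilon>: "legal3 (move D (A l) (B l) r) \<epsilon>"
    let ?f = "game_fun e (move D (A l) (B l) r) \<epsilon>"
    have "d i = 0" if "i \<in> block D (A l) (B l) r" for i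
      using that l by (force simp: block_def d_def)
    then have "blinfun_apply ?f ?y = 0"
      by (subst game_fun_move[OF F]) (simp_all add: d_def)
    then have "\<bar>blinfun_apply ?f w\<bar> = \<bar>blinfun_apply ?f (w - ?y)\<bar>" by (simp add: blinfun.diff_right)
    also have "\<dots> \<le> norm ?f * norm (w - ?y)"
      using norm_blinfun[of ?f "w - ?y"] by simp
    also have "\<dots> \<le> 1 / norm (e r) * norm (w - ?y)"
      by (intro mult_right_mono norm_game_fun_le adm \<epsilon>) simp
    also have "\<dots> < \<delta>"
      using close e_nonzero[of r] unfolding y by (simp add: field_simps dist_norm norm_minus_commute)
    finally show "\<bar>blinfun_apply ?f w\<bar> < \<delta>" .
  qed
qed

lemma late_blocks_good:
  fixes A B :: "nat \<Rightarrow> nat"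
  assumes inj: "inj (\<lambda>l. (A l, B l))" and adm: "\<And>l. admissible D (A l) (B l) r"
    and "0 < \<eta>" "W \<in> cof" "G \<in> cof_wstar"
  shows "\<forall>\<^sub>F l in sequentially. \<forall>\<epsilon>. legal3 (move D (A l) (B l) r) \<epsilon> \<longrightarrow>
    infdist (game_vec e (move D (A l) (B l) r) \<epsilon>) W < \<eta> \<and>
    infdist (game_fun e (move D (A l) (B l) r) \<epsilon>) G < \<eta>"
proof -
  obtain n K and f :: "nat \<Rightarrow> 'a \<Rightarrow>\<^sub>L real" where
    KW: "(\<forall>i. 0 \<le> K i) \<and> (\<forall>x. infdist x W \<le> (\<Sum>i<n. \<bar>blinfun_apply (f i) x\<bar> * K i))"
    using cof_infdist_bound[OF assms(4)] by blast
  obtain n' K' and w :: "nat \<Rightarrow> 'a" where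
    KG: "(\<forall>i. 0 \<le> K' i) \<and> (\<forall>g. infdist g G \<le> (\<Sum>i<n'. \<bar>blinfun_apply g (w i)\<bar> * K' i))"
    using cof_wstar_infdist_bound[OF assms(5)] by blast
  have K: "0 \<le> K i" "0 \<le> K' i" for i using KW KG by blast+
  note W = KW[THEN conjunct2, rule_format] and G = KG[THEN conjunct2, rule_format]
  \<comment> \<open>The summand \<open>1\<close> makes the bounds strict, also if there are no functionals at all.\<close>
  define s where "s = 1 + (\<Sum>i<n. K i) + (\<Sum>i<n'. K' i)"
  have nn: "0 \<le> (\<Sum>i<n. K i)" "0 \<le> (\<Sum>i<n'. K' i)" using K by (simp_all add: sum_nonneg)
  define \<delta> where "\<delta> = \<eta> / s"
  have \<delta>: "0 < \<delta>" and bound: "\<delta> * (\<Sum>i<n. K i) < \<eta>" "\<delta> * (\<Sum>i<n'. K' i) < \<eta>"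
    using nn assms(3) by (auto simp: \<delta>_def s_def field_simps intro!: add_pos_nonneg)
  have "\<forall>\<^sub>F l in sequentially. \<forall>i\<in>{..<n}. \<forall>\<epsilon>. legal3 (move D (A l) (B l) r) \<epsilon> \<longrightarrow>
      \<bar>blinfun_apply (f i) (game_vec e (move D (A l) (B l) r) \<epsilon>)\<bar> < \<delta>"
    by (intro eventually_ball_finite ballI functional_small_on_late_blocks[OF inj adm \<delta>]) simp
  moreover have "\<forall>\<^sub>F l in sequentially. \<forall>i\<in>{..<n'}. \<forall>\<epsilon>. legal3 (move D (A l) (B l) r) \<epsilon> \<longrightarrow>
      \<bar>blinfun_apply (game_fun e (move D (A l) (B l) r) \<epsilon>) (w i)\<bar> < \<delta>"
    by (intro eventually_ball_finite ballI late_block_functionals_small[OF inj adm \<delta>]) simp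
  ultimately show ?thesis
  proof (rule eventually_elim2, intro allI impI conjI)
    fix l \<epsilon> assume small: "\<forall>i\<in>{..<n}. \<forall>\<epsilon>. legal3 (move D (A l) (B l) r) \<epsilon> \<longrightarrow>
        \<bar>blinfun_apply (f i) (game_vec e (move D (A l) (B l) r) \<epsilon>)\<bar> < \<delta>"
      "\<forall>i\<in>{..<n'}. \<forall>\<epsilon>. legal3 (move D (A l) (B l) r) \<epsilon> \<longrightarrow>
        \<bar>blinfun_apply (game_fun e (move D (A l) (B l) r) \<epsilon>) (w i)\<bar> < \<delta>"
      and \<epsilon>: "legal3 (move D (A l) (B l) r) \<epsilon>"
    have "infdist (game_vec e (move D (A l) (B l) r) \<epsilon>) W \<le> (\<Sum>i<n. \<delta> * K i)"
      using small(1) \<epsilon> K by (intro order_trans[OF W] sum_mono mult_right_mono) (auto intro: less_imp_le)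
    then show "infdist (game_vec e (move D (A l) (B l) r) \<epsilon>) W < \<eta>"
      using bound(1) by (simp add: sum_distrib_left)
    have "infdist (game_fun e (move D (A l) (B l) r) \<epsilon>) G \<le> (\<Sum>i<n'. \<delta> * K' i)"
      using small(2) \<epsilon> K by (intro order_trans[OF G] sum_mono mult_right_mono) (auto intro: less_imp_le)
    then show "infdist (game_fun e (move D (A l) (B l) r) \<epsilon>) G < \<eta>"
      using bound(2) by (simp add: sum_distrib_left)
  qed
qed

section \<open>The strategy\<close>

definition shell :: "nat \<Rightarrow> nat" where
  "shell k = max (lev1 k) (lev2 k)"

lemma shell_0: "shell 0 = 0"
proof -
  have "shell (index (0, 0, 0, 0)) = 0" by (simp add: shell_def)
  then show ?thesis using shell_mono[of 0 "index (0, 0, 0, 0)"] by (simp add: shell_def)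
qed

text \<open>Every value of the maximal level occurs, so none is skipped.\<close>

lemma shell_Suc: "shell k \<le> shell (Suc k)" "shell (Suc k) \<le> Suc (shell k)"
proof -
  show "shell k \<le> shell (Suc k)" using shell_mono[of k "Suc k"] by (simp add: shell_def)
  \<comment> \<open>A rectangle whose maximal level is the next value; it cannot come before position \<open>Suc k\<close>.\<close>
  define r where "r = index (Suc (shell k), 0, 0, 0)"
  have r: "shell r = Suc (shell k)" by (simp add: shell_def r_def)
  have "\<not> r \<le> k" using shell_mono[of r k] r unfolding shell_def by linarith
  then have "Suc k \<le> r" by simp
  from shell_mono[OF this] r show "shell (Suc k) \<le> Suc (shell k)" unfolding shell_def by linarith
qed

text \<open>The least admissible level, for the coordinate in which the rectangle is not maximal.\<close>

definition coarse :: "nat set \<Rightarrow> nat \<Rightarrow> nat" where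
  "coarse D j = (LEAST a. digit_count D a = j)"

lemma coarse:
  assumes "j \<le> digit_count D l"
  shows "digit_count D (coarse D j) = j" "coarse D j \<le> l"
proof -
  obtain a where a: "a \<le> l" "digit_count D a = j" by (rule digit_count_attained[OF assms])
  show "digit_count D (coarse D j) = j" unfolding coarse_def by (rule LeastI[of _ a]) (rule a)
  show "coarse D j \<le> l" unfolding coarse_def using Least_le[of "\<lambda>a. digit_count D a = j" a] a by simp
qed

text \<open>The levels of the block for the rectangle of index \<open>k\<close>: in a coordinate of maximal level the free level \<open>l\<close>, in the other one the
  least admissible level. In case of a tie the first coordinate is the free one.\<close>

definition s_level :: "nat set \<Rightarrow> nat \<Rightarrow> nat \<Rightarrow> nat" where
  "s_level D k l = (if lev1 k < lev2 k then coarse D (lev1 k) else l)"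

definition t_level :: "nat set \<Rightarrow> nat \<Rightarrow> nat \<Rightarrow> nat" where
  "t_level D k l = (if lev1 k < lev2 k then l else coarse D (lev2 k))"

lemma digit_count_all: "D \<subseteq> {1..l} \<Longrightarrow> digit_count D l = card D"
  by (simp add: digit_count_def Int_absorb2)

lemma levels_admissible:
  assumes "D \<subseteq> {1..l}" "card D = shell k"
  shows "admissible D (s_level D k l) (t_level D k l) k"
    and "max (s_level D k l) (t_level D k l) = l"
proof -
  have l: "digit_count D l = max (lev1 k) (lev2 k)" using digit_count_all[OF assms(1)] assms(2) by (simp add: shell_def)
  show "admissible D (s_level D k l) (t_level D k l) k"
    using l coarse(1)[of "lev1 k" D l] coarse(1)[of "lev2 k" D l]
    by (auto simp: admissible_def s_level_def t_level_def)
  show "max (s_level D k l) (t_level D k l) = l"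
    using l coarse(2)[of "lev1 k" D l] coarse(2)[of "lev2 k" D l]
    by (auto simp: s_level_def t_level_def)
qed

definition turn_move :: "nat set \<Rightarrow> nat \<Rightarrow> nat \<Rightarrow> move2" where
  "turn_move D k l = move D (s_level D k l) (t_level D k l) k"

definition good_level :: "nat set \<Rightarrow> nat \<Rightarrow> 'a move1 \<Rightarrow> nat \<Rightarrow> bool" where
  "good_level D k m l \<longleftrightarrow> (case m of (\<eta>, W, G) \<Rightarrow> \<forall>\<epsilon>. legal3 (turn_move D k l) \<epsilon> \<longrightarrow>
     infdist (game_vec e (turn_move D k l) \<epsilon>) W < \<eta> \<and> infdist (game_fun e (turn_move D k l) \<epsilon>) G < \<eta>)"

lemma good_level_exists:
  assumes D: "D \<subseteq> {1..n}" "card D = shell k" and m: "legal1 m"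
  shows "\<exists>l\<ge>n. good_level D k m l"
proof -
  obtain \<eta> W G where mm: "m = (\<eta>, W, G)" by (cases m)
  have legal: "0 < \<eta>" "W \<in> cof" "G \<in> cof_wstar" using m by (simp_all add: legal1_def mm)
  \<comment> \<open>Only free levels from \<open>n\<close> on are admissible, hence the offset.\<close>
  have D': "D \<subseteq> {1..n + l}" for l using D(1) by auto
  have inj: "inj (\<lambda>l. (s_level D k (n + l), t_level D k (n + l)))"
    by (rule injI) (auto simp: s_level_def t_level_def split: if_splits)
  have "\<forall>\<^sub>F l in sequentially. \<forall>\<epsilon>. legal3 (move D (s_level D k (n + l)) (t_level D k (n + l)) k) \<epsilon> \<longrightarrow>
    infdist (game_vec e (move D (s_level D k (n + l)) (t_level D k (n + l)) k) \<epsilon>) W < \<eta> \<and>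
    infdist (game_fun e (move D (s_level D k (n + l)) (t_level D k (n + l)) k) \<epsilon>) G < \<eta>"
    by (rule late_blocks_good[OF inj levels_admissible(1)[OF D' D(2)] legal])
  then obtain l where "good_level D k m (n + l)"
    unfolding eventually_sequentially good_level_def mm turn_move_def by auto
  then show ?thesis by (intro exI[of _ "n + l"]) simp
qed

text \<open>The set of digit positions must have as many elements as the maximal level of the current rectangle. A new
  position \<open>n\<close> is added when this maximal level has just increased.\<close>

definition next_digits :: "nat \<Rightarrow> nat set \<times> nat \<Rightarrow> nat set" where
  "next_digits k = (\<lambda>(D, n). if card D = shell k then D else insert n D)"

definition next_level :: "nat \<Rightarrow> nat set \<times> nat \<Rightarrow> 'a move1 \<Rightarrow> nat" where
  "next_level k Dn m = (SOME l. snd Dn \<le> l \<and> good_level (next_digits k Dn) k m l)"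

text \<open>Before turn \<open>k\<close>, the state holds the digit positions chosen so far and a number larger than all levels used so far.\<close>

primrec state :: "(nat \<Rightarrow> 'a move1) \<Rightarrow> nat \<Rightarrow> nat set \<times> nat" where
  "state m 0 = ({}, 0)"
| "state m (Suc k) = (next_digits k (state m k), Suc (next_level k (state m k) (m k)))"

definition digits :: "(nat \<Rightarrow> 'a move1) \<Rightarrow> nat \<Rightarrow> nat set" where
  "digits m k = next_digits k (state m k)"

definition level :: "(nat \<Rightarrow> 'a move1) \<Rightarrow> nat \<Rightarrow> nat" where
  "level m k = next_level k (state m k) (m k)"

text \<open>The list \<open>ms\<close> contains the move of the current turn, so its length exceeds the number of completed turns by one.\<close>

definition strategy :: "'a strategy" where
  "strategy ms signs = (let k = length ms - 1; m = (\<lambda>i. ms ! i) in turn_move (digits m k) k (level m k))"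

lemma state_cong: "(\<And>i. i < k \<Longrightarrow> m i = m' i) \<Longrightarrow> state m k = state m' k"
  by (induction k) auto

lemma strategy_moves_eq: "strategy_moves strategy m signs k = turn_move (digits m k) k (level m k)"
proof -
  let ?m = "\<lambda>i. map m [0..<Suc k] ! i"
  have m: "?m i = m i" if "i \<le> k" for i
    using that nth_map[of i "[0..<Suc k]" m] nth_upt[of 0 i "Suc k"] by simp
  then have "state ?m k = state m k" by (intro state_cong) simp
  then show ?thesis
    unfolding strategy_moves_def strategy_def Let_def digits_def level_def
    using m[of k] by simp
qed

lemma state_invariant:
  assumes "\<And>k. legal1 (m k)"
  shows "fst (state m k) \<subseteq> {1..<snd (state m k)} \<and> card (fst (state m k)) = shell (k - 1) \<and> (0 < k \<longrightarrow> 0 < snd (state m k))"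
    and "digits m k \<subseteq> {1..level m k} \<and> card (digits m k) = shell k \<and> snd (state m k) \<le> level m k \<and> good_level (digits m k) k (m k) (level m k)"
proof -
  have step: "digits m k \<subseteq> {1..snd (state m k)} \<and> card (digits m k) = shell k \<and> snd (state m k) \<le> level m k \<and> good_level (digits m k) k (m k) (level m k)"
    if inv: "fst (state m k) \<subseteq> {1..<snd (state m k)}" "card (fst (state m k)) = shell (k - 1)"
      "0 < k \<longrightarrow> 0 < snd (state m k)" for k
  proof -
    obtain D n where Dn: "state m k = (D, n)" by (cases "state m k")
    have D: "D \<subseteq> {1..<n}" "card D = shell (k - 1)" "0 < k \<longrightarrow> 0 < n" using inv Dn by simp_all
    have "finite D" "n \<notin> D" using D(1) finite_subset by auto
    have sub: "digits m k \<subseteq> {1..n}" and card: "card (digits m k) = shell k"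
    proof -
      show "digits m k \<subseteq> {1..n}"
      proof (cases "card D = shell k")
        case False
        then have "0 < k" using D(2) by (cases "k = 0") auto
        then have "insert n D \<subseteq> {1..n}" using D(1,3) by auto
        then show ?thesis using False by (simp add: digits_def next_digits_def Dn)
      next
        case True
        have "D \<subseteq> {1..n}" using D(1) by auto
        then show ?thesis using True by (simp add: digits_def next_digits_def Dn)
      qed
      show "card (digits m k) = shell k"
      proof (cases "card D = shell k")
        case False
        then obtain k' where "k = Suc k'" using D(2) shell_0 by (cases k) auto
        then have "shell k = Suc (card D)" using False D(2) shell_Suc[of k'] by simp
        then show ?thesis using False \<open>finite D\<close> \<open>n \<notin> D\<close> by (simp add: digits_def next_digits_def Dn)
      qed (simp add: digits_def next_digits_def Dn)
    qed
    have "\<exists>l. n \<le> l \<and> good_level (digits m k) k (m k) l"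
      using good_level_exists[OF sub card assms] by auto
    from someI_ex[OF this] have "n \<le> level m k \<and> good_level (digits m k) k (m k) (level m k)"
      by (simp add: level_def next_level_def Dn digits_def)
    then show ?thesis using sub card Dn by simp
  qed
  show inv: "fst (state m k) \<subseteq> {1..<snd (state m k)} \<and> card (fst (state m k)) = shell (k - 1) \<and> (0 < k \<longrightarrow> 0 < snd (state m k))" for k
  proof (induction k)
    case (Suc k)
    then have "digits m k \<subseteq> {1..snd (state m k)}" "card (digits m k) = shell k" "snd (state m k) \<le> level m k"
      using step[of k] by auto
    moreover have "state m (Suc k) = (digits m k, Suc (level m k))" by (simp add: digits_def level_def)
    ultimately show ?case by auto
  qed (simp add: shell_0)
  show "digits m k \<subseteq> {1..level m k} \<and> card (digits m k) = shell k \<and> snd (state m k) \<le> level m k \<and> good_level (digits m k) k (m k) (level m k)"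
    using step[of k] inv[of k] by auto
qed

lemma digits_Suc: "digits m (Suc k) = digits m k \<or> digits m (Suc k) = insert (Suc (level m k)) (digits m k)"
proof -
  have "state m (Suc k) = (digits m k, Suc (level m k))" by (simp add: digits_def level_def)
  then show ?thesis by (auto simp: digits_def[of m "Suc k"] next_digits_def)
qed

lemma level_strict_mono:
  assumes "\<And>k. legal1 (m k)" shows "strict_mono (level m)"
  unfolding strict_mono_Suc_iff
proof
  fix k
  have "state m (Suc k) = (digits m k, Suc (level m k))" by (simp add: digits_def level_def)
  then show "level m k < level m (Suc k)" using state_invariant(2)[of m "Suc k", OF assms] by simp
qed

text \<open>Positions that are added later exceed all levels used before, so every turn may be judged by the final digit set.\<close>

lemma digits_later:
  assumes "\<And>k. legal1 (m k)"
  shows "(\<Union>j. digits m j) \<inter> {1..level m k} = digits m k"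
proof -
  have mono: "digits m j \<subseteq> digits m (j + i)" for i j
  proof (induction i)
    case (Suc i)
    then show ?case using digits_Suc[of m "j + i"] by auto
  qed simp
  have "digits m (k + i) \<inter> {1..level m k} \<subseteq> digits m k" for i
  proof (induction i)
    case (Suc i)
    have "level m k \<le> level m (k + i)"
      using level_strict_mono[OF assms] by (simp add: strict_mono_less_eq)
    then show ?case using Suc digits_Suc[of m "k + i"] by auto
  qed simp
  moreover have "digits m j \<inter> {1..level m k} \<subseteq> digits m k" if "j \<le> k" for j
    using mono[of j "k - j"] that by auto
  ultimately have "digits m j \<inter> {1..level m k} \<subseteq> digits m k" for j
    by (metis le_Suc_ex nat_le_linear)
  moreover have "digits m k \<subseteq> {1..level m k}" using state_invariant(2)[of m k, OF assms] by blast
  ultimately show ?thesis by blast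
qed

text \<open>The free level of turn \<open>k\<close> is the larger level of its block and increases with \<open>k\<close>, so the pairs of levels are distinct.\<close>

lemma winning_strategy_strategy:
  assumes "1 \<le> C" shows "winning_strategy e C strategy"
  unfolding winning_strategy_def
proof (intro allI impI)
  fix m :: "nat \<Rightarrow> 'a move1" and \<epsilon> :: "nat \<Rightarrow> move3"
  assume *: "(\<forall>k. legal1 (m k)) \<and> (\<forall>k. legal3 (strategy_moves strategy m \<epsilon> k) (\<epsilon> k))"
  then have legal: "\<And>k. legal1 (m k)" by blast
  define D where "D = (\<Union>j. digits m j)"
  define A where "A k = s_level (digits m k) k (level m k)" for k
  define B where "B k = t_level (digits m k) k (level m k)" for k
  note inv = state_invariant(2)[of m, OF legal]
  have max: "max (A k) (B k) = level m k" and adm': "admissible (digits m k) (A k) (B k) k" for k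
    using levels_admissible[of "digits m k" "level m k" k] inv[of k] by (simp_all add: A_def B_def)
  have same: "D \<inter> {1..a} = digits m k \<inter> {1..a}" if "a \<le> level m k" for a k
  proof -
    have "{1..a} \<subseteq> {1..level m k}" using that by simp
    then show ?thesis using digits_later[of m k, OF legal] unfolding D_def by blast
  qed
  have AB: "A k \<le> level m k" "B k \<le> level m k" for k
    using max[of k] by (metis max.cobounded1, metis max.cobounded2)
  have adm: "admissible D (A k) (B k) k" for k
    using adm'[of k] digit_count_cong[OF same[OF AB(1)]] digit_count_cong[OF same[OF AB(2)]]
    by (simp add: admissible_def)
  have moves: "strategy_moves strategy m \<epsilon> k = move D (A k) (B k) k" for k
  proof -
    have "block D (A k) (B k) k = block (digits m k) (A k) (B k) k"
      by (rule block_cong[OF same[OF AB(1)] same[OF AB(2)]])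
    then show ?thesis
      unfolding strategy_moves_eq turn_move_def move_def by (simp add: A_def B_def)
  qed
  have inj: "inj (\<lambda>k. (A k, B k))"
  proof (rule injI)
    fix k l assume "(A k, B k) = (A l, B l)"
    then have "level m k = level m l" using max[of k] max[of l] by simp
    then show "k = l" using level_strict_mono[OF legal] by (simp add: strict_mono_eq)
  qed
  have sign: "legal3 (move D (A k) (B k) k) (\<epsilon> k)" for k
    using * moves by simp
  have "II_wins e C m (strategy_moves strategy m \<epsilon>) \<epsilon>"
    unfolding II_wins_def
  proof (intro conjI allI)
    show "impartially_equivalent C (\<lambda>k. game_vec e (strategy_moves strategy m \<epsilon> k) (\<epsilon> k)) e"
      unfolding moves
      by (intro impartially_equivalent_isometric assms norm_sum_game_vec adm sign inj_on_subset[OF inj]) auto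
    show "impartially_equivalent C (\<lambda>k. game_fun e (strategy_moves strategy m \<epsilon> k) (\<epsilon> k)) (biorthogonal_functionals e)"
      unfolding moves
      by (intro impartially_equivalent_isometric assms norm_sum_game_fun adm sign inj)
    show "case m k of (\<eta>, W, G) \<Rightarrow>
        infdist (game_vec e (strategy_moves strategy m \<epsilon> k) (\<epsilon> k)) W < \<eta> \<and>
        infdist (game_fun e (strategy_moves strategy m \<epsilon> k) (\<epsilon> k)) G < \<eta>" for k
      using inv[of k] * unfolding good_level_def strategy_moves_eq by (auto split: prod.splits)
  qed
  then show "(\<forall>k. legal2 (strategy_moves strategy m \<epsilon> k)) \<and> II_wins e C m (strategy_moves strategy m \<epsilon>) \<epsilon>"
    using legal2_move[OF adm] unfolding moves by simp
qed

theorem strategically_reproducible: "strategically_reproducible e"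
  unfolding strategically_reproducible_def C_strategically_reproducible_def
  using unconditional_basis winning_strategy_strategy
  by (intro exI[of _ 1]) (auto intro!: exI[of _ strategy])

end

section \<open>The Haar system in a completion\<close>

lemma weight_normalization:
  "1 / ((1 / 2 ^ m) powr (1 / p) * (1 / 2 ^ n) powr (1 / q)) = weight p q m n"
proof -
  have "(1 / 2 ^ m) powr r = 2 powr (- (real m * r))" for m r
    by (simp add: powr_realpow[symmetric] powr_minus_divide[symmetric] powr_powr)
  then show ?thesis
    by (simp add: weight_def powr_add[symmetric] powr_minus_divide)
qed

lemma haar_sum_in_span: "finite F \<Longrightarrow> F \<subseteq> dyadic_rects \<Longrightarrow> haar_sum F a \<in> haar_span"
  by (auto simp: haar_span_def)

lemma Hpq_completion_haar_sum:
  assumes "Hpq_completion p q \<iota>" "finite F" "F \<subseteq> dyadic_rects"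
  shows "\<iota> (haar_sum F a) = (\<Sum>R\<in>F. a R *\<^sub>R \<iota> (haar2 R))"
  using assms(2,3)
proof (induction F rule: finite_induct)
  case empty
  have "\<iota> (\<lambda>x. 0 * haar_sum {} a x) = 0 *\<^sub>R \<iota> (haar_sum {} a)"
    using assms(1) haar_sum_in_span[of "{}" a] unfolding Hpq_completion_def by blast
  then show ?case by (simp add: haar_sum_def[abs_def])
next
  case (insert R F)
  have single: "haar2 R \<in> haar_span"
    using haar_sum_in_span[of "{R}" "\<lambda>_. 1"] insert.prems by (simp add: haar_sum_def[abs_def])
  have scaled: "(\<lambda>x. a R * haar2 R x) \<in> haar_span"
    using haar_sum_in_span[of "{R}" a] insert.prems by (simp add: haar_sum_def[abs_def])
  have add: "\<forall>f\<in>haar_span. \<forall>g\<in>haar_span. \<iota> (\<lambda>x. f x + g x) = \<iota> f + \<iota> g"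
    using assms(1) by (simp add: Hpq_completion_def)
  have rest: "haar_sum F a \<in> haar_span" using haar_sum_in_span[of F a] insert by simp
  have split: "haar_sum (insert R F) a = (\<lambda>x. a R * haar2 R x + haar_sum F a x)"
    using insert.hyps by (simp add: haar_sum_def[abs_def])
  have "\<iota> (haar_sum (insert R F) a) = \<iota> (\<lambda>x. a R * haar2 R x) + \<iota> (haar_sum F a)"
    unfolding split by (rule bspec[OF bspec[OF add scaled] rest])
  also have "\<iota> (\<lambda>x. a R * haar2 R x) = a R *\<^sub>R \<iota> (haar2 R)"
    using assms(1) single unfolding Hpq_completion_def by simp
  finally show ?case using insert by simp
qed

text \<open>The model applies to any completion: \<open>\<iota>\<close> is linear and isometric on the span, and the squared Haar
  functions are indicator functions of products of cells.\<close>

lemma haar_model_Hpq: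
  fixes \<iota> :: "(real \<times> real \<Rightarrow> real) \<Rightarrow> 'a::banach" and lev1 pos1 lev2 pos2 :: "nat \<Rightarrow> nat"
  assumes "1 \<le> p" "1 \<le> q" and \<iota>: "Hpq_completion p q \<iota>"
    and rect: "\<And>k. rect_enum k = (cell (lev1 k) (pos1 k), cell (lev2 k) (pos2 k))"
    and bij: "bij_betw (\<lambda>k. (lev1 k, pos1 k, lev2 k, pos2 k)) UNIV codes"
    and mono: "\<And>k l. k \<le> l \<Longrightarrow> max (lev1 k) (lev2 k) \<le> max (lev1 l) (lev2 l)"
  shows "haar_model p q (\<lambda>k. \<iota> (normalized_haar2 p q (rect_enum k))) lev1 pos1 lev2 pos2"
proof
  let ?w = "\<lambda>k. weight p q (lev1 k) (lev2 k)"
  let ?e = "\<lambda>k. \<iota> (normalized_haar2 p q (rect_enum k))"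
  have enum: "bij_betw rect_enum UNIV dyadic_rects" using rect_enum_props by blast
  have inj: "inj_on rect_enum F" for F using enum by (metis bij_betw_imp_inj_on inj_on_subset top_greatest)
  have mem: "rect_enum k \<in> dyadic_rects" for k using enum by (auto simp: bij_betw_def)
  have e: "?e k = ?w k *\<^sub>R \<iota> (haar2 (rect_enum k))" for k
  proof -
    have "normalized_haar2 p q (rect_enum k) = (\<lambda>x. ?w k * haar2 (rect_enum k) x)"
      unfolding weight_normalization[symmetric]
      by (simp add: normalized_haar2_def[abs_def] rect ilen_cell)
    moreover have "haar2 (rect_enum k) \<in> haar_span"
      using haar_sum_in_span[of "{rect_enum k}" "\<lambda>_. 1"] mem by (simp add: haar_sum_def[abs_def])
    ultimately show ?thesis using \<iota> unfolding Hpq_completion_def by simp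
  qed
  have sum_e: "\<iota> (haar_sum (rect_enum ` F) a) = (\<Sum>k\<in>F. (a (rect_enum k) / ?w k) *\<^sub>R ?e k)"
    if "finite F" for F a
    using weight_pos[of p q] that mem
    by (subst Hpq_completion_haar_sum[OF \<iota>]) (auto simp: sum.reindex[OF inj] e less_imp_neq[symmetric])
  show "norm (\<Sum>k\<in>F. c k *\<^sub>R ?e k) = cell_norm p q M (\<lambda>u v. sqrt (\<Sum>k\<in>F.
        (c k * ?w k)\<^sup>2 * of_bool (u div 2 ^ (M - lev1 k) = pos1 k \<and> v div 2 ^ (M - lev2 k) = pos2 k)))"
    if F: "finite F" "\<And>k. k \<in> F \<Longrightarrow> lev1 k \<le> M \<and> lev2 k \<le> M" for F M c
  proof -
    define a where "a R = c (inv rect_enum R) * ?w (inv rect_enum R)" for R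
    have a: "a (rect_enum k) = c k * ?w k" for k using inj[of UNIV] by (simp add: a_def)
    have "(\<Sum>k\<in>F. c k *\<^sub>R ?e k) = \<iota> (haar_sum (rect_enum ` F) a)"
      using weight_pos[of p q] by (subst sum_e[OF F(1)]) (simp add: a less_imp_neq[symmetric])
    then have "norm (\<Sum>k\<in>F. c k *\<^sub>R ?e k) = Hpq_norm p q (rect_enum ` F) a"
    proof -
      have "finite (rect_enum ` F)" "rect_enum ` F \<subseteq> dyadic_rects" using F(1) mem by auto
      then have "norm (\<iota> (haar_sum (rect_enum ` F) a)) = Hpq_norm p q (rect_enum ` F) a"
        using \<iota> unfolding Hpq_completion_def by blast
      with \<open>(\<Sum>k\<in>F. c k *\<^sub>R ?e k) = \<iota> (haar_sum (rect_enum ` F) a)\<close> show ?thesis by simp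
    qed
    also have "\<dots> = mixed_norm p q (\<lambda>x. sqrt (\<Sum>k\<in>F. (c k * ?w k)\<^sup>2 * (haar2 (rect_enum k) x)\<^sup>2))"
      unfolding Hpq_norm_def by (simp add: sum.reindex[OF inj] a)
    also have "\<dots> = cell_norm p q M (\<lambda>u v. sqrt (\<Sum>k\<in>F.
        (c k * ?w k)\<^sup>2 * of_bool (u div 2 ^ (M - lev1 k) = pos1 k \<and> v div 2 ^ (M - lev2 k) = pos2 k)))"
    proof (rule mixed_norm_step)
      fix u v s t assume st: "s \<in> cell M u" "t \<in> cell M v"
      have "(haar2 (rect_enum k) (s, t))\<^sup>2 = of_bool (u div 2 ^ (M - lev1 k) = pos1 k \<and> v div 2 ^ (M - lev2 k) = pos2 k)"
        if "k \<in> F" for k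
        using mem_cell_coarser[OF st(1), of "lev1 k" "pos1 k"] mem_cell_coarser[OF st(2), of "lev2 k" "pos2 k"] F(2)[OF that]
        by (simp add: rect haar2_cell_sq indicator_def)
      then show "sqrt (\<Sum>k\<in>F. (c k * ?w k)\<^sup>2 * (haar2 (rect_enum k) (s, t))\<^sup>2) = sqrt (\<Sum>k\<in>F.
        (c k * ?w k)\<^sup>2 * of_bool (u div 2 ^ (M - lev1 k) = pos1 k \<and> v div 2 ^ (M - lev2 k) = pos2 k))"
        by simp
    qed
    finally show ?thesis .
  qed
  have "\<iota> ` haar_span \<subseteq> {\<Sum>i\<in>A. c i *\<^sub>R ?e i | A c. finite A}"
  proof
    fix x assume "x \<in> \<iota> ` haar_span"
    then obtain F a where F: "finite F" "F \<subseteq> dyadic_rects" and x: "x = \<iota> (haar_sum F a)"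
      by (auto simp: haar_span_def)
    have "F = rect_enum ` (rect_enum -` F)" using F(2) enum by (auto simp: bij_betw_def)
    moreover have "finite (rect_enum -` F)" using F(1) inj[of UNIV] by (rule finite_vimageI)
    ultimately have "x = (\<Sum>k\<in>rect_enum -` F. (a (rect_enum k) / ?w k) *\<^sub>R ?e k)"
      using sum_e[of "rect_enum -` F" a] x by simp
    then show "x \<in> {\<Sum>i\<in>A. c i *\<^sub>R ?e i | A c. finite A}"
      using \<open>finite (rect_enum -` F)\<close> by (intro CollectI exI conjI)
  qed
  then have "closure (\<iota> ` haar_span) \<subseteq> closure {\<Sum>i\<in>A. c i *\<^sub>R ?e i | A c. finite A}"
    by (rule closure_mono)
  moreover have "closure (\<iota> ` haar_span) = UNIV" using \<iota> by (simp add: Hpq_completion_def)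
  ultimately show "closure {\<Sum>i\<in>A. c i *\<^sub>R ?e i | A c. finite A} = UNIV" by blast
qed (use assms in auto)

theorem theorem5p3:
  fixes p q :: real
    and \<iota> :: "(real \<times> real \<Rightarrow> real) \<Rightarrow> 'a::banach"
  assumes "1 \<le> p" and "1 \<le> q"
    and "Hpq_completion p q \<iota>"
  shows "strategically_reproducible (\<lambda>k. \<iota> (normalized_haar2 p q (rect_enum k)))"
proof (rule rect_enum_codes)
  fix lev1 pos1 lev2 pos2 :: "nat \<Rightarrow> nat"
  assume "\<And>k. rect_enum k = (cell (lev1 k) (pos1 k), cell (lev2 k) (pos2 k))"
    "bij_betw (\<lambda>k. (lev1 k, pos1 k, lev2 k, pos2 k)) UNIV codes"
    "\<And>k l. k \<le> l \<Longrightarrow> max (lev1 k) (lev2 k) \<le> max (lev1 l) (lev2 l)"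
  then have "haar_model p q (\<lambda>k. \<iota> (normalized_haar2 p q (rect_enum k))) lev1 pos1 lev2 pos2"
    by (rule haar_model_Hpq[OF assms])
  then show ?thesis by (rule haar_model.strategically_reproducible)
qed

end
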